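(* Let $(R,\mathfrak m)$ be an $F$-finite regular local ring of characteristic $p>0$ and let $\mathfrak a\subseteq R$ be a nonzero proper ideal. Let $d=\operatorname{ord}_{\mathfrak m}(\mathfrak a)$ and write $d=qs$ where $q$ is a power of $p$ (with $q=p^0=1$ allowed) and $s$ is a positive integer coprime to $p$. Then $\operatorname{fpt}(\mathfrak a)=\frac1d$ if and only if $\mathfrak a$ is a principal ideal and there exists $g\in\mathfrak m^{[q]}$ such that $\mathfrak a=g^sR$.
   Context: All rings are commutative and Noetherian. A ring $R$ of characteristic $p>0$ is $F$-finite if the Frobenius map $F:R\to R$, $z\mapsto z^p$, is finite. For an ideal $I$ and $q=p^e$, $I^{[q]}$ denotes the ideal generated by $\{z^{q}: z\in I\}$. For a nonzero proper ideal $\mathfrak a$ of a local ring $(R,\mathfrak m)$, $\operatorname{ord}_{\mathfrak m}(\mathfrak a)$ is the greatest integer $d$ with $\mathfrak a\subseteq\mathfrak m^d$. For a proper ideal $\mathfrak a$ of an $F$-finite regular local ring $(R,\mathfrak m)$ of characteristic $p$, the $F$-pure threshold is $$\operatorname{fpt}(\mathfrak a)=\sup\left\{\tfrac{t}{p^e}: t,e\in\mathbb Z_{\ge 0},\ \mathfrak a^t\not\subseteq\mathfrak m^{[p^e]}\right\}.$$ *)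

theory Defs
  imports "HOL-Algebra.Algebra" "HOL-Library.Extended_Nat" Complex_Main
begin

definition ring_char :: "('a, 'b) ring_scheme \<Rightarrow> nat" where
  "ring_char R =
    (if \<exists>n::nat. n > 0 \<and> [n] \<cdot>\<^bsub>R\<^esub> \<one>\<^bsub>R\<^esub> = \<zero>\<^bsub>R\<^esub>
     then (LEAST n::nat. n > 0 \<and> [n] \<cdot>\<^bsub>R\<^esub> \<one>\<^bsub>R\<^esub> = \<zero>\<^bsub>R\<^esub>) else 0)"

text \<open>A ring homomorphism is finite if it makes its target a finitely generated module over
  its source.\<close>

definition finite_ring_hom ::
    "('a, 'm) ring_scheme \<Rightarrow> ('b, 'n) ring_scheme \<Rightarrow> ('a \<Rightarrow> 'b) \<Rightarrow> bool" where
  "finite_ring_hom R S h \<longleftrightarrow> h \<in> ring_hom R S \<and>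
    (\<exists>B. finite B \<and> B \<subseteq> carrier S \<and>
      (\<forall>x\<in>carrier S. \<exists>c\<in>B \<rightarrow> carrier R. x = (\<Oplus>\<^bsub>S\<^esub>b\<in>B. h (c b) \<otimes>\<^bsub>S\<^esub> b)))"

definition F_finite :: "nat \<Rightarrow> ('a, 'b) ring_scheme \<Rightarrow> bool" where
  "F_finite p R \<longleftrightarrow> finite_ring_hom R R (\<lambda>z. z [^]\<^bsub>R\<^esub> p)"

definition krull_dim :: "('a, 'b) ring_scheme \<Rightarrow> enat" where
  "krull_dim R = Sup {enat n | n. \<exists>P :: nat \<Rightarrow> 'a set.
     (\<forall>i\<le>n. primeideal (P i) R) \<and> (\<forall>i<n. P i \<subset> P (Suc i))}"

text \<open>Minimal number of generators; only meaningful for finitely generated ideals.\<close>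

definition min_gens :: "('a, 'b) ring_scheme \<Rightarrow> 'a set \<Rightarrow> nat" where
  "min_gens R I = (LEAST n. \<exists>B. finite B \<and> card B = n \<and> B \<subseteq> carrier R \<and> I = Idl\<^bsub>R\<^esub> B)"

locale noetherian_local_ring = cring R + noetherian_ring R
  for R (structure) and \<mm> +
  assumes maximal: "maximalideal \<mm> R"
    and maximal_unique: "maximalideal I R \<Longrightarrow> I = \<mm>"

locale regular_local_ring = noetherian_local_ring +
  assumes regular: "enat (min_gens R \<mm>) = krull_dim R"

text \<open>In \<open>ideals_set R\<close> the multiplication is the product of ideals and the unit is
  \<open>carrier R\<close>; so the zeroth power of every ideal is \<open>carrier R\<close>.\<close>

abbreviation ideal_pow :: "('a, 'b) ring_scheme \<Rightarrow> 'a set \<Rightarrow> nat \<Rightarrow> 'a set" where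
  "ideal_pow R I n \<equiv> I [^]\<^bsub>ideals_set R\<^esub> n"

definition frobenius_pow :: "('a, 'b) ring_scheme \<Rightarrow> 'a set \<Rightarrow> nat \<Rightarrow> 'a set" where
  "frobenius_pow R I q = Idl\<^bsub>R\<^esub> ((\<lambda>z. z [^]\<^bsub>R\<^esub> q) ` I)"

text \<open>For a nonzero proper ideal of a Noetherian local ring the maximum exists, by Krull's
  intersection theorem.\<close>

definition ideal_ord :: "('a, 'b) ring_scheme \<Rightarrow> 'a set \<Rightarrow> 'a set \<Rightarrow> nat" where
  "ideal_ord R \<mm> \<aa> = (GREATEST d. \<aa> \<subseteq> ideal_pow R \<mm> d)"

text \<open>For a proper ideal of a regular local ring the set is nonempty (\<open>t = e = 0\<close>) and bounded
  above by \<open>min_gens R \<mm>\<close>, so the real supremum is the intended one.\<close>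

definition fpt :: "nat \<Rightarrow> ('a, 'b) ring_scheme \<Rightarrow> 'a set \<Rightarrow> 'a set \<Rightarrow> real" where
  "fpt p R \<mm> \<aa> = Sup {real t / real p ^ e | t e :: nat.
     \<not> ideal_pow R \<aa> t \<subseteq> frobenius_pow R \<mm> (p ^ e)}"

end

theory Submission
  imports Defs
begin

text \<open>Let \<open>Q\<close> range over the powers of \<open>p\<close> with \<open>Q = s r + 1\<close>, and let \<open>f \<in> \<aa>\<close> have order
  \<open>d = q s\<close>. If \<open>fpt(\<aa>) = 1/d\<close>, then \<open>f\<^sup>a \<in> (\<mm>\<^sup>[\<^sup>q\<^sup>])\<^sup>c\<^sup>[\<^sup>Q\<^sup>]\<close> whenever \<open>a s \<ge> c Q\<close>; this uses that a
  fixed nonzero multiple of \<open>z\<^sup>Q\<close> lies in \<open>I\<^sup>[\<^sup>Q\<^sup>]\<close> for all \<open>Q\<close> only if \<open>z \<in> I\<close>, by flatness of Frobenius.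
  For a suitable regular parameter \<open>x\<close> one has \<open>f \<equiv> u x\<^sup>q\<^sup>s\<close> with a unit \<open>u\<close> modulo the \<open>q\<close>-th powers of
  the other parameters. Comparing \<open>f\<^sup>a \<equiv> A x\<^sup>q\<^sup>(\<^sup>s\<^sup>-\<^sup>1\<^sup>)\<^sup>Q\<close> for \<open>a s = (s - 1) Q + 1\<close> with
  \<open>f\<^sup>a\<^sup>s = f (f\<^sup>Q)\<^sup>s\<^sup>-\<^sup>1\<close> modulo the \<open>qQ\<close>-th powers of the other parameters, where \<open>x\<close> is a nonzerodivisor,
  shows that \<open>f\<close> is \<open>u\<close> times an \<open>s\<close>-th power modulo \<open>\<mm>\<^sup>Q\<close>. These approximate roots assemble to an exact
  one without passing to the completion: the smallest ideal \<open>J\<close> with \<open>f\<^sup>r\<^sup>+\<^sup>1 \<in> J\<^sup>[\<^sup>Q\<^sup>]\<close>, for one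
  large \<open>Q\<close>, exists because \<open>R\<close> is free over its \<open>Q\<close>-th powers, it satisfies
  \<open>f \<in> J\<^sup>s\<close> and \<open>J \<subseteq> \<mm>\<^sup>[\<^sup>q\<^sup>]\<close>, and modulo every \<open>\<mm>\<^sup>n\<close> it is generated by an approximate root, so it is
  principal. Finally the same cancellation applied to \<open>f\<^sup>i h\<^sup>l\<close> with \<open>h \<in> \<aa>\<close> gives \<open>h \<in> (f)\<close>.\<close>

text \<open>The supremum never has to be computed. Since f^t has order exactly d t, the threshold is
  at least 1/d in any case, so equality only says that \<aa>^t lies in \<mm>^[p^k] whenever d t >
  p^k. This inequality is strict, while the memberships wanted sit on its boundary; a fixed power of
  f as extra factor makes it strict, and the factor can be removed because every ideal of a regular
  ring is tightly closed. The form Q = s r + 1 makes f^Q equal to f times an s-th power, so that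
  s-th roots of f can be read off from powers of f; coprimality of s and p provides such Q of any
  size. The obstacle is that R need not be complete: there are no power series, and units need not
  have s-th roots. Power series are replaced by ideals generated by powers of all parameters but
  one, modulo which the remaining parameter can be cancelled. The unit is carried along to the end,
  where it disappears because only ideals are compared. Dimension theory is built from the
  definition of regularity, with saturation at a prime in place of localization.\<close>

no_notation Sum_Type.Plus (infixr \<open><+>\<close> 65)

section \<open>Elementary arithmetic of ideals\<close>

context cring
begin

lemma one_ideals_set [simp]: "\<one>\<^bsub>ideals_set R\<^esub> = carrier R"
  by (simp add: ideals_set_def)

lemma mult_ideals_set [simp]: "I \<otimes>\<^bsub>ideals_set R\<^esub> J = I \<cdot> J"
  by (simp add: ideals_set_def)

lemma minus_add_cancel: "a \<in> carrier R \<Longrightarrow> b \<in> carrier R \<Longrightarrow> (a \<ominus> b) \<oplus> b = a"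
  by algebra

lemma add_minus_cancel: "a \<in> carrier R \<Longrightarrow> b \<in> carrier R \<Longrightarrow> (a \<oplus> b) \<ominus> a = b"
  by algebra

lemma add_add_minus_cancel:
  "a \<in> carrier R \<Longrightarrow> b \<in> carrier R \<Longrightarrow> c \<in> carrier R \<Longrightarrow> (a \<oplus> c) \<oplus> (b \<ominus> c) = a \<oplus> b"
  by algebra

lemma r_minus_distr:
  "a \<in> carrier R \<Longrightarrow> b \<in> carrier R \<Longrightarrow> c \<in> carrier R \<Longrightarrow> a \<otimes> (b \<ominus> c) = a \<otimes> b \<ominus> a \<otimes> c"
  by algebra

lemma l_minus_distr:
  "a \<in> carrier R \<Longrightarrow> b \<in> carrier R \<Longrightarrow> c \<in> carrier R \<Longrightarrow> (b \<ominus> c) \<otimes> a = b \<otimes> a \<ominus> c \<otimes> a"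
  by algebra

lemma ideal_add_closed: "ideal I R \<Longrightarrow> a \<in> I \<Longrightarrow> b \<in> I \<Longrightarrow> a \<oplus> b \<in> I"
  by (simp add: additive_subgroup.a_closed ideal.axioms(1))

lemma ideal_zero_mem: "ideal I R \<Longrightarrow> \<zero> \<in> I"
  by (simp add: additive_subgroup.zero_closed ideal.axioms(1))

lemma ideal_a_inv_closed: "ideal I R \<Longrightarrow> a \<in> I \<Longrightarrow> \<ominus> a \<in> I"
  by (simp add: additive_subgroup.a_inv_closed ideal.axioms(1))

lemma ideal_minus_closed: "ideal I R \<Longrightarrow> a \<in> I \<Longrightarrow> b \<in> I \<Longrightarrow> a \<ominus> b \<in> I"
  by (simp add: a_minus_def ideal_add_closed ideal_a_inv_closed)

lemma ideal_subset_carrier: "ideal I R \<Longrightarrow> I \<subseteq> carrier R"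
  by (meson ideal.Icarr subsetI)

lemma ideal_finsum_closed:
  assumes "ideal I R" "finite A" "\<And>a. a \<in> A \<Longrightarrow> h a \<in> I"
  shows "(\<Oplus>a\<in>A. h a) \<in> I"
  using assms(2,3)
proof (induction A rule: finite_induct)
  case empty
  then show ?case using assms(1) by (simp add: ideal_zero_mem)
next
  case (insert x F)
  have "h \<in> F \<rightarrow> carrier R" "h x \<in> carrier R"
    using insert.prems ideal.Icarr[OF assms(1)] by auto
  then show ?case using insert assms(1) by (simp add: ideal_add_closed)
qed

lemma ideal_if_closed:
  assumes "I \<subseteq> carrier R" "\<zero> \<in> I"
    and add: "\<And>a b. a \<in> I \<Longrightarrow> b \<in> I \<Longrightarrow> a \<oplus> b \<in> I"
    and mult: "\<And>a r. a \<in> I \<Longrightarrow> r \<in> carrier R \<Longrightarrow> r \<otimes> a \<in> I"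
  shows "ideal I R"
proof (rule idealI)
  show "ring R" by (rule ring_axioms)
  show "subgroup I (add_monoid R)"
  proof (rule group.subgroupI)
    show "group (add_monoid R)" by (rule add.is_group)
    fix a assume a: "a \<in> I"
    have "\<ominus> a = \<ominus> \<one> \<otimes> a" using a assms(1) by (simp add: l_minus subset_iff)
    then show "inv\<^bsub>add_monoid R\<^esub> a \<in> I" using mult[OF a, of "\<ominus> \<one>"] by (simp add: a_inv_def)
  qed (use assms in \<open>auto\<close>)
  fix a x assume a: "a \<in> I" and x: "x \<in> carrier R"
  show "x \<otimes> a \<in> I" by (rule mult[OF a x])
  then show "a \<otimes> x \<in> I" using a x assms(1) by (metis m_comm subsetD)
qed

lemma set_add_iff: "x \<in> I <+> J \<longleftrightarrow> (\<exists>i\<in>I. \<exists>j\<in>J. x = i \<oplus> j)"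
  by (auto simp: set_add_def set_mult_def)

lemma set_addI: "i \<in> I \<Longrightarrow> j \<in> J \<Longrightarrow> i \<oplus> j \<in> I <+> J"
  by (auto simp: set_add_iff)

lemma subset_set_add:
  assumes "ideal I R" "ideal J R"
  shows "I \<subseteq> I <+> J" "J \<subseteq> I <+> J"
proof -
  show "I \<subseteq> I <+> J"
  proof
    fix x assume "x \<in> I"
    then show "x \<in> I <+> J"
      using set_addI[of x I \<zero> J] assms by (simp add: ideal_zero_mem ideal.Icarr)
  qed
  show "J \<subseteq> I <+> J"
  proof
    fix x assume "x \<in> J"
    then show "x \<in> I <+> J"
      using set_addI[of \<zero> I x J] assms by (simp add: ideal_zero_mem ideal.Icarr)
  qed
qed

lemma set_add_subset_ideal:
  assumes "ideal K R" "I \<subseteq> K" "J \<subseteq> K"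
  shows "I <+> J \<subseteq> K"
  using assms by (auto simp: set_add_iff ideal_add_closed subset_iff)

lemma set_add_mono: "I \<subseteq> I' \<Longrightarrow> J \<subseteq> J' \<Longrightarrow> I <+> J \<subseteq> I' <+> J'"
  unfolding set_add_iff subset_iff by blast

lemma PIdl_iff: "x \<in> PIdl a \<longleftrightarrow> (\<exists>r\<in>carrier R. x = r \<otimes> a)"
  by (auto simp: cgenideal_def)

lemma add_PIdl_iff:
  assumes "ideal I R" "y \<in> carrier R"
  shows "x \<in> I <+> PIdl y \<longleftrightarrow> x \<in> carrier R \<and> (\<exists>r\<in>carrier R. x \<ominus> r \<otimes> y \<in> I)"
proof
  assume "x \<in> I <+> PIdl y"
  then obtain i r where i: "i \<in> I" and r: "r \<in> carrier R" and x: "x = i \<oplus> r \<otimes> y"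
    by (auto simp: set_add_iff PIdl_iff)
  have ic: "i \<in> carrier R" using i assms(1) by (rule ideal.Icarr[rotated])
  have "x \<ominus> r \<otimes> y = i" unfolding x using ic r assms(2) by (simp add: a_minus_def a_assoc r_neg)
  then show "x \<in> carrier R \<and> (\<exists>r\<in>carrier R. x \<ominus> r \<otimes> y \<in> I)"
    using i ic r x assms(2) by (metis add.m_closed m_closed)
next
  assume "x \<in> carrier R \<and> (\<exists>r\<in>carrier R. x \<ominus> r \<otimes> y \<in> I)"
  then obtain r where r: "r \<in> carrier R" "x \<ominus> r \<otimes> y \<in> I" and x: "x \<in> carrier R" by auto
  have "x = (x \<ominus> r \<otimes> y) \<oplus> r \<otimes> y" using x r assms(2) by (simp add: a_minus_def a_assoc l_neg)
  then show "x \<in> I <+> PIdl y" using r set_addI[of "x \<ominus> r \<otimes> y" I "r \<otimes> y" "PIdl y"] PIdl_iff by auto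
qed

lemma Idl_insert:
  assumes "a \<in> carrier R" "S \<subseteq> carrier R"
  shows "Idl (insert a S) = Idl S <+> PIdl a"
proof
  have iS: "ideal (Idl S) R" and ia: "ideal (PIdl a) R"
    using assms by (auto intro: genideal_ideal cgenideal_ideal)
  have sum: "ideal (Idl S <+> PIdl a) R" by (rule add_ideals[OF iS ia])
  show "Idl (insert a S) \<subseteq> Idl S <+> PIdl a"
    using subset_set_add[OF iS ia] genideal_self[OF assms(2)] cgenideal_self[OF assms(1)]
    by (intro genideal_minimal[OF sum]) auto
  have "insert a S \<subseteq> Idl (insert a S)" using assms by (intro genideal_self) auto
  moreover have "ideal (Idl (insert a S)) R" using assms by (intro genideal_ideal) auto
  ultimately show "Idl S <+> PIdl a \<subseteq> Idl (insert a S)"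
    by (intro set_add_subset_ideal genideal_minimal cgenideal_minimal) simp_all
qed

lemma Idl_empty: "Idl {} = {\<zero>}"
  using genideal_minimal[OF zeroideal, of "{}"] ideal_zero_mem[OF genideal_ideal[of "{}"]] by auto

lemma Idl_Un:
  assumes "S \<subseteq> carrier R" "T \<subseteq> carrier R"
  shows "Idl (S \<union> T) = Idl S <+> Idl T"
proof
  have iS: "ideal (Idl S) R" and iT: "ideal (Idl T) R" using assms by (auto intro: genideal_ideal)
  show "Idl (S \<union> T) \<subseteq> Idl S <+> Idl T"
    using subset_set_add[OF iS iT] genideal_self[OF assms(1)] genideal_self[OF assms(2)]
    by (intro genideal_minimal add_ideals iS iT) blast
  have "S \<union> T \<subseteq> Idl (S \<union> T)" "ideal (Idl (S \<union> T)) R"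
    using assms by (intro genideal_self genideal_ideal; blast)+
  then show "Idl S <+> Idl T \<subseteq> Idl (S \<union> T)"
    by (intro set_add_subset_ideal genideal_minimal) simp_all
qed

lemma Idl_finite_image_iff:
  assumes "finite A" "h \<in> A \<rightarrow> carrier R"
  shows "z \<in> Idl (h ` A) \<longleftrightarrow> (\<exists>c\<in>A \<rightarrow> carrier R. z = (\<Oplus>a\<in>A. c a \<otimes> h a))"
proof
  assume "z \<in> Idl (h ` A)"
  with assms show "\<exists>c\<in>A \<rightarrow> carrier R. z = (\<Oplus>a\<in>A. c a \<otimes> h a)"
  proof (induction A arbitrary: z rule: finite_induct)
    case empty
    then show ?case by (simp add: Idl_empty)
  next
    case (insert x F)
    have hx: "h x \<in> carrier R" and hF: "h \<in> F \<rightarrow> carrier R" using insert.prems by auto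
    have "z \<in> Idl (h ` F) <+> PIdl (h x)"
      using insert.prems(2) hx hF by (subst (asm) image_insert, subst (asm) Idl_insert) auto
    then obtain i r where i: "i \<in> Idl (h ` F)" and r: "r \<in> carrier R" and z: "z = i \<oplus> r \<otimes> h x"
      by (auto simp: set_add_iff PIdl_iff)
    obtain c where c: "c \<in> F \<rightarrow> carrier R" "i = (\<Oplus>a\<in>F. c a \<otimes> h a)"
      using insert.IH[OF hF i] by auto
    let ?c = "c(x := r)"
    have "(\<Oplus>a\<in>F. ?c a \<otimes> h a) = i" unfolding c(2)
      using insert.hyps(2) c hF by (intro finsum_cong') (auto simp: Pi_iff)
    moreover have "i \<in> carrier R"
      using i ideal.Icarr[OF genideal_ideal[of "h ` F"]] hF by auto
    ultimately have "(\<Oplus>a\<in>insert x F. ?c a \<otimes> h a) = z"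
      using insert.hyps c hF hx r unfolding z
      by (subst finsum_insert) (auto simp: Pi_iff a_comm)
    moreover have "?c \<in> insert x F \<rightarrow> carrier R" using c r by auto
    ultimately show ?case by blast
  qed
next
  assume "\<exists>c\<in>A \<rightarrow> carrier R. z = (\<Oplus>a\<in>A. c a \<otimes> h a)"
  then obtain c where c: "c \<in> A \<rightarrow> carrier R" "z = (\<Oplus>a\<in>A. c a \<otimes> h a)" by auto
  have sub: "h ` A \<subseteq> carrier R" using assms by auto
  have I: "ideal (Idl (h ` A)) R" by (rule genideal_ideal[OF sub])
  show "z \<in> Idl (h ` A)" unfolding c(2)
    using genideal_self[OF sub] c(1)
    by (intro ideal_finsum_closed I assms(1) ideal.I_l_closed[OF I]) auto
qed

subsection \<open>Products and powers of ideals\<close>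

lemma ideal_prod_subset:
  assumes "ideal K R" "\<And>i j. i \<in> I \<Longrightarrow> j \<in> J \<Longrightarrow> i \<otimes> j \<in> K"
  shows "I \<cdot> J \<subseteq> K"
proof
  fix x assume "x \<in> I \<cdot> J"
  then show "x \<in> K" by induction (auto simp: assms ideal_add_closed)
qed

lemma ideal_prod_mono: "I \<subseteq> I' \<Longrightarrow> J \<subseteq> J' \<Longrightarrow> I \<cdot> J \<subseteq> I' \<cdot> J'"
proof
  fix x assume "I \<subseteq> I'" "J \<subseteq> J'" "x \<in> I \<cdot> J"
  from this(3,1,2) show "x \<in> I' \<cdot> J'" by induction (auto intro: ideal_prod.intros)
qed

lemma Idl_prod_subset:
  assumes "S \<subseteq> carrier R" "ideal J R" "ideal K R"
    and "\<And>i j. i \<in> S \<Longrightarrow> j \<in> J \<Longrightarrow> i \<otimes> j \<in> K"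
  shows "(Idl S) \<cdot> J \<subseteq> K"
proof (rule ideal_prod_subset[OF assms(3)])
  fix i j assume i: "i \<in> Idl S" and j: "j \<in> J"
  have jc: "j \<in> carrier R" using j assms(2) by (rule ideal.Icarr[rotated])
  have "ideal {x \<in> carrier R. j \<otimes> x \<in> K} R"
    by (rule ideal.helper_max_prime[OF assms(3) is_cring jc])
  moreover have "S \<subseteq> {x \<in> carrier R. j \<otimes> x \<in> K}"
    using assms(1,4) j jc by (auto simp: m_comm subset_iff)
  ultimately have "Idl S \<subseteq> {x \<in> carrier R. j \<otimes> x \<in> K}" by (rule genideal_minimal)
  then have "i \<in> carrier R" "j \<otimes> i \<in> K" using i by auto
  then show "i \<otimes> j \<in> K" using jc by (simp add: m_comm)
qed

lemma ideal_pow_0: "ideal_pow R I 0 = carrier R"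
  by simp

lemma ideal_pow_Suc: "ideal_pow R I (Suc n) = ideal_pow R I n \<cdot> I"
  by simp

lemma ideal_pow_ideal [intro]: "ideal I R \<Longrightarrow> ideal (ideal_pow R I n) R"
  by (induction n) (auto simp: ideal_pow_Suc oneideal ideal_prod_is_ideal)

lemma ideal_pow_1: "ideal I R \<Longrightarrow> ideal_pow R I 1 = I"
  using ideal_pow_Suc[of I 0] ideal_prod_one[of I] ideal_prod_commute[of I "carrier R"]
  by (simp add: oneideal)

lemma ideal_pow_add: "ideal I R \<Longrightarrow> ideal_pow R I (a + b) = ideal_pow R I a \<cdot> ideal_pow R I b"
proof (induction b)
  case 0
  then show ?case by (simp add: ideal_prod_one ideal_pow_ideal)
next
  case (Suc b)
  then show ?case by (simp add: ideal_pow_Suc ideal_prod_assoc ideal_pow_ideal)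
qed

lemma ideal_pow_mult:
  "ideal I R \<Longrightarrow> ideal_pow R (ideal_pow R I a) b = ideal_pow R I (a * b)"
  by (induction b) (simp_all add: ideal_pow_Suc ideal_pow_add ideal_prod_commute ideal_pow_ideal)

lemma ideal_pow_mono: "I \<subseteq> J \<Longrightarrow> ideal_pow R I n \<subseteq> ideal_pow R J n"
  by (induction n) (auto simp: ideal_pow_Suc dest: ideal_prod_mono)

lemma ideal_pow_antimono:
  assumes "ideal I R" "a \<le> b" shows "ideal_pow R I b \<subseteq> ideal_pow R I a"
proof -
  obtain c where "b = a + c" using assms(2) le_Suc_ex by blast
  then show ?thesis using assms(1) ideal_prod_inter[of "ideal_pow R I a" "ideal_pow R I c"]
    by (simp add: ideal_pow_add ideal_pow_ideal)
qed

lemma ideal_pow_mult_mem: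
  assumes "ideal I R" "x \<in> ideal_pow R I a" "y \<in> ideal_pow R I b"
  shows "x \<otimes> y \<in> ideal_pow R I (a + b)"
  using assms by (simp add: ideal_pow_add ideal_prod.prod)

lemma pow_mem_ideal_pow: "x \<in> I \<Longrightarrow> x [^] n \<in> ideal_pow R I n"
  by (induction n) (auto simp: ideal_pow_Suc intro: ideal_prod.prod)

lemma pow_mem_ideal_pow_mult:
  "ideal I R \<Longrightarrow> x \<in> ideal_pow R I a \<Longrightarrow> x [^] n \<in> ideal_pow R I (a * n)"
  using pow_mem_ideal_pow[of x "ideal_pow R I a" n] by (simp add: ideal_pow_mult)

lemma pow_mem_ideal:
  assumes "ideal I R" "x \<in> carrier R" "x [^] (a::nat) \<in> I" "a \<le> b"
  shows "x [^] b \<in> I"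
proof -
  have "x [^] b = x [^] (b - a) \<otimes> x [^] a" using assms by (simp add: nat_pow_mult)
  then show ?thesis using assms by (simp add: ideal.I_l_closed)
qed

text \<open>Pigeonhole: a product of a + b factors from I and J has more than a factors from I or at
  least b from J. The induction on the total splits off the last factor: one from J raises b, one
  from I raises a, and for a = 0 a single factor from I is already enough.\<close>

lemma ideal_pow_add_subset:
  assumes I: "ideal I R" and J: "ideal J R"
  shows "ideal_pow R (I <+> J) (a + b) \<subseteq> ideal_pow R I (Suc a) <+> ideal_pow R J b"
proof (induction "a + b" arbitrary: a b)
  case 0
  then show ?case using subset_set_add(2)[OF ideal_pow_ideal[OF I, of 1] oneideal] by simp
next
  case (Suc n)
  note IJ = add_ideals[OF I J]
  have iK: "ideal (ideal_pow R I (Suc a) <+> ideal_pow R J b) R"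
    by (intro add_ideals ideal_pow_ideal I J)
  show ?case
  proof (cases b)
    case 0
    have "ideal_pow R (I <+> J) (a + b) \<subseteq> carrier R"
      by (rule ideal_subset_carrier[OF ideal_pow_ideal[OF IJ]])
    moreover have "carrier R \<subseteq> ideal_pow R I (Suc a) <+> ideal_pow R J b"
      using 0 subset_set_add(2)[OF ideal_pow_ideal[OF I, of "Suc a"] ideal_pow_ideal[OF J, of b]] by simp
    ultimately show ?thesis by blast
  next
    case (Suc b')
    have n: "n = a + b'" using Suc.hyps(2) Suc by simp
    have 1: "ideal_pow R (I <+> J) n \<cdot> I \<subseteq> ideal_pow R I (Suc a) <+> ideal_pow R J b"
    proof (rule ideal_prod_subset[OF iK])
      fix x i assume x: "x \<in> ideal_pow R (I <+> J) n" and i: "i \<in> I"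
      have c: "x \<in> carrier R" "i \<in> carrier R"
        using ideal.Icarr[OF ideal_pow_ideal[OF IJ] x] ideal.Icarr[OF I i] by auto
      show "x \<otimes> i \<in> ideal_pow R I (Suc a) <+> ideal_pow R J b"
      proof (cases a)
        case 0
        then have "x \<otimes> i \<in> ideal_pow R I (Suc a)"
          using c i ideal_pow_1[OF I] by (simp add: ideal.I_l_closed[OF I])
        then show ?thesis
          using subset_set_add(1)[OF ideal_pow_ideal[OF I, of "Suc a"] ideal_pow_ideal[OF J, of b]] by blast
      next
        case (Suc a')
        then have "n = a' + b" using n \<open>b = Suc b'\<close> by simp
        then have "x \<in> ideal_pow R I a <+> ideal_pow R J b" using Suc.hyps(1)[of a' b] x Suc by blast
        then obtain u v where uv: "u \<in> ideal_pow R I a" "v \<in> ideal_pow R J b" "x = u \<oplus> v"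
          unfolding set_add_iff by blast
        have [simp]: "u \<in> carrier R" "v \<in> carrier R"
          using ideal.Icarr[OF ideal_pow_ideal[OF I] uv(1)] ideal.Icarr[OF ideal_pow_ideal[OF J] uv(2)] .
        have "x \<otimes> i = u \<otimes> i \<oplus> v \<otimes> i" using c uv by (simp add: l_distr)
        moreover have "u \<otimes> i \<in> ideal_pow R I (Suc a)"
          unfolding ideal_pow_Suc using uv(1) i by (rule ideal_prod.prod)
        moreover have "v \<otimes> i \<in> ideal_pow R J b"
          using ideal.I_r_closed[OF ideal_pow_ideal[OF J] uv(2) c(2)] .
        ultimately show ?thesis using set_addI by metis
      qed
    qed
    have 2: "ideal_pow R (I <+> J) n \<cdot> J \<subseteq> ideal_pow R I (Suc a) <+> ideal_pow R J b"
    proof (rule ideal_prod_subset[OF iK])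
      fix x j assume x: "x \<in> ideal_pow R (I <+> J) n" and j: "j \<in> J"
      have jc: "j \<in> carrier R" using ideal.Icarr[OF J j] .
      have "x \<in> ideal_pow R I (Suc a) <+> ideal_pow R J b'" using Suc.hyps(1)[of a b'] x n by blast
      then obtain u v where uv: "u \<in> ideal_pow R I (Suc a)" "v \<in> ideal_pow R J b'" "x = u \<oplus> v"
        unfolding set_add_iff by blast
      have [simp]: "u \<in> carrier R" "v \<in> carrier R"
        using ideal.Icarr[OF ideal_pow_ideal[OF I] uv(1)] ideal.Icarr[OF ideal_pow_ideal[OF J] uv(2)] .
      have "x \<otimes> j = u \<otimes> j \<oplus> v \<otimes> j" using jc uv by (simp add: l_distr)
      moreover have "v \<otimes> j \<in> ideal_pow R J b"
        unfolding Suc ideal_pow_Suc using uv(2) j by (rule ideal_prod.prod)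
      moreover have "u \<otimes> j \<in> ideal_pow R I (Suc a)"
        using ideal.I_r_closed[OF ideal_pow_ideal[OF I] uv(1) jc] .
      ultimately show "x \<otimes> j \<in> ideal_pow R I (Suc a) <+> ideal_pow R J b" using set_addI by metis
    qed
    have "ideal_pow R (I <+> J) (a + b) = ideal_pow R (I <+> J) n \<cdot> (I <+> J)"
      using Suc.hyps(2)[symmetric] by (simp add: ideal_pow_Suc)
    also have "\<dots> = ideal_pow R (I <+> J) n \<cdot> I <+> ideal_pow R (I <+> J) n \<cdot> J"
      by (rule ideal_prod_distr[OF ideal_pow_ideal[OF IJ] I J])
    also have "\<dots> \<subseteq> ideal_pow R I (Suc a) <+> ideal_pow R J b"
      by (rule set_add_subset_ideal[OF iK 1 2])
    finally show ?thesis .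
  qed
qed

lemma PIdl_pow_subset:
  assumes "x \<in> carrier R"
  shows "ideal_pow R (PIdl x) n \<subseteq> PIdl (x [^] n)"
proof (induction n)
  case 0
  have "\<one> \<in> PIdl \<one>" using cgenideal_self by blast
  then show ?case using ideal.one_imp_carrier[OF cgenideal_ideal[of \<one>]] by simp
next
  case (Suc n)
  have "ideal_pow R (PIdl x) n \<cdot> (PIdl x) \<subseteq> PIdl (x [^] Suc n)"
  proof (rule ideal_prod_subset)
    show "ideal (PIdl (x [^] Suc n)) R" using assms by (intro cgenideal_ideal) simp
    fix i j assume "i \<in> ideal_pow R (PIdl x) n" "j \<in> PIdl x"
    then obtain r s where rs: "r \<in> carrier R" "s \<in> carrier R" "i = r \<otimes> x [^] n" "j = s \<otimes> x"
      using Suc by (auto simp: PIdl_iff subset_iff)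
    have "i \<otimes> j = (r \<otimes> s) \<otimes> x [^] Suc n" using rs assms by (simp add: m_ac)
    then show "i \<otimes> j \<in> PIdl (x [^] Suc n)" using rs by (auto simp: PIdl_iff)
  qed
  then show ?case by (simp add: ideal_pow_Suc)
qed

text \<open>Pigeonhole again: among that many generators some x is repeated at least
  \<open>a x\<close> times. If \<open>a x = 0\<close>, truncated subtraction still does the right
  thing, because then L is the whole ring and contains x itself.\<close>

lemma Idl_pow_subset_if_gens:
  assumes "finite A" "A \<subseteq> carrier R" "ideal L R" "\<And>x. x \<in> A \<Longrightarrow> x [^] (a x :: nat) \<in> L"
  shows "ideal_pow R (Idl A) ((\<Sum>x\<in>A. a x - 1) + 1) \<subseteq> L"
  using assms(1,2,4)
proof (induction A rule: finite_induct)
  case empty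
  have "ideal_pow R {\<zero>} 1 = {\<zero>}" by (rule ideal_pow_1[OF zeroideal])
  then show ?case using ideal_zero_mem[OF assms(3)] by (simp add: Idl_empty)
next
  case (insert x F)
  have x: "x \<in> carrier R" and F: "F \<subseteq> carrier R" using insert by auto
  note ix = cgenideal_ideal[OF x] and iF = genideal_ideal[OF F]
  have "ideal_pow R (PIdl x <+> Idl F) ((a x - 1) + ((\<Sum>x\<in>F. a x - 1) + 1))
      \<subseteq> ideal_pow R (PIdl x) (Suc (a x - 1)) <+> ideal_pow R (Idl F) ((\<Sum>x\<in>F. a x - 1) + 1)"
    by (rule ideal_pow_add_subset[OF ix iF])
  moreover have "ideal_pow R (Idl F) ((\<Sum>x\<in>F. a x - 1) + 1) \<subseteq> L"
    by (rule insert.IH) (use insert in auto)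
  moreover have "x [^] Suc (a x - 1) \<in> L"
    using pow_mem_ideal[OF assms(3) x insert.prems(2)[of x], of "Suc (a x - 1)"] by simp
  then have "PIdl (x [^] Suc (a x - 1)) \<subseteq> L" by (intro cgenideal_minimal assms(3))
  then have "ideal_pow R (PIdl x) (Suc (a x - 1)) \<subseteq> L" using PIdl_pow_subset[OF x, of "Suc (a x - 1)"] by blast
  ultimately have "ideal_pow R (PIdl x <+> Idl F) ((a x - 1) + ((\<Sum>x\<in>F. a x - 1) + 1)) \<subseteq> L"
    using set_add_subset_ideal[OF assms(3)] by blast
  moreover have "PIdl x <+> Idl F = Idl (insert x F)"
    using Idl_insert[OF x F] set_add_comm ideal_subset_carrier ix iF by metis
  ultimately show ?case using insert.hyps by (simp add: ac_simps)
qed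

subsection \<open>Colon ideals and congruences\<close>

definition colon :: "'a set \<Rightarrow> 'a \<Rightarrow> 'a set" where
  "colon I z = {r \<in> carrier R. r \<otimes> z \<in> I}"

lemma colon_ideal: "ideal I R \<Longrightarrow> z \<in> carrier R \<Longrightarrow> ideal (colon I z) R"
proof -
  assume a: "ideal I R" "z \<in> carrier R"
  have "colon I z = {x \<in> carrier R. z \<otimes> x \<in> I}" using a by (auto simp: colon_def m_comm)
  then show ?thesis using ideal.helper_max_prime[OF a(1) is_cring a(2)] by simp
qed

text \<open>Carrier membership is built in, so that congruences can be composed and multiplied
  without side conditions.\<close>

definition ideal_cong :: "'a set \<Rightarrow> 'a \<Rightarrow> 'a \<Rightarrow> bool" where
  "ideal_cong I a b \<longleftrightarrow> a \<in> carrier R \<and> b \<in> carrier R \<and> a \<ominus> b \<in> I"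

context
  fixes I assumes I: "ideal I R"
begin

lemma ideal_cong_refl: "a \<in> carrier R \<Longrightarrow> ideal_cong I a a"
  using I by (simp add: ideal_cong_def ideal_zero_mem a_minus_def r_neg)

lemma ideal_cong_sym: "ideal_cong I a b \<Longrightarrow> ideal_cong I b a"
proof -
  assume a: "ideal_cong I a b"
  then have "a \<in> carrier R" "b \<in> carrier R" by (auto simp: ideal_cong_def)
  then have "b \<ominus> a = \<ominus> (a \<ominus> b)" by algebra
  then show ?thesis using a I by (simp add: ideal_cong_def ideal_a_inv_closed)
qed

lemma ideal_cong_trans: "ideal_cong I a b \<Longrightarrow> ideal_cong I b c \<Longrightarrow> ideal_cong I a c"
proof -
  assume a: "ideal_cong I a b" "ideal_cong I b c"
  then have "a \<in> carrier R" "b \<in> carrier R" "c \<in> carrier R" by (auto simp: ideal_cong_def)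
  then have "a \<ominus> c = (a \<ominus> b) \<oplus> (b \<ominus> c)" by algebra
  then show ?thesis using a I by (simp add: ideal_cong_def ideal_add_closed)
qed

lemma ideal_cong_mult:
  assumes a: "ideal_cong I a b" "ideal_cong I c d"
  shows "ideal_cong I (a \<otimes> c) (b \<otimes> d)"
proof -
  have c: "a \<in> carrier R" "b \<in> carrier R" "c \<in> carrier R" "d \<in> carrier R"
    using a by (auto simp: ideal_cong_def)
  have "(a \<otimes> c) \<ominus> (b \<otimes> d) = (a \<ominus> b) \<otimes> c \<oplus> b \<otimes> (c \<ominus> d)" using c by algebra
  then show ?thesis using a I c
    by (simp add: ideal_cong_def ideal_add_closed ideal.I_l_closed ideal.I_r_closed)
qed

lemma ideal_cong_pow: "ideal_cong I a b \<Longrightarrow> ideal_cong I (a [^] (n::nat)) (b [^] n)"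
  by (induction n) (auto intro: ideal_cong_refl ideal_cong_mult)

lemma ideal_cong_mem_iff: "ideal_cong I a b \<Longrightarrow> a \<in> I \<longleftrightarrow> b \<in> I"
proof -
  have *: "b \<in> I \<Longrightarrow> ideal_cong I a b \<Longrightarrow> a \<in> I" for a b
  proof -
    assume a: "b \<in> I" "ideal_cong I a b"
    then have "a = (a \<ominus> b) \<oplus> b" by (simp add: minus_add_cancel ideal_cong_def)
    then show "a \<in> I" using a I ideal_add_closed ideal_cong_def by metis
  qed
  assume "ideal_cong I a b"
  then show ?thesis using * ideal_cong_sym by blast
qed

end

lemma ideal_cong_mono: "ideal_cong I a b \<Longrightarrow> I \<subseteq> J \<Longrightarrow> ideal_cong J a b"
  by (auto simp: ideal_cong_def)

lemma add_PIdl_cong_iff: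
  assumes "ideal I R" "y \<in> carrier R"
  shows "x \<in> I <+> PIdl y \<longleftrightarrow> (\<exists>r\<in>carrier R. ideal_cong I x (r \<otimes> y))"
  using add_PIdl_iff[OF assms, of x] assms(2) by (auto simp: ideal_cong_def)

end

locale noetherian_cring = cring R + noetherian_ring R for R (structure)

context cring
begin

lemma primeideal_mult_notin:
  "primeideal P R \<Longrightarrow> s \<in> carrier R - P \<Longrightarrow> t \<in> carrier R - P \<Longrightarrow> s \<otimes> t \<in> carrier R - P"
  using primeideal.I_prime[of P R s t] by auto

lemma primeideal_one_notin: "primeideal P R \<Longrightarrow> \<one> \<in> carrier R - P"
  using ideal.one_imp_carrier[OF primeideal.axioms(1), of P R] primeideal.I_notcarr[of P R] by auto

lemma primeideal_pow_mem:
  "primeideal P R \<Longrightarrow> y \<in> carrier R \<Longrightarrow> y [^] (k::nat) \<in> P \<Longrightarrow> y \<in> P"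
proof (induction k)
  case 0
  then show ?case using primeideal_one_notin by auto
next
  case (Suc k)
  then show ?case using primeideal.I_prime[OF Suc.prems(1), of "y [^] k" y] by auto
qed

subsection \<open>Saturation with respect to a prime ideal\<close>

text \<open>\<open>sat P I\<close> is the contraction of the extension of \<open>I\<close> to the localization at \<open>P\<close>.\<close>

definition sat :: "'a set \<Rightarrow> 'a set \<Rightarrow> 'a set" where
  "sat P I = {z \<in> carrier R. \<exists>s\<in>carrier R - P. s \<otimes> z \<in> I}"

lemma satI: "z \<in> carrier R \<Longrightarrow> s \<in> carrier R - P \<Longrightarrow> s \<otimes> z \<in> I \<Longrightarrow> z \<in> sat P I"
  by (auto simp: sat_def)

lemma sat_mono: "I \<subseteq> J \<Longrightarrow> sat P I \<subseteq> sat P J"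
  by (auto simp: sat_def)

lemma sat_subset_carrier: "sat P I \<subseteq> carrier R"
  by (auto simp: sat_def)

context
  fixes P assumes P: "primeideal P R"
begin

lemma subset_sat: "ideal I R \<Longrightarrow> I \<subseteq> sat P I"
proof
  fix z assume "ideal I R" "z \<in> I"
  then have "z \<in> carrier R" by (rule ideal.Icarr)
  then show "z \<in> sat P I" using primeideal_one_notin[OF P] \<open>z \<in> I\<close> by (intro satI[of _ \<one>]) auto
qed

lemma sat_ideal:
  assumes I: "ideal I R"
  shows "ideal (sat P I) R"
proof (rule ideal_if_closed)
  show "sat P I \<subseteq> carrier R" by (rule sat_subset_carrier)
  show "\<zero> \<in> sat P I" using subset_sat[OF I] ideal_zero_mem[OF I] by auto
next
  fix a b assume "a \<in> sat P I" "b \<in> sat P I"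
  then obtain s t where st: "s \<in> carrier R - P" "t \<in> carrier R - P" "s \<otimes> a \<in> I" "t \<otimes> b \<in> I"
    and [simp]: "a \<in> carrier R" "b \<in> carrier R" by (auto simp: sat_def)
  then have [simp]: "s \<in> carrier R" "t \<in> carrier R" by auto
  have "(s \<otimes> t) \<otimes> (a \<oplus> b) = t \<otimes> (s \<otimes> a) \<oplus> s \<otimes> (t \<otimes> b)"
    by (simp add: r_distr m_ac)
  then have "(s \<otimes> t) \<otimes> (a \<oplus> b) \<in> I" using st I by (simp add: ideal_add_closed ideal.I_l_closed)
  then show "a \<oplus> b \<in> sat P I" using primeideal_mult_notin[OF P st(1,2)] by (intro satI) auto
next
  fix a r assume "a \<in> sat P I" and r: "r \<in> carrier R"
  then obtain s where s: "s \<in> carrier R - P" "s \<otimes> a \<in> I" and a: "a \<in> carrier R"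
    by (auto simp: sat_def)
  have "s \<otimes> (r \<otimes> a) = r \<otimes> (s \<otimes> a)" using s a r by (simp add: m_lcomm)
  then show "r \<otimes> a \<in> sat P I" using s a r I by (intro satI[OF _ s(1)]) (auto simp: ideal.I_l_closed)
qed

lemma sat_memD: "s \<in> carrier R - P \<Longrightarrow> z \<in> carrier R \<Longrightarrow> s \<otimes> z \<in> sat P I \<Longrightarrow> z \<in> sat P I"
proof -
  assume s: "s \<in> carrier R - P" "z \<in> carrier R" "s \<otimes> z \<in> sat P I"
  then obtain t where t: "t \<in> carrier R - P" "t \<otimes> (s \<otimes> z) \<in> I" by (auto simp: sat_def)
  then show "z \<in> sat P I" using s primeideal_mult_notin[OF P t(1) s(1)]
    by (intro satI[of _ "t \<otimes> s"]) (simp_all add: m_assoc)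
qed

lemma sat_sat: "sat P (sat P I) \<subseteq> sat P I"
proof
  fix z assume "z \<in> sat P (sat P I)"
  then obtain s where "s \<in> carrier R - P" "z \<in> carrier R" "s \<otimes> z \<in> sat P I"
    unfolding sat_def[of P "sat P I"] by blast
  then show "z \<in> sat P I" by (rule sat_memD)
qed

lemma sat_subset_sat: "I \<subseteq> sat P J \<Longrightarrow> sat P I \<subseteq> sat P J"
  using sat_mono[of I "sat P J" P] sat_sat[of J] by blast

text \<open>Nakayama's lemma in the localization at P, by removing one generator g at a time. Modulo
  N + (g) the induction hypothesis absorbs the other generators, so P times them lies in N + P g up
  to saturation. What remains is s g in N + P g with s outside P.\<close>

lemma Idl_subset_sat_Nakayama:
  assumes "finite A" "A \<subseteq> carrier R" "ideal N R" "A \<subseteq> sat P (N <+> P \<cdot> (Idl A))"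
  shows "A \<subseteq> sat P N"
  using assms
proof (induction A arbitrary: N rule: finite_induct)
  case empty
  then show ?case by simp
next
  case (insert g A)
  have iP: "ideal P R" using P by (rule primeideal.axioms(1))
  have g: "g \<in> carrier R" and A: "A \<subseteq> carrier R" using insert by auto
  have ig: "ideal (PIdl g) R" and iA: "ideal (Idl A) R" using g A by (auto intro: cgenideal_ideal genideal_ideal)
  note N = \<open>ideal N R\<close>
  define N' where "N' = N <+> PIdl g"
  define W where "W = N <+> P \<cdot> (PIdl g)"
  have iN': "ideal N' R" and iW: "ideal W R"
    unfolding N'_def W_def by (intro add_ideals ideal_prod_is_ideal N ig iP)+
  have iPg: "ideal (P \<cdot> (PIdl g)) R" and iPA: "ideal (P \<cdot> (Idl A)) R"
    by (intro ideal_prod_is_ideal iP ig iA)+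
  have split: "P \<cdot> (Idl (insert g A)) = P \<cdot> (Idl A) <+> P \<cdot> (PIdl g)"
    unfolding Idl_insert[OF g A] by (rule ideal_prod_distr[OF iP iA ig])
  have Pg: "P \<cdot> (PIdl g) \<subseteq> PIdl g" using ideal_prod_inter[OF iP ig] by auto
  have NW: "N \<subseteq> W" "P \<cdot> (PIdl g) \<subseteq> W" unfolding W_def by (rule subset_set_add[OF N iPg])+
  have NN': "N \<subseteq> N'" "PIdl g \<subseteq> N'" unfolding N'_def by (rule subset_set_add[OF N ig])+
  have "N <+> P \<cdot> (Idl (insert g A)) \<subseteq> N' <+> P \<cdot> (Idl A)"
    unfolding split using subset_set_add[OF iN' iPA] NN' Pg
    by (intro set_add_subset_ideal add_ideals iN' iPA) auto
  then have "A \<subseteq> sat P (N' <+> P \<cdot> (Idl A))" using insert.prems(3) sat_mono by blast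
  then have "A \<subseteq> sat P N'" by (rule insert.IH[OF A iN'])
  then have IdlA: "Idl A \<subseteq> sat P N'" by (intro genideal_minimal sat_ideal iN')
  have PA: "P \<cdot> (Idl A) \<subseteq> sat P W"
  proof (rule ideal_prod_subset[OF sat_ideal[OF iW]])
    fix p a assume p: "p \<in> P" and "a \<in> Idl A"
    then have a: "a \<in> sat P N'" using IdlA by auto
    have pc: "p \<in> carrier R" using p iP by (rule ideal.Icarr[rotated])
    from a obtain s where s: "s \<in> carrier R - P" "s \<otimes> a \<in> N'" and ac: "a \<in> carrier R"
      by (auto simp: sat_def)
    then obtain n r where nr: "n \<in> N" "r \<in> PIdl g" "s \<otimes> a = n \<oplus> r"
      unfolding N'_def set_add_iff by auto
    have c: "n \<in> carrier R" "r \<in> carrier R" using nr N ig ideal.Icarr by metis+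
    have "s \<otimes> (p \<otimes> a) = p \<otimes> (s \<otimes> a)" using s pc ac by (simp add: m_lcomm)
    also have "\<dots> = p \<otimes> n \<oplus> p \<otimes> r" using nr c pc by (simp add: r_distr)
    also have "\<dots> \<in> W" unfolding W_def using nr p pc
      by (intro set_addI ideal.I_l_closed[OF N] ideal_prod.prod)
    finally show "p \<otimes> a \<in> sat P W" using s pc ac by (intro satI) auto
  qed
  have "N <+> P \<cdot> (Idl (insert g A)) \<subseteq> sat P W"
    unfolding split using subset_sat[OF iW] NW PA
    by (intro set_add_subset_ideal sat_ideal iW) auto
  then have "g \<in> sat P W" using insert.prems(3) sat_subset_sat by blast
  then obtain s where s: "s \<in> carrier R - P" "s \<otimes> g \<in> W" by (auto simp: sat_def)
  then obtain n w where nw: "n \<in> N" "w \<in> P \<cdot> (PIdl g)" "s \<otimes> g = n \<oplus> w"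
    unfolding W_def set_add_iff by auto
  \<comment> \<open>A sum of products from P and (g) collapses to a single p g, so that p can be
    subtracted from s.\<close>
  have "ideal {p \<otimes> g | p. p \<in> P} R"
  proof (rule ideal_if_closed, goal_cases)
    case 1 then show ?case using g ideal.Icarr[OF iP] by auto
    case 2 then show ?case using ideal_zero_mem[OF iP] g by force
  next
    case (3 a b)
    then obtain p q where "p \<in> P" "q \<in> P" "a = p \<otimes> g" "b = q \<otimes> g" by auto
    then show ?case using g ideal.Icarr[OF iP] ideal_add_closed[OF iP, of p q]
      by (auto simp: l_distr[symmetric])
  next
    case (4 a r)
    then obtain p where "p \<in> P" "a = p \<otimes> g" by auto
    then show ?case using 4 g ideal.Icarr[OF iP] ideal.I_l_closed[OF iP, of p r]
      by (auto simp: m_assoc[symmetric])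
  qed
  then have "P \<cdot> (PIdl g) \<subseteq> {p \<otimes> g | p. p \<in> P}"
  proof (rule ideal_prod_subset)
    fix p j assume pj: "p \<in> P" "j \<in> PIdl g"
    then obtain r where "r \<in> carrier R" "j = r \<otimes> g" by (auto simp: PIdl_iff)
    then have "p \<otimes> j = (p \<otimes> r) \<otimes> g" "p \<otimes> r \<in> P"
      using pj g ideal.Icarr[OF iP] by (auto simp: m_assoc ideal.I_r_closed[OF iP])
    then show "p \<otimes> j \<in> {p \<otimes> g | p. p \<in> P}" by blast
  qed
  then obtain p where p: "p \<in> P" "w = p \<otimes> g" using nw by auto
  have [simp]: "p \<in> carrier R" "n \<in> carrier R" "s \<in> carrier R" "g \<in> carrier R"
    using p nw s g N iP ideal.Icarr by auto
  \<comment> \<open>The element s - p is a unit in the localization, being outside P; this is the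
    only place where locality enters.\<close>
  have "(s \<ominus> p) \<otimes> g = s \<otimes> g \<ominus> p \<otimes> g" by (simp add: l_minus_distr)
  also have "\<dots> = n" unfolding nw(3) p(2) by (simp add: a_minus_def a_assoc r_neg)
  finally have "(s \<ominus> p) \<otimes> g \<in> N" using nw by simp
  moreover have "s \<ominus> p \<notin> P"
  proof
    assume "s \<ominus> p \<in> P"
    then have "(s \<ominus> p) \<oplus> p \<in> P" using p iP by (intro ideal_add_closed)
    moreover have "(s \<ominus> p) \<oplus> p = s" by (simp add: minus_add_cancel)
    ultimately show False using s by simp
  qed
  ultimately have gN: "g \<in> sat P N" by (intro satI[of _ "s \<ominus> p"]) auto
  have "N' \<subseteq> sat P N" unfolding N'_def
    by (rule set_add_subset_ideal[OF sat_ideal[OF N] subset_sat[OF N] cgenideal_minimal[OF sat_ideal[OF N] gN]])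
  then have "sat P N' \<subseteq> sat P N" by (rule sat_subset_sat)
  then show ?case using gN \<open>A \<subseteq> sat P N'\<close> by auto
qed

text \<open>Saturated ideals correspond to ideals of the localization at P, so this is the
  descending chain condition between the localizations of K and M. It replaces finite length, for
  which no module theory is set up.\<close>

definition sat_dcc :: "'a set \<Rightarrow> 'a set \<Rightarrow> bool" where
  "sat_dcc K M \<longleftrightarrow> (\<forall>L :: nat \<Rightarrow> 'a set.
     (\<forall>k. ideal (L k) R \<and> sat P (L k) \<subseteq> L k \<and> K \<subseteq> L k \<and> L k \<subseteq> M \<and> L (Suc k) \<subseteq> L k) \<longrightarrow>
     (\<exists>k0. \<forall>k\<ge>k0. L k = L k0))"

lemma sat_dccI:
  assumes "\<And>L. (\<And>k. ideal (L k) R) \<Longrightarrow> (\<And>k. sat P (L k) \<subseteq> L k) \<Longrightarrow> (\<And>k. K \<subseteq> L k) \<Longrightarrow>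
    (\<And>k. L k \<subseteq> M) \<Longrightarrow> (\<And>k::nat. L (Suc k) \<subseteq> L k) \<Longrightarrow> \<exists>k0. \<forall>k\<ge>k0. L k = L k0"
  shows "sat_dcc K M"
  unfolding sat_dcc_def
proof (intro allI impI, rule assms)
qed simp_all

lemma sat_dccD:
  assumes "sat_dcc K M" "\<And>k. ideal (L k) R" "\<And>k. sat P (L k) \<subseteq> L k" "\<And>k. K \<subseteq> L k"
    "\<And>k. L k \<subseteq> M" "\<And>k::nat. L (Suc k) \<subseteq> L k"
  obtains k0 where "\<And>k. k \<ge> k0 \<Longrightarrow> L k = L k0"
proof -
  have "\<forall>k. ideal (L k) R \<and> sat P (L k) \<subseteq> L k \<and> K \<subseteq> L k \<and> L k \<subseteq> M \<and> L (Suc k) \<subseteq> L k"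
    using assms(2-) by simp
  then have "\<exists>k0. \<forall>k\<ge>k0. L k = L k0"
    using assms(1)[unfolded sat_dcc_def, THEN spec, of L, THEN mp] by satx
  then show ?thesis using that by metis
qed

lemma sat_dcc_mono:
  assumes "sat_dcc K M" "K \<subseteq> K'" "M' \<subseteq> M"
  shows "sat_dcc K' M'"
proof (rule sat_dccI)
  fix L assume L: "\<And>k::nat. ideal (L k) R" "\<And>k. sat P (L k) \<subseteq> L k" "\<And>k. K' \<subseteq> L k"
    "\<And>k. L k \<subseteq> M'" "\<And>k. L (Suc k) \<subseteq> L k"
  obtain k0 where "\<And>k. k \<ge> k0 \<Longrightarrow> L k = L k0"
    using sat_dccD[OF assms(1), of L] L subset_trans[OF assms(2)] subset_trans[OF _ assms(3)] by metis
  then show "\<exists>k0. \<forall>k\<ge>k0. L k = L k0" by blast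
qed

text \<open>The usual extension argument: of two nested saturated ideals with the same intersection
  with M' and the same sum with M' up to saturation, the larger is contained in the smaller by the
  modular law.\<close>

lemma sat_dcc_trans:
  assumes "ideal M' R" "sat P M' \<subseteq> M'" "K \<subseteq> M'" "ideal M R" "sat P M \<subseteq> M" "M' \<subseteq> M"
    and 1: "sat_dcc K M'" and 2: "sat_dcc M' M"
  shows "sat_dcc K M"
proof (rule sat_dccI)
  fix L assume L: "\<And>k::nat. ideal (L k) R" "\<And>k. sat P (L k) \<subseteq> L k" "\<And>k. K \<subseteq> L k"
    "\<And>k. L k \<subseteq> M" "\<And>k. L (Suc k) \<subseteq> L k"
  have anti: "L k \<subseteq> L l" if "l \<le> k" for k l by (rule lift_Suc_antimono_le[of L, OF L(5) that])
  obtain a where a: "\<And>k. k \<ge> a \<Longrightarrow> L k \<inter> M' = L a \<inter> M'"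
  proof (rule sat_dccD[OF 1, of "\<lambda>k. L k \<inter> M'"])
    fix k
    show "ideal (L k \<inter> M') R" using L assms by (intro i_intersect) auto
    have "sat P (L k \<inter> M') \<subseteq> sat P (L k) \<inter> sat P M'" using sat_mono[of "L k \<inter> M'"] by auto
    then show "sat P (L k \<inter> M') \<subseteq> L k \<inter> M'" using L(2)[of k] assms by blast
    show "L (Suc k) \<inter> M' \<subseteq> L k \<inter> M'" using L(5)[of k] by blast
    show "K \<subseteq> L k \<inter> M'" using L(3)[of k] assms by blast
  qed auto
  have iS: "ideal (L k <+> M') R" for k using L assms by (intro add_ideals) auto
  \<comment> \<open>A sum of saturated ideals need not be saturated, so the chain of sums is
    saturated before the condition is applied to it.\<close>
  obtain b where b: "\<And>k. k \<ge> b \<Longrightarrow> sat P (L k <+> M') = sat P (L b <+> M')"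
  proof (rule sat_dccD[OF 2, where L = "\<lambda>k. sat P (L k <+> M')"])
    fix k
    show "ideal (sat P (L k <+> M')) R" by (rule sat_ideal[OF iS])
    show "sat P (sat P (L k <+> M')) \<subseteq> sat P (L k <+> M')" by (rule sat_sat)
    show "M' \<subseteq> sat P (L k <+> M')" using subset_sat[OF iS] subset_set_add(2)[OF L(1) assms(1)] by blast
    have "L k <+> M' \<subseteq> M" using L assms by (intro set_add_subset_ideal) auto
    then show "sat P (L k <+> M') \<subseteq> M" using sat_mono assms(5) by blast
    show "sat P (L (Suc k) <+> M') \<subseteq> sat P (L k <+> M')"
      using L by (intro sat_mono set_add_mono) auto
  qed (rule that)
  define c where "c = max a b"
  have "L k = L c" if k: "k \<ge> c" for k
  proof
    show "L k \<subseteq> L c" by (rule anti[OF k])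
    show "L c \<subseteq> L k"
    proof
      fix z assume z: "z \<in> L c"
      have iL: "ideal (L k) R" for k using L by auto
      have zc: "z \<in> carrier R" using z iL by (rule ideal.Icarr[rotated])
      have "z \<in> sat P (L c <+> M')" using z subset_sat[OF iS] subset_set_add(1)[OF L(1) assms(1)] by blast
      also have "sat P (L c <+> M') = sat P (L k <+> M')"
        using b[of k] b[of c] k c_def by simp
      finally obtain s where s: "s \<in> carrier R - P" "s \<otimes> z \<in> L k <+> M'" by (auto simp: sat_def)
      then obtain l m where lm: "l \<in> L k" "m \<in> M'" "s \<otimes> z = l \<oplus> m" by (auto simp: set_add_iff)
      have [simp]: "l \<in> carrier R" "m \<in> carrier R" using ideal.Icarr[OF iL lm(1)] ideal.Icarr[OF assms(1) lm(2)] by auto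
      have "m = (l \<oplus> m) \<ominus> l" by (simp add: add_minus_cancel)
      also have "\<dots> = s \<otimes> z \<ominus> l" using lm by simp
      also have "\<dots> \<in> L c" using lm anti[OF k] z s by (intro ideal_minus_closed[OF iL] ideal.I_l_closed[OF iL]) auto
      finally have "m \<in> L c \<inter> M'" using lm by auto
      also have "L c \<inter> M' = L k \<inter> M'" using a[of k] a[of c] k c_def by simp
      finally have "s \<otimes> z \<in> L k" using lm by (simp add: ideal_add_closed[OF iL])
      then have "z \<in> sat P (L k)" using s zc by (intro satI) auto
      then show "z \<in> L k" using L by auto
    qed
  qed
  then show "\<exists>k0. \<forall>k\<ge>k0. L k = L k0" by blast
qed

text \<open>As P kills g modulo K, the localized quotient is at most a line over the residue field
  at P. A saturated ideal in between is therefore either at the bottom or contains g.\<close>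

lemma sat_dcc_add_PIdl:
  assumes K: "ideal K R" and g: "g \<in> carrier R" and Pg: "\<And>p. p \<in> P \<Longrightarrow> p \<otimes> g \<in> K"
  shows "sat_dcc K (sat P (K <+> PIdl g))"
proof (rule sat_dccI)
  fix L assume L: "\<And>k::nat. ideal (L k) R" "\<And>k. sat P (L k) \<subseteq> L k" "\<And>k. K \<subseteq> L k"
    "\<And>k. L k \<subseteq> sat P (K <+> PIdl g)" "\<And>k. L (Suc k) \<subseteq> L k"
  have anti: "L k \<subseteq> L l" if "l \<le> k" for k l by (rule lift_Suc_antimono_le[of L, OF L(5) that])
  have iL: "ideal (L k) R" for k using L by auto
  show "\<exists>k0. \<forall>k\<ge>k0. L k = L k0"
  proof (cases "\<exists>k0. L k0 \<subseteq> sat P K")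
    case True
    then obtain k0 where "L k0 \<subseteq> sat P K" by auto
    then have "L k = L k0" if "k \<ge> k0" for k
      using anti[OF that] sat_mono[OF L(3), of P k] L(2)[of k] by blast
    then show ?thesis by blast
  next
    case False
    have "sat P (K <+> PIdl g) \<subseteq> L k" for k
    proof -
      obtain z where z: "z \<in> L k" "z \<notin> sat P K" using False by blast
      then have zc: "z \<in> carrier R" using iL by (auto intro: ideal.Icarr)
      have "z \<in> sat P (K <+> PIdl g)" using z L(4)[of k] by blast
      then obtain s where s: "s \<in> carrier R - P" "s \<otimes> z \<in> K <+> PIdl g" by (auto simp: sat_def)
      then obtain l r where lr: "l \<in> K" "r \<in> carrier R" "s \<otimes> z = l \<oplus> r \<otimes> g"
        by (auto simp: set_add_iff PIdl_iff)
      have r: "r \<notin> P"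
      proof
        assume "r \<in> P"
        then have "s \<otimes> z \<in> K" using lr Pg by (auto intro: ideal_add_closed[OF K])
        then show False using z s zc satI by blast
      qed
      have [simp]: "l \<in> carrier R" "r \<otimes> g \<in> carrier R" using lr g K ideal.Icarr by auto
      have "r \<otimes> g = s \<otimes> z \<ominus> l" unfolding lr(3) by (metis (no_types, lifting) \<open>l \<in> carrier R\<close> \<open>r \<otimes> g \<in> carrier R\<close> a_assoc a_comm a_minus_def add.inv_closed r_neg r_zero)
      also have "\<dots> \<in> L k" using lr L(3)[of k] z s by (intro ideal_minus_closed[OF iL] ideal.I_l_closed[OF iL]) auto
      finally have "g \<in> sat P (L k)" using g r lr by (intro satI[of _ r]) auto
      then have "g \<in> L k" using L(2)[of k] by auto
      then have "K <+> PIdl g \<subseteq> L k" using L by (intro set_add_subset_ideal iL cgenideal_minimal) auto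
      then have "sat P (K <+> PIdl g) \<subseteq> sat P (L k)" by (rule sat_mono)
      then show ?thesis using L(2)[of k] by (rule subset_trans)
    qed
    then have "L k = sat P (K <+> PIdl g)" for k using L(4)[of k] by (simp add: subset_antisym)
    then show ?thesis by blast
  qed
qed

lemma sat_dcc_add_Idl:
  assumes K: "ideal K R" "sat P K \<subseteq> K" and A: "finite A" "A \<subseteq> carrier R"
    and Pg: "\<And>p g. p \<in> P \<Longrightarrow> g \<in> A \<Longrightarrow> p \<otimes> g \<in> K"
  shows "sat_dcc K (sat P (K <+> Idl A))"
  using A Pg
proof (induction A rule: finite_induct)
  case empty
  have "K <+> Idl {} \<subseteq> K" unfolding Idl_empty
    using ideal_zero_mem[OF K(1)] by (intro set_add_subset_ideal K) auto
  then have "sat P (K <+> Idl {}) \<subseteq> K" using sat_mono K by blast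
  then show ?case by (intro sat_dccI) (metis subset_antisym subset_trans)
next
  case (insert g A)
  have g: "g \<in> carrier R" and A: "A \<subseteq> carrier R" using insert by auto
  let ?M = "sat P (K <+> Idl A)"
  have iKA: "ideal (K <+> Idl A) R" and iA: "ideal (Idl A) R" and ig: "ideal (PIdl g) R"
    using A g by (auto intro!: add_ideals K genideal_ideal cgenideal_ideal)
  have iM: "ideal ?M R" by (rule sat_ideal[OF iKA])
  have KM: "K \<subseteq> ?M" using subset_sat[OF iKA] subset_set_add[OF K(1) iA] by blast
  have "sat_dcc ?M (sat P (?M <+> PIdl g))"
    using insert.prems KM by (intro sat_dcc_add_PIdl iM g) auto
  moreover have "sat_dcc K ?M" using insert.IH A insert.prems by auto
  moreover have iMg: "ideal (?M <+> PIdl g) R" by (intro add_ideals iM ig)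
  ultimately have "sat_dcc K (sat P (?M <+> PIdl g))"
    using KM subset_set_add[OF iM ig] subset_sat[OF iMg]
    by (intro sat_dcc_trans[OF iM sat_sat KM sat_ideal[OF iMg] sat_sat]) auto
  moreover have "K <+> Idl (insert g A) \<subseteq> ?M <+> PIdl g"
    unfolding Idl_insert[OF g A] using subset_set_add[OF iM ig] KM
      subset_sat[OF iKA] subset_set_add[OF K(1) iA]
    by (intro set_add_subset_ideal iMg) auto
  then have "sat P (K <+> Idl (insert g A)) \<subseteq> sat P (?M <+> PIdl g)" by (rule sat_mono)
  ultimately show ?case using sat_dcc_mono[of K _ K] by blast
qed

end

end

section \<open>Krull's principal ideal theorem\<close>

context noetherian_cring
begin

lemma maximal_in_ideal_family:
  assumes "S \<noteq> {}" "\<And>J. J \<in> S \<Longrightarrow> ideal J R"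
  obtains M where "M \<in> S" "\<And>J. J \<in> S \<Longrightarrow> M \<subseteq> J \<Longrightarrow> J = M"
proof -
  have "\<exists>M\<in>S. \<forall>J\<in>S. M \<subseteq> J \<longrightarrow> J = M"
  proof (rule subset_Zorn)
    fix C assume C: "subset.chain S C"
    show "\<exists>U\<in>S. \<forall>J\<in>C. J \<subseteq> U"
    proof (cases "C = {}")
      case True
      then show ?thesis using assms(1) by auto
    next
      case False
      have "subset.chain {I. ideal I R} C" using C assms(2) unfolding pred_on.chain_def by auto
      then have "\<Union>C \<in> C" by (rule ideal_chain_is_trivial[OF False])
      then show ?thesis using C unfolding pred_on.chain_def by auto
    qed
  qed
  then show ?thesis using that by blast
qed

lemma exists_prime_avoiding:
  assumes I: "ideal I R" and S: "S \<subseteq> carrier R" "\<one> \<in> S" "I \<inter> S = {}"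
    and mult: "\<And>s t. s \<in> S \<Longrightarrow> t \<in> S \<Longrightarrow> s \<otimes> t \<in> S"
  obtains P where "primeideal P R" "I \<subseteq> P" "P \<inter> S = {}"
proof -
  let ?F = "{J. ideal J R \<and> I \<subseteq> J \<and> J \<inter> S = {}}"
  have IF: "I \<in> ?F" using I S by blast
  obtain M where M: "M \<in> ?F" and max: "\<And>J. J \<in> ?F \<Longrightarrow> M \<subseteq> J \<Longrightarrow> J = M"
  proof (rule maximal_in_ideal_family[of ?F, rotated 2])
    show "?F \<noteq> {}" using IF by blast
    show "ideal J R" if "J \<in> ?F" for J using that by blast
  qed (rule that)
  have iM: "ideal M R" using M by auto
  have ex: "\<exists>s\<in>S. \<exists>r\<in>carrier R. ideal_cong M s (r \<otimes> a)" if a: "a \<in> carrier R" "a \<notin> M" for a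
  proof -
    have ia: "ideal (PIdl a) R" using a by (intro cgenideal_ideal)
    have "M <+> PIdl a \<noteq> M" using subset_set_add[OF iM ia] cgenideal_self[OF a(1)] a(2) by blast
    then have "M <+> PIdl a \<notin> ?F" using max subset_set_add[OF iM ia] by blast
    then have "(M <+> PIdl a) \<inter> S \<noteq> {}"
      using M subset_set_add[OF iM ia] add_ideals[OF iM ia] by blast
    then obtain s where "s \<in> S" "s \<in> M <+> PIdl a" by auto
    then show ?thesis using add_PIdl_cong_iff[OF iM a(1)] by auto
  qed
  have "primeideal M R"
  proof (rule primeidealI[OF iM is_cring])
    show "carrier R \<noteq> M" using M S by auto
    fix a b assume ab: "a \<in> carrier R" "b \<in> carrier R" "a \<otimes> b \<in> M"
    show "a \<in> M \<or> b \<in> M"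
    proof (rule ccontr)
      assume "\<not> (a \<in> M \<or> b \<in> M)"
      then obtain s t q r where st: "s \<in> S" "t \<in> S" "q \<in> carrier R" "r \<in> carrier R"
        "ideal_cong M s (q \<otimes> a)" "ideal_cong M t (r \<otimes> b)"
        using ex ab by metis
      have "ideal_cong M (s \<otimes> t) ((q \<otimes> a) \<otimes> (r \<otimes> b))" using st by (intro ideal_cong_mult iM)
      moreover have "(q \<otimes> a) \<otimes> (r \<otimes> b) = (q \<otimes> r) \<otimes> (a \<otimes> b)"
        using st ab by (simp add: m_ac)
      moreover have "\<dots> \<in> M" using st ab by (simp add: ideal.I_l_closed[OF iM])
      ultimately have "s \<otimes> t \<in> M" using ideal_cong_mem_iff[OF iM] by auto
      then show False using mult[OF st(1,2)] M by auto
    qed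
  qed
  then show ?thesis using that M by auto
qed

lemma ideal_pow_subset_if_nil:
  assumes K: "ideal K R" and L: "ideal L R" and nil: "\<And>y. y \<in> K \<Longrightarrow> \<exists>k::nat. y [^] k \<in> L"
  shows "\<exists>N. ideal_pow R K N \<subseteq> L"
proof -
  obtain k where k: "\<And>y. y \<in> K \<Longrightarrow> y [^] (k y::nat) \<in> L" using nil by metis
  obtain A where A: "A \<subseteq> carrier R" "finite A" "K = Idl A" using finetely_gen[OF K] by auto
  have AK: "A \<subseteq> K" using A genideal_self by auto
  have "ideal_pow R K ((\<Sum>x\<in>A. k x - 1) + 1) \<subseteq> L"
    unfolding A(3) using k AK by (intro Idl_pow_subset_if_gens A L) auto
  then show ?thesis by blast
qed

lemma ideal_subset_sat_Nakayama:
  assumes P: "primeideal P R" and N: "ideal N R" and M: "ideal M R" "M \<subseteq> sat P (N <+> P \<cdot> M)"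
  shows "M \<subseteq> sat P N"
proof -
  obtain A where A: "A \<subseteq> carrier R" "finite A" "M = Idl A" using finetely_gen[OF M(1)] by auto
  have "A \<subseteq> sat P (N <+> P \<cdot> (Idl A))" using A M genideal_self[OF A(1)] by auto
  then have "A \<subseteq> sat P N" by (rule Idl_subset_sat_Nakayama[OF P A(2,1) N])
  then show ?thesis unfolding A(3) by (intro genideal_minimal sat_ideal P N)
qed

text \<open>If a power of P lies in K, the localization at P is Artinian modulo K: P annihilates
  each quotient P^i / P^(i+1), and finitely many generators give finitely many steps of dimension at
  most one.\<close>

lemma sat_dcc_carrier:
  assumes P: "primeideal P R" and "ideal K R" "sat P K \<subseteq> K" "ideal_pow R P n \<subseteq> K"
  shows "sat_dcc P K (carrier R)"
  using assms(2-)
proof (induction n arbitrary: K)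
  case 0
  then have "K = carrier R" using ideal_subset_carrier by (auto simp: ideal_pow_0)
  then show ?case by (intro sat_dccI[OF P]) (metis subset_antisym)
next
  case (Suc n)
  have iP: "ideal P R" using P by (rule primeideal.axioms(1))
  obtain A where A: "A \<subseteq> carrier R" "finite A" "ideal_pow R P n = Idl A"
    using finetely_gen[OF ideal_pow_ideal[OF iP]] by metis
  have iA: "ideal (Idl A) R" by (rule genideal_ideal[OF A(1)])
  let ?M = "sat P (K <+> Idl A)"
  have iKA: "ideal (K <+> Idl A) R" by (intro add_ideals Suc.prems iA)
  have iM: "ideal ?M R" by (rule sat_ideal[OF P iKA])
  have "sat_dcc P K ?M"
  proof (rule sat_dcc_add_Idl[OF P Suc.prems(1,2) A(2,1)])
    fix p g assume p: "p \<in> P" and "g \<in> A"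
    then have g: "g \<in> ideal_pow R P n" using A genideal_self by auto
    then have "g \<otimes> p \<in> ideal_pow R P (Suc n)" using p by (simp add: ideal_prod.prod)
    moreover have "g \<in> carrier R" "p \<in> carrier R" using g p iP ideal.Icarr ideal_pow_ideal by metis+
    ultimately show "p \<otimes> g \<in> K" using Suc.prems(3) m_comm by auto
  qed
  moreover have sub: "K \<subseteq> ?M" "Idl A \<subseteq> ?M"
    using subset_sat[OF P iKA] subset_set_add[OF Suc.prems(1) iA] by blast+
  have "sat_dcc P ?M (carrier R)"
    using sub A by (intro Suc.IH iM sat_sat P) auto
  ultimately show ?case
    using sub ideal_subset_carrier[OF iM] sat_subset_carrier
    by (intro sat_dcc_trans[OF P iM sat_sat[OF P] sub(1) oneideal]) auto
qed

text \<open>Krull's principal ideal theorem. If \<open>P\<close> is minimal over \<open>P0 + (x)\<close>, then the descending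
  chain of the ideals \<open>Q\<^sup>(\<^sup>k\<^sup>) + (x)\<close>, with symbolic powers taken modulo \<open>P0\<close>, stabilizes in the
  localization at \<open>P\<close>, and Nakayama's lemma makes \<open>Q\<close> nilpotent modulo \<open>P0\<close>.\<close>

theorem principal_ideal_theorem:
  assumes P0: "primeideal P0 R" and Q: "primeideal Q R" and P: "primeideal P R"
    and "P0 \<subset> Q" "Q \<subset> P" "x \<in> P"
  obtains P' where "primeideal P' R" "P0 \<subseteq> P'" "x \<in> P'" "P' \<subset> P"
proof (rule ccontr)
  assume "\<not> thesis"
  then have contra: "x \<in> P' \<Longrightarrow> P0 \<subseteq> P' \<Longrightarrow> P' \<subset> P \<Longrightarrow> \<not> primeideal P' R" for P' using that by blast
  then have xQ: "x \<notin> Q" using Q assms by auto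
  have iP0: "ideal P0 R" and iQ: "ideal Q R" and iP: "ideal P R"
    using P0 Q P by (auto intro: primeideal.axioms(1))
  have x: "x \<in> carrier R" using \<open>x \<in> P\<close> iP by (rule ideal.Icarr[rotated])
  have ix: "ideal (PIdl x) R" by (rule cgenideal_ideal[OF x])
  define I where "I = P0 <+> PIdl x"
  have iI: "ideal I R" unfolding I_def by (intro add_ideals iP0 ix)
  have I: "P0 \<subseteq> I" "PIdl x \<subseteq> I" unfolding I_def using subset_set_add[OF iP0 ix] by auto
  have xI: "x \<in> I" using I cgenideal_self[OF x] by auto
  define K where "K = sat P I"
  have iK: "ideal K R" unfolding K_def by (rule sat_ideal[OF P iI])
  have "\<exists>k::nat. y [^] k \<in> K" if y: "y \<in> P" for y
  proof (rule ccontr)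
    assume no: "\<nexists>k::nat. y [^] k \<in> K"
    have yc: "y \<in> carrier R" using y iP by (rule ideal.Icarr[rotated])
    \<comment> \<open>The multiplicative set generated by y and the complement of P. A prime
      containing I and avoiding S would lie strictly inside P, since y is in P, against the
      minimality of P.\<close>
    define S where "S = {s \<otimes> y [^] k | s k::nat. s \<in> carrier R - P}"
    have S1: "s \<otimes> y [^] (k::nat) \<in> S" if "s \<in> carrier R - P" for s k using that S_def by auto
    have S2: "I \<inter> S = {}" using no yc unfolding S_def K_def by (auto intro: satI)
    have S3: "\<one> \<in> S" using S1[of \<one> 0] primeideal_one_notin[OF P] by simp
    have S4: "S \<subseteq> carrier R" using yc by (auto simp: S_def)
    have S5: "s \<otimes> t \<in> S" if "s \<in> S" "t \<in> S" for s t
    proof -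
      obtain a and k :: nat where a: "s = a \<otimes> y [^] k" "a \<in> carrier R - P"
        using \<open>s \<in> S\<close> by (auto simp: S_def)
      obtain b and l :: nat where b: "t = b \<otimes> y [^] l" "b \<in> carrier R - P"
        using \<open>t \<in> S\<close> by (auto simp: S_def)
      note ab = a(2) b(2) a(1) b(1)
      have [simp]: "a \<in> carrier R" "b \<in> carrier R" "y [^] k \<in> carrier R" "y [^] l \<in> carrier R"
        using ab yc by auto
      have "s \<otimes> t = (a \<otimes> b) \<otimes> y [^] (k + l)" 
        unfolding ab(3,4) nat_pow_mult[OF yc, symmetric] by (simp add: m_ac)
      then show ?thesis using S1[OF primeideal_mult_notin[OF P ab(1,2)], of "k + l"] by simp
    qed
    obtain P' where P': "primeideal P' R" "I \<subseteq> P'" "P' \<inter> S = {}"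
      by (rule exists_prime_avoiding[OF iI S4 S3 S2 S5])
    have "y \<in> S" using S1[of \<one> 1] primeideal_one_notin[OF P] yc by simp
    moreover have "z \<in> S" if "z \<in> carrier R - P" for z using S1[of z 0] that by simp
    moreover have "P' \<subseteq> carrier R" using P'(1) primeideal.axioms(1) ideal_subset_carrier by blast
    ultimately have "P' \<subset> P" using P'(3) y by blast
    then show False using contra[of P'] P'(1,2) I(1) xI by blast
  qed
  then obtain N where PK: "ideal_pow R P N \<subseteq> K"
    using ideal_pow_subset_if_nil[OF iP iK] by auto
  have dcc: "sat_dcc P K (carrier R)"
    by (rule sat_dcc_carrier[OF P iK _ PK]) (simp add: K_def sat_sat[OF P])
  define QS where "QS k = sat Q (ideal_pow R Q k <+> P0)" for k
  have iQk: "ideal (ideal_pow R Q k <+> P0) R" for k by (intro add_ideals ideal_pow_ideal iQ iP0)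
  have iQS: "ideal (QS k) R" for k unfolding QS_def by (rule sat_ideal[OF Q iQk])
  have QS_dec: "QS (Suc k) \<subseteq> QS k" for k
    unfolding QS_def using ideal_pow_antimono[OF iQ, of k "Suc k"] by (intro sat_mono set_add_mono) auto
  have QSs: "z \<in> QS k" if "s \<in> carrier R - Q" "z \<in> carrier R" "s \<otimes> z \<in> QS k" for s z k
    using sat_memD[OF Q that(1,2)] that(3) unfolding QS_def by blast
  have P0QS: "P0 \<subseteq> QS k" for k
    unfolding QS_def using subset_sat[OF Q iQk] subset_set_add[OF ideal_pow_ideal[OF iQ] iP0] by blast
  have QQS: "ideal_pow R Q k \<subseteq> QS k" for k
    unfolding QS_def using subset_sat[OF Q iQk] subset_set_add[OF ideal_pow_ideal[OF iQ] iP0] by blast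
  have iL: "ideal (QS k <+> I) R" for k by (intro add_ideals iQS iI)
  obtain n where n: "\<And>k. k \<ge> n \<Longrightarrow> sat P (QS k <+> I) = sat P (QS n <+> I)"
  proof (rule sat_dccD[OF P dcc, of "\<lambda>k. sat P (QS k <+> I)"])
    fix k
    show "ideal (sat P (QS k <+> I)) R" by (rule sat_ideal[OF P iL])
    show "sat P (sat P (QS k <+> I)) \<subseteq> sat P (QS k <+> I)" by (rule sat_sat[OF P])
    show "K \<subseteq> sat P (QS k <+> I)" unfolding K_def by (intro sat_mono subset_set_add iQS iI)
    show "sat P (QS k <+> I) \<subseteq> carrier R" by (rule sat_subset_carrier)
    show "sat P (QS (Suc k) <+> I) \<subseteq> sat P (QS k <+> I)" by (intro sat_mono set_add_mono QS_dec) simp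
  qed (rule that)
  have n: "QS n \<subseteq> sat P (QS (Suc n) <+> I)"
    using n[of "Suc n"] subset_sat[OF P iL[of n]] subset_set_add(1)[OF iQS[of n] iI] by simp
  have iN: "ideal (QS (Suc n) <+> P \<cdot> QS n) R" by (intro add_ideals iQS ideal_prod_is_ideal iP)
  have "QS n \<subseteq> sat P (QS (Suc n) <+> P \<cdot> QS n)"
  proof
    fix z assume z: "z \<in> QS n"
    then obtain s where s: "s \<in> carrier R - P" "s \<otimes> z \<in> QS (Suc n) <+> I" and zc: "z \<in> carrier R"
      using n by (auto simp: sat_def)
    then obtain w a r where w: "w \<in> QS (Suc n)" "a \<in> P0" "r \<in> carrier R" "s \<otimes> z = w \<oplus> (a \<oplus> r \<otimes> x)"
      by (auto simp: set_add_iff I_def PIdl_iff)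
    have [simp]: "w \<in> carrier R" "a \<in> carrier R" "r \<in> carrier R" "x \<in> carrier R" "s \<in> carrier R" "z \<in> carrier R"
      using w x s zc ideal.Icarr[OF iQS] ideal.Icarr[OF iP0] by auto
    have wa: "w \<oplus> a \<in> QS (Suc n)" using w P0QS by (intro ideal_add_closed[OF iQS]) auto
    have "r \<otimes> x = (w \<oplus> (a \<oplus> r \<otimes> x)) \<ominus> (w \<oplus> a)"
      by (simp add: a_assoc[symmetric] add_minus_cancel)
    also have "\<dots> = s \<otimes> z \<ominus> (w \<oplus> a)" using w by simp
    also have "\<dots> \<in> QS n" using wa QS_dec z by (intro ideal_minus_closed[OF iQS] ideal.I_l_closed[OF iQS]) auto
    finally have "x \<otimes> r \<in> QS n" by (simp add: m_comm)
    \<comment> \<open>Symbolic powers are used for this step: \<open>QS n\<close> is saturated at Q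
      and x is outside Q, so x can be cancelled and the term in x moves into P times
      \<open>QS n\<close>.\<close>
    then have "r \<in> QS n" using xQ QSs[of x r n] by simp
    then have "x \<otimes> r \<in> P \<cdot> QS n" using \<open>x \<in> P\<close> by (intro ideal_prod.prod)
    moreover have "s \<otimes> z = (w \<oplus> a) \<oplus> x \<otimes> r" using w by (simp add: a_assoc m_comm)
    ultimately have "s \<otimes> z \<in> QS (Suc n) <+> P \<cdot> QS n" 
      using set_addI[OF wa, of "x \<otimes> r" "P \<cdot> QS n"] by simp
    then show "z \<in> sat P (QS (Suc n) <+> P \<cdot> QS n)" using s by (intro satI) auto
  qed
  then have "QS n \<subseteq> sat P (QS (Suc n))" by (rule ideal_subset_sat_Nakayama[OF P iQS iQS])
  also have "\<dots> \<subseteq> QS (Suc n)" using \<open>Q \<subset> P\<close> QSs by (auto simp: sat_def)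
  \<comment> \<open>The second use of Nakayama's lemma is at Q instead of P: the symbolic power
    Q^(n+1) is written as P0 + Q Q^n up to saturation at Q.\<close>
  finally have "ideal_pow R Q n \<subseteq> sat Q (ideal_pow R Q (Suc n) <+> P0)" using QQS QS_def by blast
  also have "ideal_pow R Q (Suc n) <+> P0 = P0 <+> Q \<cdot> ideal_pow R Q n"
    using set_add_comm[of "ideal_pow R Q (Suc n)" P0] ideal_subset_carrier iP0 iQ ideal_pow_ideal
      ideal_prod_commute[OF iQ ideal_pow_ideal[OF iQ]] ideal_pow_Suc by metis
  finally have "ideal_pow R Q n \<subseteq> sat Q P0"
    by (rule ideal_subset_sat_Nakayama[OF Q iP0 ideal_pow_ideal[OF iQ]])
  also have "\<dots> \<subseteq> P0" using primeideal.I_prime[OF P0] \<open>P0 \<subset> Q\<close> by (auto simp: sat_def)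
  finally have Qn: "ideal_pow R Q n \<subseteq> P0" .
  have "Q \<subseteq> P0"
    using pow_mem_ideal_pow[of _ Q n] Qn ideal.Icarr[OF iQ] by (auto intro: primeideal_pow_mem[OF P0])
  then show False using \<open>P0 \<subset> Q\<close> by auto
qed

end

section \<open>Chains of prime ideals\<close>

context cring
begin

lemma set_add_Idl_insert:
  assumes I: "ideal I R" and x: "x \<in> carrier R" and B: "B \<subseteq> carrier R"
  shows "I <+> Idl (insert x B) = (I <+> PIdl x) <+> Idl B"
proof
  note iB = genideal_ideal[OF B] and ix = cgenideal_ideal[OF x]
  note iIx = add_ideals[OF I ix] and iBx = add_ideals[OF genideal_ideal[OF B] cgenideal_ideal[OF x]]
  note iL = add_ideals[OF I iBx] and iR = add_ideals[OF iIx iB]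
  have 1: "I \<subseteq> (I <+> PIdl x) <+> Idl B" "PIdl x \<subseteq> (I <+> PIdl x) <+> Idl B" "Idl B \<subseteq> (I <+> PIdl x) <+> Idl B"
    using subset_set_add[OF I ix] subset_set_add[OF iIx iB] by blast+
  show "I <+> Idl (insert x B) \<subseteq> (I <+> PIdl x) <+> Idl B"
    unfolding Idl_insert[OF x B] by (intro set_add_subset_ideal iR 1)
  have 2: "I \<subseteq> I <+> (Idl B <+> PIdl x)" "PIdl x \<subseteq> I <+> (Idl B <+> PIdl x)" "Idl B \<subseteq> I <+> (Idl B <+> PIdl x)"
    using subset_set_add[OF iB ix] subset_set_add[OF I iBx] by blast+
  show "(I <+> PIdl x) <+> Idl B \<subseteq> I <+> Idl (insert x B)"
    unfolding Idl_insert[OF x B] by (intro set_add_subset_ideal iL 2)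
qed

text \<open>The recursion runs downwards from a fixed top prime, and the predicate constrains only
  the bottom one. Passing to a quotient of R then changes nothing but the predicate.\<close>

primrec prime_chain :: "('a set \<Rightarrow> bool) \<Rightarrow> nat \<Rightarrow> 'a set \<Rightarrow> bool" where
  "prime_chain \<phi> 0 P \<longleftrightarrow> primeideal P R \<and> \<phi> P"
| "prime_chain \<phi> (Suc n) P \<longleftrightarrow> primeideal P R \<and> (\<exists>Q. prime_chain \<phi> n Q \<and> Q \<subset> P)"

lemma prime_chain_prime: "prime_chain \<phi> n P \<Longrightarrow> primeideal P R"
  by (cases n) auto

lemma prime_chain_mono:
  "(\<And>P. primeideal P R \<Longrightarrow> \<phi> P \<Longrightarrow> \<psi> P) \<Longrightarrow> prime_chain \<phi> n P \<Longrightarrow> prime_chain \<psi> n P"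
proof (induction n arbitrary: P)
  case (Suc n)
  then show ?case by (metis prime_chain.simps(2))
qed auto

lemma prime_chain_extend:
  assumes "\<And>P1. primeideal P1 R \<Longrightarrow> \<psi> P1 \<Longrightarrow> \<exists>P0. primeideal P0 R \<and> \<phi> P0 \<and> P0 \<subset> P1"
  shows "prime_chain \<psi> n P \<Longrightarrow> prime_chain \<phi> (Suc n) P"
proof (induction n arbitrary: P)
  case 0
  then show ?case using assms by auto
next
  case (Suc n)
  then obtain Q where "prime_chain \<psi> n Q" "Q \<subset> P" by auto
  then show ?case using Suc by (metis prime_chain.simps(2))
qed

lemma prime_chain_bottom:
  "prime_chain \<phi> n P \<Longrightarrow> \<exists>P0. \<phi> P0 \<and> P0 \<subseteq> P \<and> (n > 0 \<longrightarrow> P0 \<subset> P)"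
proof (induction n arbitrary: P)
  case (Suc n)
  then obtain Q where "prime_chain \<phi> n Q" "Q \<subset> P" by auto
  then show ?case using Suc.IH by (meson subset_psubset_trans psubset_imp_subset)
qed auto

end

context noetherian_cring
begin

text \<open>The chain is rerouted so that x enters as low as possible. If the prime Q below P misses
  x, the principal ideal theorem, applied over the next prime Q', replaces Q by a prime that
  contains x and still lies strictly between Q' and P.\<close>

lemma prime_chain_through:
  assumes "prime_chain \<phi> (Suc n) P" "x \<in> P"
  shows "prime_chain (\<lambda>P1. x \<in> P1 \<and> (\<exists>P0. primeideal P0 R \<and> \<phi> P0 \<and> P0 \<subset> P1)) n P"
  using assms
proof (induction n arbitrary: P)
  case 0
  then show ?case by auto
next
  case (Suc n)
  have P: "primeideal P R" using Suc.prems(1) by (rule prime_chain_prime)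
  obtain Q where Q: "prime_chain \<phi> (Suc n) Q" "Q \<subset> P" using Suc.prems(1) by auto
  show ?case
  proof (cases "x \<in> Q")
    case True
    show ?thesis using Suc.IH[OF Q(1) True] Q(2) P by (auto simp only: prime_chain.simps)
  next
    case False
    obtain Q' where Q': "prime_chain \<phi> n Q'" "Q' \<subset> Q" using Q(1) by auto
    obtain P' where P': "primeideal P' R" "Q' \<subseteq> P'" "x \<in> P'" "P' \<subset> P"
      by (rule principal_ideal_theorem[OF prime_chain_prime[OF Q'(1)] prime_chain_prime[OF Q(1)] P
          Q'(2) Q(2) \<open>x \<in> P\<close>])
    have "Q' \<subset> P'" using P'(2,3) Q'(2) False by auto
    then have "prime_chain \<phi> (Suc n) P'" using P'(1) Q'(1) by auto
    then show ?thesis using Suc.IH[of P'] P'(3,4) P by (auto simp only: prime_chain.simps)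
  qed
qed

lemma prime_chain_add_PIdl:
  assumes "prime_chain (\<lambda>P. I \<subseteq> P) (Suc n) P" "x \<in> P"
  shows "prime_chain (\<lambda>P. I <+> PIdl x \<subseteq> P) n P"
proof (rule prime_chain_mono[OF _ prime_chain_through[OF assms]])
  fix P1 assume "primeideal P1 R" "x \<in> P1 \<and> (\<exists>P0. primeideal P0 R \<and> I \<subseteq> P0 \<and> P0 \<subset> P1)"
  then show "I <+> PIdl x \<subseteq> P1"
    using primeideal.axioms(1)[of P1 R] by (intro set_add_subset_ideal cgenideal_minimal) auto
qed

end

section \<open>Noetherian local rings: Nakayama's lemma, Krull's intersection theorem,
  heights\<close>

sublocale noetherian_local_ring \<subseteq> noetherian_cring
  by unfold_locales

context noetherian_local_ring
begin

lemma max_prime: "primeideal \<mm> R"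
  by (rule maximalideal_prime[OF maximal])

lemma max_ideal: "ideal \<mm> R"
  by (rule maximalideal.axioms(1)[OF maximal])

lemma proper_ideal_subset_max:
  assumes I: "ideal I R" "I \<noteq> carrier R"
  shows "I \<subseteq> \<mm>"
proof -
  let ?F = "{J. ideal J R \<and> I \<subseteq> J \<and> J \<noteq> carrier R}"
  obtain M where M: "M \<in> ?F" and max: "\<And>J. J \<in> ?F \<Longrightarrow> M \<subseteq> J \<Longrightarrow> J = M"
  proof (rule maximal_in_ideal_family[of ?F, rotated 2])
    show "?F \<noteq> {}" using I by blast
    show "ideal J R" if "J \<in> ?F" for J using that by blast
  qed (rule that)
  have "maximalideal M R"
  proof (rule maximalidealI)
    show "ideal M R" "carrier R \<noteq> M" using M by auto
    fix J assume J: "ideal J R" "M \<subseteq> J" "J \<subseteq> carrier R"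
    show "J = M \<or> J = carrier R"
    proof (rule disjCI)
      assume "J \<noteq> carrier R"
      then have "J \<in> ?F" using J M by auto
      then show "J = M" using max J(2) by blast
    qed
  qed
  then have "M = \<mm>" by (rule maximal_unique)
  then show ?thesis using M by auto
qed

lemma unit_if_notin_max: "x \<in> carrier R \<Longrightarrow> x \<notin> \<mm> \<Longrightarrow> x \<in> Units R"
proof -
  assume x: "x \<in> carrier R" "x \<notin> \<mm>"
  have "PIdl x = carrier R"
    using proper_ideal_subset_max[OF cgenideal_ideal[OF x(1)]] cgenideal_self[OF x(1)] x(2) by auto
  then have "\<one> \<in> PIdl x" by simp
  then obtain r where "r \<in> carrier R" "\<one> = r \<otimes> x" by (auto simp: PIdl_iff)
  then show ?thesis using x(1) by (auto simp: Units_def m_comm)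
qed

lemma one_notin_max: "\<one> \<notin> \<mm>"
  using primeideal_one_notin[OF max_prime] by auto

lemma mem_if_unit_mult_mem:
  assumes "ideal I R" "s \<in> carrier R" "s \<notin> \<mm>" "z \<in> carrier R" "s \<otimes> z \<in> I"
  shows "z \<in> I"
proof -
  have s: "s \<in> Units R" using assms by (intro unit_if_notin_max)
  have "inv s \<otimes> (s \<otimes> z) = z" using s assms by (simp add: m_assoc[symmetric])
  then show ?thesis using ideal.I_l_closed[OF assms(1,5), of "inv s"] s by simp
qed

lemma sat_max: "ideal I R \<Longrightarrow> sat \<mm> I \<subseteq> I"
  using mem_if_unit_mult_mem by (auto simp: sat_def)

lemma Nakayama:
  assumes "ideal N R" "ideal M R" "M \<subseteq> N <+> \<mm> \<cdot> M"
  shows "M \<subseteq> N"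
proof -
  have "ideal (N <+> \<mm> \<cdot> M) R" by (intro add_ideals ideal_prod_is_ideal assms max_ideal)
  then have "M \<subseteq> sat \<mm> (N <+> \<mm> \<cdot> M)" using subset_sat[OF max_prime] assms(3) by blast
  then have "M \<subseteq> sat \<mm> N" by (rule ideal_subset_sat_Nakayama[OF max_prime assms(1,2)])
  then show ?thesis using sat_max[OF assms(1)] by blast
qed

text \<open>An ideal \<open>L\<close> maximal among those containing \<open>I + \<mm>y\<close> but not \<open>y\<close> contains a power of \<open>\<mm>\<close>,
  because the ideals \<open>(L : a\<^sup>k)\<close> stabilize for each \<open>a \<in> \<mm>\<close>.\<close>

theorem Krull_intersection:
  assumes I: "ideal I R" and y: "y \<in> carrier R" and all: "\<And>n. y \<in> I <+> ideal_pow R \<mm> n"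
  shows "y \<in> I"
proof (rule ccontr)
  assume yI: "y \<notin> I"
  have iy: "ideal (PIdl y) R" by (rule cgenideal_ideal[OF y])
  have imy: "ideal (\<mm> \<cdot> (PIdl y)) R" by (rule ideal_prod_is_ideal[OF max_ideal iy])
  define J where "J = I <+> \<mm> \<cdot> (PIdl y)"
  have iJ: "ideal J R" unfolding J_def by (rule add_ideals[OF I imy])
  have J: "I \<subseteq> J" "\<mm> \<cdot> (PIdl y) \<subseteq> J" unfolding J_def by (rule subset_set_add[OF I imy])+
  have yJ: "y \<notin> J"
  proof
    assume "y \<in> J"
    then have "PIdl y \<subseteq> I <+> \<mm> \<cdot> (PIdl y)" using cgenideal_minimal[OF iJ] J_def by simp
    then have "PIdl y \<subseteq> I" by (rule Nakayama[OF I iy])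
    then show False using cgenideal_self[OF y] yI by auto
  qed
  let ?F = "{L. ideal L R \<and> J \<subseteq> L \<and> y \<notin> L}"
  obtain L where L: "L \<in> ?F" and max: "\<And>K. K \<in> ?F \<Longrightarrow> L \<subseteq> K \<Longrightarrow> K = L"
  proof (rule maximal_in_ideal_family[of ?F, rotated 2])
    show "?F \<noteq> {}" using iJ yJ by blast
    show "ideal K R" if "K \<in> ?F" for K using that by blast
  qed (rule that)
  have iL: "ideal L R" using L by auto
  have "\<exists>k::nat. a [^] k \<in> L" if a: "a \<in> \<mm>" for a
  proof -
    have ac: "a \<in> carrier R" using a max_ideal by (rule ideal.Icarr[rotated])
    let ?G = "range (\<lambda>k::nat. colon L (a [^] k))"
    have iG: "ideal (colon L (a [^] k)) R" for k :: nat by (intro colon_ideal iL nat_pow_closed ac)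
    obtain M where M: "M \<in> ?G" and maxM: "\<And>K. K \<in> ?G \<Longrightarrow> M \<subseteq> K \<Longrightarrow> K = M"
    proof (rule maximal_in_ideal_family[of ?G, rotated 2])
      show "?G \<noteq> {}" by simp
      show "ideal K R" if "K \<in> ?G" for K using that iG by auto
    qed (rule that)
    obtain k :: nat where k: "M = colon L (a [^] k)" using M by auto
    have "colon L (a [^] k) \<subseteq> colon L (a [^] Suc k)"
      using ac by (auto simp: colon_def m_assoc[symmetric] intro: ideal.I_r_closed[OF iL])
    then have eq: "colon L (a [^] Suc k) = colon L (a [^] k)" using maxM k by blast
    have "a [^] k \<in> L"
    proof (rule ccontr)
      assume akL: "a [^] k \<notin> L"
      have akc: "a [^] k \<in> carrier R" using ac by simp
      note iak = cgenideal_ideal[OF akc]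
      have "L <+> PIdl (a [^] k) \<noteq> L"
        using subset_set_add[OF iL iak] cgenideal_self[OF akc] akL by blast
      then have "L <+> PIdl (a [^] k) \<notin> ?F" using max subset_set_add(1)[OF iL iak] by blast
      then have "y \<in> L <+> PIdl (a [^] k)"
        using L subset_set_add(1)[OF iL iak] add_ideals[OF iL iak] by blast
      then obtain r where r: "r \<in> carrier R" "ideal_cong L y (r \<otimes> a [^] k)"
        using add_PIdl_cong_iff[OF iL akc] by auto
      have "ideal_cong L (y \<otimes> a) ((r \<otimes> a [^] k) \<otimes> a)"
        by (intro ideal_cong_mult[OF iL] r ideal_cong_refl iL ac)
      moreover have "a \<otimes> y \<in> \<mm> \<cdot> (PIdl y)" using a cgenideal_self[OF y] by (rule ideal_prod.prod)
      then have "y \<otimes> a \<in> L" using J L ac y by (auto simp: m_comm)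
      ultimately have "(r \<otimes> a [^] k) \<otimes> a \<in> L" using ideal_cong_mem_iff[OF iL] by blast
      then have "r \<in> colon L (a [^] Suc k)" using r ac by (simp add: colon_def m_assoc)
      then have "r \<otimes> a [^] k \<in> L" unfolding eq by (simp add: colon_def)
      then have "y \<in> L" using ideal_cong_mem_iff[OF iL r(2)] by simp
      then show False using L by simp
    qed
    then show ?thesis by blast
  qed
  then obtain N where N: "ideal_pow R \<mm> N \<subseteq> L" using ideal_pow_subset_if_nil[OF max_ideal iL] by auto
  have "I <+> ideal_pow R \<mm> N \<subseteq> L" using J L N by (intro set_add_subset_ideal iL) auto
  then show False using all[of N] L by auto
qed

lemma Krull_intersection_zero:
  assumes "y \<in> carrier R" "\<And>n. y \<in> ideal_pow R \<mm> n"
  shows "y = \<zero>"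
proof -
  have "y \<in> {\<zero>} <+> ideal_pow R \<mm> n" for n
    using assms(2)[of n] subset_set_add(2)[OF zeroideal ideal_pow_ideal[OF max_ideal, of n]] by blast
  then have "y \<in> {\<zero>}" by (rule Krull_intersection[OF zeroideal assms(1)])
  then show ?thesis by simp
qed

text \<open>Krull's height theorem modulo I. Adding one generator to I shortens the chain by at most
  one, and without generators left I equals the maximal ideal, above which there is no proper
  step.\<close>

lemma prime_chain_length_le:
  assumes "finite B" "B \<subseteq> carrier R" "ideal I R" "\<mm> = I <+> Idl B"
    "prime_chain (\<lambda>P. I \<subseteq> P) n \<mm>"
  shows "n \<le> card B"
  using assms
proof (induction B arbitrary: I n rule: finite_induct)
  case empty
  have "\<mm> \<subseteq> I" using empty set_add_subset_ideal[of I I "{\<zero>}"] ideal_zero_mem[of I] by (simp add: Idl_empty)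
  then show ?case using prime_chain_bottom[OF empty(4)] by auto
next
  case (insert x B)
  have x: "x \<in> carrier R" and B: "B \<subseteq> carrier R" using insert.prems by auto
  note ix = cgenideal_ideal[OF x]
  show ?case
  proof (cases n)
    case (Suc k)
    have "x \<in> Idl (insert x B)" using insert.prems genideal_self by blast
    then have "x \<in> \<mm>"
      using insert.prems(3) subset_set_add(2)[OF insert.prems(2) genideal_ideal[OF insert.prems(1)]] by blast
    then have "prime_chain (\<lambda>P. I <+> PIdl x \<subseteq> P) k \<mm>"
      using insert.prems(4) unfolding Suc by (rule prime_chain_add_PIdl[rotated])
    moreover have "\<mm> = (I <+> PIdl x) <+> Idl B"
      using insert.prems(3) set_add_Idl_insert[OF insert.prems(2) x B] by simp
    ultimately have "k \<le> card B"
      using insert.IH[OF B add_ideals[OF insert.prems(2) ix]] by blast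
    then show ?thesis using Suc insert by simp
  qed simp
qed

text \<open>If \<open>\<mm>\<close> is generated modulo \<open>I\<close> by as many elements as the dimension of \<open>R/I\<close>, then \<open>I\<close> is
  prime: for a generator \<open>x\<close>, a prime \<open>P0\<close> with \<open>I \<subseteq> P0 \<subset> I + (x)\<close> satisfies \<open>P0 = I + x P0\<close>.\<close>

lemma primeideal_if_prime_chain:
  assumes "finite B" "B \<subseteq> carrier R" "ideal I R" "\<mm> = I <+> Idl B"
    "prime_chain (\<lambda>P. I \<subseteq> P) (card B) \<mm>"
  shows "primeideal I R"
  using assms
proof (induction B arbitrary: I rule: finite_induct)
  case empty
  have "\<mm> \<subseteq> I" using empty set_add_subset_ideal[of I I "{\<zero>}"] ideal_zero_mem[of I] by (simp add: Idl_empty)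
  moreover have "I \<subseteq> \<mm>" using empty subset_set_add[OF empty(2) genideal_ideal[of "{}"]] by auto
  ultimately show ?case using max_prime by (metis subset_antisym)
next
  case (insert x B)
  note I = \<open>ideal I R\<close>
  have x: "x \<in> carrier R" and B: "B \<subseteq> carrier R" using insert.prems by auto
  note ix = cgenideal_ideal[OF x]
  note iIx = add_ideals[OF I ix]
  have xm: "x \<in> \<mm>"
    using insert.prems(1,3) genideal_self[of "insert x B"] subset_set_add(2)[OF I genideal_ideal[OF insert.prems(1)]] by blast
  have mm: "\<mm> = (I <+> PIdl x) <+> Idl B" using insert.prems(3) set_add_Idl_insert[OF I x B] by simp
  let ?\<psi> = "\<lambda>P1. x \<in> P1 \<and> (\<exists>P0. primeideal P0 R \<and> I \<subseteq> P0 \<and> P0 \<subset> P1)"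
  have chain0: "prime_chain (\<lambda>P. I \<subseteq> P) (Suc (card B)) \<mm>" using insert.prems(4) insert.hyps by simp
  then have chain: "prime_chain ?\<psi> (card B) \<mm>" using xm by (rule prime_chain_through)
  have sub: "I <+> PIdl x \<subseteq> P1" if "ideal P1 R" "I \<subseteq> P1" "x \<in> P1" for P1
    using that by (intro set_add_subset_ideal cgenideal_minimal) auto
  have "prime_chain (\<lambda>P. I <+> PIdl x \<subseteq> P) (card B) \<mm>"
    using chain0 xm by (rule prime_chain_add_PIdl)
  then have prime: "primeideal (I <+> PIdl x) R" by (rule insert.IH[OF B iIx mm])
  have "\<exists>P0. primeideal P0 R \<and> I \<subseteq> P0 \<and> P0 \<subset> I <+> PIdl x"
  proof (rule ccontr)
    assume no: "\<not> ?thesis"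
    \<comment> \<open>With no such P0, every possible bottom prime of the rerouted chain contains I
      + (x) strictly. The prime I + (x) can then be put below it, which makes the chain longer than
      the number of generators allows.\<close>
    have "prime_chain (\<lambda>P. I <+> PIdl x \<subseteq> P) (Suc (card B)) \<mm>"
    proof (rule prime_chain_extend[OF _ chain])
      fix P1 assume P1: "primeideal P1 R" "?\<psi> P1"
      have "I <+> PIdl x \<subseteq> P1" using sub[OF primeideal.axioms(1)[OF P1(1)]] P1(2) by blast
      moreover have "I <+> PIdl x \<noteq> P1" using no P1(2) by auto
      ultimately show "\<exists>P0. primeideal P0 R \<and> I <+> PIdl x \<subseteq> P0 \<and> P0 \<subset> P1" using prime by blast
    qed
    then have "Suc (card B) \<le> card B"
      by (rule prime_chain_length_le[OF insert.hyps(1) B iIx mm])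
    then show False by simp
  qed
  then obtain P0 where P0: "primeideal P0 R" "I \<subseteq> P0" "P0 \<subset> I <+> PIdl x" by auto
  have iP0: "ideal P0 R" by (rule primeideal.axioms(1)[OF P0(1)])
  have xP0: "x \<notin> P0" using sub[OF iP0 P0(2)] P0(3) by auto
  have "P0 \<subseteq> I <+> \<mm> \<cdot> P0"
  proof
    fix y assume y: "y \<in> P0"
    then have "y \<in> I <+> PIdl x" using P0(3) by blast
    then obtain i r where ir: "i \<in> I" "r \<in> carrier R" "y = i \<oplus> r \<otimes> x"
      by (auto simp: set_add_iff PIdl_iff)
    have [simp]: "i \<in> carrier R" "r \<in> carrier R" "x \<in> carrier R" using ir x I ideal.Icarr by auto
    have "r \<otimes> x = (i \<oplus> r \<otimes> x) \<ominus> i" by (simp add: add_minus_cancel)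
    also have "\<dots> = y \<ominus> i" using ir by simp
    also have "\<dots> \<in> P0" using y ir P0(2) by (intro ideal_minus_closed[OF iP0]) auto
    finally have "r \<in> P0" using primeideal.I_prime[OF P0(1), of r x] xP0 by auto
    then have "x \<otimes> r \<in> \<mm> \<cdot> P0" using xm by (intro ideal_prod.prod)
    then show "y \<in> I <+> \<mm> \<cdot> P0" using ir(1,3) set_addI[of i I "x \<otimes> r"] by (simp add: m_comm)
  qed
  then have "P0 \<subseteq> I" by (rule Nakayama[OF I iP0])
  then show ?case using P0 by (metis subset_antisym)
qed

end

text \<open>A regular system of parameters in the form in which it gets used. Quantifying over all
  subsets, instead of fixing an order, makes the parameters a regular sequence in every
  order.\<close>

definition (in cring) partial_primes :: "'a set \<Rightarrow> bool" where
  "partial_primes X0 \<longleftrightarrow> finite X0 \<and> X0 \<subseteq> carrier R \<and>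
    (\<forall>S\<subseteq>X0. primeideal (Idl S) R \<and> (\<forall>x\<in>X0 - S. x \<notin> Idl S))"

text \<open>Regularity makes the height bound tight. Dividing by a generator costs the chain at most
  one step, so modulo any part S of the minimal generating set there are still as many chain steps
  as remaining generators, and \<open>primeideal_if_prime_chain\<close> applies.\<close>

lemma (in regular_local_ring) regular_parameters:
  obtains X0 where "partial_primes X0" "\<mm> = Idl X0"
proof -
  define n where "n = min_gens R \<mm>"
  have "\<exists>n B. finite B \<and> card B = n \<and> B \<subseteq> carrier R \<and> \<mm> = Idl B"
    using finetely_gen[OF max_ideal] by blast
  then have "\<exists>B. finite B \<and> card B = n \<and> B \<subseteq> carrier R \<and> \<mm> = Idl B"
    unfolding n_def min_gens_def by (rule LeastI_ex)
  then obtain B where B: "finite B" "card B = n" "B \<subseteq> carrier R" "\<mm> = Idl B" by auto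
  have zs: "{\<zero>} <+> I = I" if I: "ideal I R" for I
    using subset_set_add(2)[OF zeroideal I] set_add_subset_ideal[OF I, of "{\<zero>}" I] ideal_zero_mem[OF I] by auto
  have mB: "\<mm> = {\<zero>} <+> Idl B" using zs[OF genideal_ideal[OF B(3)]] B(4) by simp
  define D where "D = {enat n | n. \<exists>P :: nat \<Rightarrow> 'a set.
     (\<forall>i\<le>n. primeideal (P i) R) \<and> (\<forall>i<n. P i \<subset> P (Suc i))}"
  have D: "Sup D = enat n" using regular unfolding D_def krull_dim_def n_def by simp
  have "enat 0 \<in> D" unfolding D_def using max_prime by auto
  then have "D \<noteq> {}" by auto
  \<comment> \<open>In \<open>enat\<close> an infinite set has supremum infinity, so a finite
    supremum is attained and yields an actual chain.\<close>
  moreover have "finite D" using D by (auto simp: Sup_enat_def split: if_splits)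
  ultimately have "enat n \<in> D" using D Max_in[of D] by (simp add: Sup_enat_def)
  then obtain P where P: "\<And>i. i \<le> n \<Longrightarrow> primeideal (P i) R" "\<And>i. i < n \<Longrightarrow> P i \<subset> P (Suc i)"
    unfolding D_def by auto
  have zP: "{\<zero>} \<subseteq> Q" if "primeideal Q R" for Q
    using ideal_zero_mem primeideal.axioms(1)[OF that] by auto
  have chain: "prime_chain (\<lambda>P. {\<zero>} \<subseteq> P) i (P i)" if "i \<le> n" for i
    using that
  proof (induction i)
    case 0
    then show ?case using P(1)[of 0] zP by auto
  next
    case (Suc i)
    then show ?case using P(1)[of "Suc i"] P(2)[of i] by auto
  qed
  \<comment> \<open>Otherwise the maximal ideal could be put on top, giving a chain longer than the
    number of generators.\<close>
  have "P n = \<mm>"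
  proof (rule ccontr)
    assume ne: "P n \<noteq> \<mm>"
    have "P n \<subseteq> \<mm>" using primeideal.I_notcarr[OF P(1)[of n]] primeideal.axioms(1)[OF P(1)[of n]]
      by (intro proper_ideal_subset_max) auto
    then have "prime_chain (\<lambda>P. {\<zero>} \<subseteq> P) (Suc n) \<mm>" using ne chain[of n] max_prime by auto
    then have "Suc n \<le> card B" by (rule prime_chain_length_le[OF B(1,3) zeroideal mB])
    then show False using B(2) by simp
  qed
  then have chain0: "prime_chain (\<lambda>P. {\<zero>} \<subseteq> P) n \<mm>" using chain[of n] by simp
  have split: "\<mm> = Idl S <+> Idl T" if "S \<union> T = B" for S T
    using Idl_Un[of S T] that B by auto
  have chainS: "prime_chain (\<lambda>P. Idl S \<subseteq> P) (card (B - S)) \<mm>" if "S \<subseteq> B" for S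
    using finite_subset[OF that B(1)] that
  proof (induction S rule: finite_induct)
    case empty
    then show ?case using chain0 B by (simp add: Idl_empty)
  next
    case (insert x S)
    have S: "S \<subseteq> carrier R" and x: "x \<in> carrier R" "x \<in> B" using insert.prems B by auto
    note iS = genideal_ideal[OF S]
    have "B - S = insert x (B - insert x S)" using insert by auto
    then have card: "card (B - S) = Suc (card (B - insert x S))"
      using B(1) by (metis Diff_iff card_insert_disjoint finite_Diff insertI1)
    have "prime_chain (\<lambda>P. Idl S \<subseteq> P) (Suc (card (B - insert x S))) \<mm>"
      using insert.IH insert.prems unfolding card[symmetric] by blast
    moreover have xm: "x \<in> \<mm>" using x B genideal_self[OF B(3)] by auto
    ultimately show ?case unfolding Idl_insert[OF x(1) S] by (rule prime_chain_add_PIdl)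
  qed
  have "partial_primes B"
    unfolding partial_primes_def
  proof (intro conjI allI impI ballI B(1,3))
    fix S assume S: "S \<subseteq> B"
    have Sc: "S \<subseteq> carrier R" "B - S \<subseteq> carrier R" using S B(3) by auto
    show "primeideal (Idl S) R"
      using S B(1) by (intro primeideal_if_prime_chain[OF _ Sc(2) genideal_ideal[OF Sc(1)] split chainS]) auto
    fix x assume x: "x \<in> B - S"
    show "x \<notin> Idl S"
    proof
      assume xS: "x \<in> Idl S"
      have xc: "x \<in> carrier R" using x B(3) by auto
      have Tc: "B - insert x S \<subseteq> carrier R" using B(3) by auto
      have "Idl (insert x S) \<subseteq> Idl S"
        using xS genideal_self[OF Sc(1)] by (intro genideal_minimal genideal_ideal Sc) auto
      moreover have "Idl S \<subseteq> Idl (insert x S)" using xc Sc by (intro subset_Idl_subset) auto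
      ultimately have "\<mm> = Idl S <+> Idl (B - insert x S)"
        using split[of "insert x S" "B - insert x S"] x S by auto
      \<comment> \<open>Without x there are fewer generators modulo (S) than the chain above (S) has
        steps.\<close>
      then have "card (B - S) \<le> card (B - insert x S)"
        using B(1) by (intro prime_chain_length_le[OF _ Tc genideal_ideal[OF Sc(1)] _ chainS[OF S]]) auto
      moreover have "card (B - insert x S) < card (B - S)"
        using x B(1) by (intro psubset_card_mono) auto
      ultimately show False by simp
    qed
  qed
  then show ?thesis using that B(4) by blast
qed

subsection \<open>Powers of regular parameters\<close>

context cring
begin

definition box :: "'a set \<Rightarrow> ('a \<Rightarrow> nat) \<Rightarrow> 'a set" where
  "box S a = Idl ((\<lambda>x. x [^] a x) ` S)"

lemma box_ideal: "S \<subseteq> carrier R \<Longrightarrow> ideal (box S a) R"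
  unfolding box_def by (rule genideal_ideal) auto

lemma pow_mem_box: "S \<subseteq> carrier R \<Longrightarrow> x \<in> S \<Longrightarrow> x [^] a x \<in> box S a"
  unfolding box_def by (rule subsetD[OF genideal_self]) auto

lemma pow_mem_box_le: "S \<subseteq> carrier R \<Longrightarrow> x \<in> S \<Longrightarrow> a x \<le> k \<Longrightarrow> x [^] k \<in> box S a"
  using pow_mem_ideal[OF box_ideal[of S a], of x "a x" k] pow_mem_box[of S x a] by auto

lemma box_subset: "ideal J R \<Longrightarrow> (\<And>x. x \<in> S \<Longrightarrow> x [^] a x \<in> J) \<Longrightarrow> box S a \<subseteq> J"
  unfolding box_def by (rule genideal_minimal) auto

lemma box_insert:
  "y \<in> carrier R \<Longrightarrow> S \<subseteq> carrier R \<Longrightarrow> box (insert y S) a = box S a <+> PIdl (y [^] a y)"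
  unfolding box_def by (subst image_insert, rule Idl_insert) auto

lemma box_cong: "(\<And>x. x \<in> S \<Longrightarrow> a x = b x) \<Longrightarrow> box S a = box S b"
  unfolding box_def by (metis (no_types, lifting) image_cong)

lemma box_mono: "S \<subseteq> T \<Longrightarrow> T \<subseteq> carrier R \<Longrightarrow> box S a \<subseteq> box T a"
  unfolding box_def by (intro subset_Idl_subset) auto

lemma box_antimono:
  assumes S: "S \<subseteq> carrier R" and ab: "\<And>x. x \<in> S \<Longrightarrow> b x \<le> a x"
  shows "box S a \<subseteq> box S b"
proof (rule box_subset[OF box_ideal[OF S]])
  fix x assume x: "x \<in> S"
  show "x [^] a x \<in> box S b"
    by (rule pow_mem_box_le[of S x b, OF S x ab[OF x]])
qed

lemma Idl_pow_subset_box: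
  assumes "finite S" "S \<subseteq> carrier R" "(\<Sum>x\<in>S. a x - 1) + 1 \<le> n"
  shows "ideal_pow R (Idl S) n \<subseteq> box S a"
proof -
  have "ideal_pow R (Idl S) ((\<Sum>x\<in>S. a x - 1) + 1) \<subseteq> box S a"
    using assms by (intro Idl_pow_subset_if_gens box_ideal pow_mem_box) auto
  then show ?thesis using ideal_pow_antimono[OF genideal_ideal[OF assms(2)] assms(3)] by blast
qed

text \<open>Replacing one exponent \<open>a y \<ge> 2\<close> by \<open>1\<close>, by \<open>a y - 1\<close>, or removing \<open>y\<close> lowers the sum of the
  exponents; once all exponents are at most \<open>1\<close> the ideal is prime or trivial.\<close>

lemma nonzerodivisor_mod_box:
  assumes pp: "partial_primes X0"
  shows "S \<subseteq> X0 \<Longrightarrow> x \<in> X0 - S \<Longrightarrow> r \<in> carrier R \<Longrightarrow> x \<otimes> r \<in> box S a \<Longrightarrow> r \<in> box S a"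
proof (induction "sum a S" arbitrary: S x r a rule: less_induct)
  case less
  have X0: "finite X0" "X0 \<subseteq> carrier R" using pp by (auto simp: partial_primes_def)
  have S: "S \<subseteq> carrier R" "finite S" using less.prems X0 finite_subset by auto
  have x: "x \<in> carrier R" using less.prems X0 by auto
  have r: "r \<in> carrier R" by (rule less.prems(3))
  note iS = box_ideal[OF S(1), of a]
  show ?case
  proof (cases "\<exists>y\<in>S. a y \<ge> 2")
    case False
    show ?thesis
    proof (cases "\<exists>y\<in>S. a y = 0")
      case True
      then obtain y where y: "y \<in> S" "a y = 0" by auto
      then have "\<one> \<in> box S a" using pow_mem_box[OF S(1) y(1), of a] by simp
      then have "box S a = carrier R" by (rule ideal.one_imp_carrier[OF iS])
      then show ?thesis using r by simp
    next
      case no0: False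
      have "a y = 1" if "y \<in> S" for y
        using that False no0 by (metis One_nat_def Suc_1 less_Suc_eq_le linorder_not_le le_antisym not_less_eq_eq zero_less_iff_neq_zero Suc_leI)
      then have "box S a = Idl ((\<lambda>x. x) ` S)"
        unfolding box_def using S(1) by (intro arg_cong[where f = "genideal R"] image_cong) auto
      then have eq: "box S a = Idl S" by simp
      have "primeideal (Idl S) R" "x \<notin> Idl S" using pp less.prems by (auto simp: partial_primes_def)
      then show ?thesis using less.prems(4) x r unfolding eq by (auto dest: primeideal.I_prime)
    qed
  next
    case True
    then obtain y where y: "y \<in> S" "a y \<ge> 2" by auto
    define S' where "S' = S - {y}"
    have yc: "y \<in> carrier R" and S': "S' \<subseteq> carrier R" "S' \<subseteq> X0" and yS': "y \<in> X0 - S'" "y \<notin> S'" and xS': "x \<in> X0 - S'"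
      using y S less.prems unfolding S'_def by auto
    have SS: "S = insert y S'" using y S'_def by auto
    have fS': "finite S'" using S S'_def by auto
    have sumS: "sum a S = a y + sum a S'" unfolding SS using yS'(2) fS' by simp
    define n where "n = a y - 1"
    have n: "a y = Suc n" "n \<ge> 1" using y(2) n_def by auto
    have upd: "box S (a(y := k)) = box S' a <+> PIdl (y [^] k)" for k
    proof -
      have "box S (a(y := k)) = box S' (a(y := k)) <+> PIdl (y [^] k)"
        unfolding SS using box_insert[OF yc S'(1), of "a(y := k)"] by simp
      moreover have "box S' (a(y := k)) = box S' a" using yS'(2) by (intro box_cong) auto
      ultimately show ?thesis by simp
    qed
    have sumupd: "sum (a(y := k)) S = k + sum a S'" for k
    proof -
      have "sum (a(y := k)) S' = sum a S'" using yS'(2) by (intro sum.cong) auto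
      then show ?thesis unfolding SS using yS'(2) fS' by simp
    qed
    note iS' = box_ideal[OF S'(1), of a]
    have IH1: "\<And>k r. k < a y \<Longrightarrow> r \<in> carrier R \<Longrightarrow> x \<otimes> r \<in> box S (a(y := k)) \<Longrightarrow> r \<in> box S (a(y := k))"
      using less.hyps[OF _ less.prems(1,2)] sumupd sumS by (metis add_less_cancel_right)
    have IH2: "r \<in> box S' a" if "r \<in> carrier R" "y \<otimes> r \<in> box S' a" for r
      using less.hyps[of a S', OF _ S'(2) yS'(1) that] sumS y(2) by simp
    have memS: "z \<in> box S' a <+> PIdl (y [^] k) \<longleftrightarrow> (\<exists>t\<in>carrier R. ideal_cong (box S' a) z (t \<otimes> y [^] k))" for z and k :: nat
      by (rule add_PIdl_cong_iff[OF iS']) (use yc in simp)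
    have eqS: "box S a = box S' a <+> PIdl (y [^] a y)" using upd[of "a y"] by simp
    obtain t where t: "t \<in> carrier R" "ideal_cong (box S' a) (x \<otimes> r) (t \<otimes> y [^] a y)"
      using less.prems(4) unfolding eqS memS by auto
    \<comment> \<open>Lowering the exponent of y to 1 shows r = r' y modulo the other powers. Then y
      itself is cancelled from x r' y = t y^(a y), and the case of exponent \<open>a y - 1\<close>
      applies to r'.\<close>
    have "box S a \<subseteq> box S (a(y := 1))" by (rule box_antimono[OF S(1)]) (use y in auto)
    then have "x \<otimes> r \<in> box S (a(y := 1))" using less.prems(4) by blast
    then have "r \<in> box S (a(y := 1))" using y(2) by (rule_tac IH1[OF _ r]) simp_all
    then obtain r' where r': "r' \<in> carrier R" "ideal_cong (box S' a) r (r' \<otimes> y)"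
      unfolding upd memS using yc by auto
    have yn: "y [^] n \<in> carrier R" "y [^] n \<otimes> y = y [^] a y" using yc n by auto
    have "ideal_cong (box S' a) (x \<otimes> r) (x \<otimes> (r' \<otimes> y))"
      by (intro ideal_cong_mult[OF iS'] ideal_cong_refl iS' x r')
    then have "ideal_cong (box S' a) (x \<otimes> (r' \<otimes> y)) (t \<otimes> y [^] a y)"
      using t(2) ideal_cong_sym[OF iS'] ideal_cong_trans[OF iS'] by blast
    then have "x \<otimes> (r' \<otimes> y) \<ominus> t \<otimes> (y [^] n \<otimes> y) \<in> box S' a" using yn by (simp add: ideal_cong_def)
    moreover have eq: "x \<otimes> (r' \<otimes> y) \<ominus> t \<otimes> (w \<otimes> y) = y \<otimes> (x \<otimes> r' \<ominus> t \<otimes> w)" if [simp]: "w \<in> carrier R" for w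
    proof -
      have [simp]: "x \<in> carrier R" "y \<in> carrier R" "r' \<in> carrier R" "t \<in> carrier R" using x yc r' t by auto
      show ?thesis by (simp add: r_minus_distr m_ac)
    qed
    ultimately have "y \<otimes> (x \<otimes> r' \<ominus> t \<otimes> y [^] n) \<in> box S' a" using eq[OF yn(1)] by simp
    then have "x \<otimes> r' \<ominus> t \<otimes> y [^] n \<in> box S' a" using x yc r' t by (rule_tac IH2) auto
    then have "ideal_cong (box S' a) (x \<otimes> r') (t \<otimes> y [^] n)"
      using x yc r' t by (simp add: ideal_cong_def)
    then have "x \<otimes> r' \<in> box S (a(y := n))" unfolding upd memS using t by auto
    then have "r' \<in> box S (a(y := n))" using n by (rule_tac IH1[OF _ r'(1)]) auto
    then obtain t' where t': "t' \<in> carrier R" "ideal_cong (box S' a) r' (t' \<otimes> y [^] n)"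
      unfolding upd memS by auto
    have "ideal_cong (box S' a) (r' \<otimes> y) ((t' \<otimes> y [^] n) \<otimes> y)"
      by (intro ideal_cong_mult[OF iS'] ideal_cong_refl iS' yc t')
    moreover have "(t' \<otimes> y [^] n) \<otimes> y = t' \<otimes> y [^] a y" using t' yc yn by (simp add: m_assoc)
    ultimately have "ideal_cong (box S' a) r (t' \<otimes> y [^] a y)"
      using ideal_cong_trans[OF iS' r'(2)] by simp
    then show ?thesis unfolding eqS memS using t' by auto
  qed
qed

lemma nonzerodivisor_pow_mod_box:
  assumes pp: "partial_primes X0" and S: "S \<subseteq> X0" and x: "x \<in> X0 - S"
    and r: "r \<in> carrier R" and mem: "x [^] (k::nat) \<otimes> r \<in> box S a"
  shows "r \<in> box S a"
  using mem
proof (induction k)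
  case 0
  then show ?case using r by simp
next
  case (Suc k)
  have xc: "x \<in> carrier R" using pp x by (auto simp: partial_primes_def)
  have "x [^] Suc k \<otimes> r = x \<otimes> (x [^] k \<otimes> r)" using xc r by (simp add: m_ac)
  then have "x [^] k \<otimes> r \<in> box S a"
    using Suc.prems xc r nonzerodivisor_mod_box[OF pp S x, of "x [^] k \<otimes> r" a] by auto
  then show ?case by (rule Suc.IH)
qed

definition mon :: "('a \<Rightarrow> nat) \<Rightarrow> 'a set \<Rightarrow> 'a" where
  "mon \<beta> S = (\<Otimes>x\<in>S. x [^] \<beta> x)"

lemma mon_closed: "S \<subseteq> carrier R \<Longrightarrow> mon \<beta> S \<in> carrier R"
  unfolding mon_def by (rule finprod_closed) auto

lemma mon_insert:
  "finite S \<Longrightarrow> x \<notin> S \<Longrightarrow> x \<in> carrier R \<Longrightarrow> S \<subseteq> carrier R \<Longrightarrow> mon \<beta> (insert x S) = x [^] \<beta> x \<otimes> mon \<beta> S"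
  unfolding mon_def by (subst finprod_insert) auto

lemma mon_pow:
  "finite S \<Longrightarrow> S \<subseteq> carrier R \<Longrightarrow> mon \<beta> S [^] (k::nat) = mon (\<lambda>x. \<beta> x * k) S"
proof (induction S rule: finite_induct)
  case empty
  then show ?case by (simp add: mon_def)
next
  case (insert x S)
  then show ?case by (simp add: mon_insert nat_pow_distrib nat_pow_pow mon_closed)
qed

lemma mon_mult_param:
  assumes "finite S" "S \<subseteq> carrier R" "x \<in> S"
  shows "mon \<beta> S \<otimes> x = mon (\<beta>(x := Suc (\<beta> x))) S"
proof -
  have S: "S = insert x (S - {x})" "finite (S - {x})" "x \<notin> S - {x}" "x \<in> carrier R" "S - {x} \<subseteq> carrier R"
    using assms by auto
  have "mon (\<beta>(x := Suc (\<beta> x))) (S - {x}) = mon \<beta> (S - {x})"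
    unfolding mon_def using S by (intro finprod_cong') (auto simp: Pi_iff)
  then have "mon (\<beta>(x := Suc (\<beta> x))) S = (x [^] \<beta> x \<otimes> x) \<otimes> mon \<beta> (S - {x})"
    using mon_insert[OF S(2-5), of "\<beta>(x := Suc (\<beta> x))"] S(1) by simp
  moreover have "mon \<beta> S = x [^] \<beta> x \<otimes> mon \<beta> (S - {x})"
    using mon_insert[OF S(2-5), of \<beta>] S(1) by simp
  ultimately show ?thesis using S mon_closed[OF S(5)] by (simp add: m_ac)
qed

lemma Idl_pow_subset_monomials:
  assumes "finite S" "S \<subseteq> carrier R"
  shows "ideal_pow R (Idl S) d \<subseteq> Idl {mon \<beta> S | \<beta>. sum \<beta> S = d}"
proof (induction d)
  case 0
  have "\<one> \<in> {mon \<beta> S | \<beta>. sum \<beta> S = 0}"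
    using assms by (auto intro!: exI[of _ "\<lambda>_. 0"] simp: mon_def finprod_one_eqI)
  moreover have sub: "{mon \<beta> S | \<beta>. sum \<beta> S = 0} \<subseteq> carrier R" using mon_closed assms by auto
  ultimately have "\<one> \<in> Idl {mon \<beta> S | \<beta>. sum \<beta> S = 0}" using genideal_self[OF sub] by blast
  then have "Idl {mon \<beta> S | \<beta>. sum \<beta> S = 0} = carrier R"
    by (rule ideal.one_imp_carrier[OF genideal_ideal[OF sub]])
  then show ?case by simp
next
  case (Suc d)
  let ?M = "\<lambda>d. {mon \<beta> S | \<beta>. sum \<beta> S = d}"
  have sub: "?M d \<subseteq> carrier R" for d using mon_closed assms by auto
  note iM = genideal_ideal[OF sub] and iS = genideal_ideal[OF assms(2)]
  have "(Idl S) \<cdot> (Idl (?M d)) \<subseteq> Idl (?M (Suc d))"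
  proof (rule Idl_prod_subset[OF assms(2) iM iM])
    fix x j assume x: "x \<in> S" and j: "j \<in> Idl (?M d)"
    have xc: "x \<in> carrier R" using x assms by auto
    have "(Idl (?M d)) \<cdot> (PIdl x) \<subseteq> Idl (?M (Suc d))"
    proof (rule Idl_prod_subset[OF sub cgenideal_ideal[OF xc] iM])
      fix i y assume "i \<in> ?M d" "y \<in> PIdl x"
      then obtain \<beta> r where b: "i = mon \<beta> S" "sum \<beta> S = d" and r: "r \<in> carrier R" "y = r \<otimes> x"
        by (auto simp: PIdl_iff)
      have "sum (\<beta>(x := Suc (\<beta> x))) S = Suc d"
        using b x assms(1) by (simp add: sum.remove[of S x])
      then have "mon \<beta> S \<otimes> x \<in> Idl (?M (Suc d))"
        using genideal_self[OF sub] mon_mult_param[OF assms x] by blast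
      then have "r \<otimes> (mon \<beta> S \<otimes> x) \<in> Idl (?M (Suc d))" using ideal.I_l_closed[OF iM] r by auto
      moreover have "r \<otimes> (mon \<beta> S \<otimes> x) = i \<otimes> y" using r b xc mon_closed[OF assms(2)] by (simp add: m_ac)
      ultimately show "i \<otimes> y \<in> Idl (?M (Suc d))" by simp
    qed
    then have "j \<otimes> x \<in> Idl (?M (Suc d))"
      using j cgenideal_self[OF xc] ideal_prod.prod by (metis (no_types, lifting) subsetD)
    then show "x \<otimes> j \<in> Idl (?M (Suc d))" using xc ideal.Icarr[OF iM j] by (simp add: m_comm)
  qed
  moreover have "(Idl S) \<cdot> ideal_pow R (Idl S) d \<subseteq> (Idl S) \<cdot> (Idl (?M d))"
    using Suc by (intro ideal_prod_mono) auto
  moreover have "ideal_pow R (Idl S) (Suc d) = (Idl S) \<cdot> ideal_pow R (Idl S) d"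
    unfolding ideal_pow_Suc by (rule ideal_prod_commute[OF ideal_pow_ideal[OF iS] iS])
  ultimately show ?case by simp
qed

end

section \<open>Monomials in a regular system of parameters\<close>

locale regular_parameter_ring = noetherian_local_ring R \<mm> for R (structure) and \<mm> +
  fixes X0 :: "'a set"
  assumes partial_primes: "partial_primes X0" and max_eq: "\<mm> = Idl X0"
begin

lemma finite_params: "finite X0" and params_carrier: "X0 \<subseteq> carrier R"
  using partial_primes by (auto simp: partial_primes_def)

lemma params_subset_max: "X0 \<subseteq> \<mm>"
  unfolding max_eq by (rule genideal_self[OF params_carrier])

text \<open>The start is that 1 is not in the maximal ideal, the box with all exponents 1. The
  exponents are then raised one parameter at a time: a power of x can be cancelled modulo the powers
  of the other parameters.\<close>

lemma monomial_notin_box: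
  "mon \<beta> X0 \<notin> box X0 (\<lambda>x. Suc (\<beta> x))"
proof -
  have "mon \<beta> S \<notin> box X0 (\<lambda>x. if x \<in> S then Suc (\<beta> x) else 1)" if "finite S" "S \<subseteq> X0" for S
    using that
  proof (induction S rule: finite_induct)
    case empty
    have "box X0 (\<lambda>x. 1) = \<mm>"
    proof -
      have "(\<lambda>x. x [^] (1::nat)) ` X0 = (\<lambda>x. x) ` X0" using params_carrier by (intro image_cong) auto
      then show ?thesis by (simp add: box_def max_eq)
    qed
    then show ?case using one_notin_max by (simp add: mon_def)
  next
    case (insert x S)
    have x: "x \<in> X0" "x \<in> carrier R" and S: "S \<subseteq> X0" "S \<subseteq> carrier R" using insert params_carrier by auto
    define a where "a = (\<lambda>z. if z \<in> S then Suc (\<beta> z) else 1)"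
    define X1 where "X1 = X0 - {x}"
    have X1: "X0 = insert x X1" "x \<notin> X1" "X1 \<subseteq> X0" "X1 \<subseteq> carrier R" using x params_carrier X1_def by auto
    note i1 = box_ideal[OF X1(4), of a]
    have b1: "box X0 (\<lambda>z. if z \<in> insert x S then Suc (\<beta> z) else 1) = box X1 a <+> PIdl (x [^] Suc (\<beta> x))"
    proof -
      have "box X1 (\<lambda>z. if z \<in> insert x S then Suc (\<beta> z) else 1) = box X1 a"
        unfolding a_def using X1(2) by (intro box_cong) auto
      then show ?thesis using box_insert[OF x(2) X1(4), of "\<lambda>z. if z \<in> insert x S then Suc (\<beta> z) else 1"] X1(1) by simp
    qed
    have b2: "box X0 a = box X1 a <+> PIdl x"
    proof -
      have "a x = 1" using insert.hyps a_def by simp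
      then show ?thesis using box_insert[OF x(2) X1(4), of a] X1(1) x by simp
    qed
    have IH: "mon \<beta> S \<notin> box X0 a" using insert S a_def by simp
    have mS: "mon \<beta> S \<in> carrier R" by (rule mon_closed[OF S(2)])
    show ?case
    proof
      assume "mon \<beta> (insert x S) \<in> box X0 (\<lambda>z. if z \<in> insert x S then Suc (\<beta> z) else 1)"
      then have "x [^] \<beta> x \<otimes> mon \<beta> S \<in> box X1 a <+> PIdl (x [^] Suc (\<beta> x))"
        using b1 mon_insert[OF insert.hyps(1,2) x(2) S(2)] by simp
      then obtain t where t: "t \<in> carrier R" "x [^] \<beta> x \<otimes> mon \<beta> S \<ominus> t \<otimes> x [^] Suc (\<beta> x) \<in> box X1 a"
        using add_PIdl_iff[OF i1, of "x [^] Suc (\<beta> x)"] x by auto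
      have "w \<otimes> mon \<beta> S \<ominus> t \<otimes> (w \<otimes> x) = w \<otimes> (mon \<beta> S \<ominus> t \<otimes> x)" if [simp]: "w \<in> carrier R" for w
      proof -
        define v where "v = mon \<beta> S"
        have [simp]: "v \<in> carrier R" "x \<in> carrier R" "t \<in> carrier R" using mS x t v_def by auto
        have "w \<otimes> v \<ominus> t \<otimes> (w \<otimes> x) = w \<otimes> (v \<ominus> t \<otimes> x)" by (simp add: r_minus_distr m_ac)
        then show ?thesis unfolding v_def .
      qed
      from this[of "x [^] \<beta> x"] have "x [^] \<beta> x \<otimes> (mon \<beta> S \<ominus> t \<otimes> x) \<in> box X1 a" using t x by simp
      then have "mon \<beta> S \<ominus> t \<otimes> x \<in> box X1 a"
        using x X1 mS t nonzerodivisor_pow_mod_box[OF partial_primes X1(3), of x "mon \<beta> S \<ominus> t \<otimes> x"] by auto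
      then have "mon \<beta> S \<in> box X1 a <+> PIdl x" using add_PIdl_iff[OF i1 x(2)] mS t by auto
      then show False using IH b2 by simp
    qed
  qed
  from this[OF finite_params subset_refl]
  have "mon \<beta> X0 \<notin> box X0 (\<lambda>x. if x \<in> X0 then Suc (\<beta> x) else 1)" .
  also have "box X0 (\<lambda>x. if x \<in> X0 then Suc (\<beta> x) else 1) = box X0 (\<lambda>x. Suc (\<beta> x))"
    by (rule box_cong) simp
  finally show ?thesis .
qed

lemma monomial_mem_box:
  assumes "x \<in> X0" "a x \<le> \<beta> x"
  shows "mon \<beta> X0 \<in> box X0 a"
proof -
  have *: "X0 = insert x (X0 - {x})" using assms by auto
  have x: "x \<in> carrier R" using assms params_carrier by auto
  have "mon \<beta> X0 = x [^] \<beta> x \<otimes> mon \<beta> (X0 - {x})"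
    using mon_insert[of "X0 - {x}" x \<beta>] * finite_params params_carrier x by auto
  moreover have "x [^] \<beta> x \<in> box X0 a"
    by (rule pow_mem_box_le[of X0 x a, OF params_carrier assms])
  moreover have "mon \<beta> (X0 - {x}) \<in> carrier R" using params_carrier by (intro mon_closed) auto
  ultimately show ?thesis using ideal.I_r_closed[OF box_ideal[OF params_carrier]] by metis
qed

lemma max_pow_subset_box:
  assumes "(\<Sum>x\<in>X0. a x - 1) < n"
  shows "ideal_pow R \<mm> n \<subseteq> box X0 a"
  unfolding max_eq using assms by (intro Idl_pow_subset_box finite_params params_carrier) simp

end

subsection \<open>Frobenius powers\<close>

context cring
begin

lemma frobenius_pow_ideal: "ideal I R \<Longrightarrow> ideal (frobenius_pow R I k) R"
  unfolding frobenius_pow_def by (rule genideal_ideal) (auto simp: ideal.Icarr)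

lemma pow_mem_frobenius_pow: "ideal I R \<Longrightarrow> z \<in> I \<Longrightarrow> z [^] k \<in> frobenius_pow R I k"
  unfolding frobenius_pow_def by (rule subsetD[OF genideal_self]) (auto simp: ideal.Icarr)

lemma frobenius_pow_subset:
  "ideal J R \<Longrightarrow> (\<And>z. z \<in> I \<Longrightarrow> z [^] k \<in> J) \<Longrightarrow> frobenius_pow R I k \<subseteq> J"
  unfolding frobenius_pow_def by (rule genideal_minimal) auto

lemma frobenius_pow_mono: "ideal J R \<Longrightarrow> I \<subseteq> J \<Longrightarrow> frobenius_pow R I k \<subseteq> frobenius_pow R J k"
  by (intro frobenius_pow_subset frobenius_pow_ideal pow_mem_frobenius_pow) auto

lemma frobenius_pow_1: "ideal I R \<Longrightarrow> frobenius_pow R I 1 = I"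
proof -
  assume I: "ideal I R"
  have "(\<lambda>z. z [^] (1::nat)) ` I = (\<lambda>z. z) ` I" using ideal.Icarr[OF I] by (intro image_cong) auto
  then have "frobenius_pow R I 1 = Idl I" by (simp add: frobenius_pow_def)
  also have "\<dots> = I" using genideal_minimal[OF I, of I] genideal_self[OF ideal_subset_carrier[OF I]] by auto
  finally show ?thesis .
qed

lemma frobenius_pow_subset_ideal_pow: "ideal I R \<Longrightarrow> frobenius_pow R I k \<subseteq> ideal_pow R I k"
  by (intro frobenius_pow_subset ideal_pow_ideal pow_mem_ideal_pow)

lemma frobenius_pow_prod_subset:
  assumes I: "ideal I R" and J: "ideal J R"
  shows "frobenius_pow R I k \<cdot> frobenius_pow R J k \<subseteq> frobenius_pow R (I \<cdot> J) k"
proof -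
  note IJ = ideal_prod_is_ideal[OF I J]
  note F = frobenius_pow_ideal[OF IJ, of k]
  have Ic: "(\<lambda>z. z [^] k) ` I \<subseteq> carrier R" and Jc: "(\<lambda>z. z [^] k) ` J \<subseteq> carrier R"
    using ideal.Icarr[OF I] ideal.Icarr[OF J] by auto
  have 1: "y [^] k \<otimes> x [^] k \<in> frobenius_pow R (I \<cdot> J) k" if x: "x \<in> I" and y: "y \<in> J" for x y
  proof -
    have "(x \<otimes> y) [^] k \<in> frobenius_pow R (I \<cdot> J) k"
      using x y by (intro pow_mem_frobenius_pow IJ ideal_prod.prod)
    then show ?thesis using ideal.Icarr[OF I x] ideal.Icarr[OF J y] by (simp add: nat_pow_distrib m_comm)
  qed
  have 2: "x [^] k \<otimes> j \<in> frobenius_pow R (I \<cdot> J) k" if x: "x \<in> I" and j: "j \<in> frobenius_pow R J k" for x j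
  proof -
    have xc: "x [^] k \<in> carrier R" using ideal.Icarr[OF I x] by simp
    have "frobenius_pow R J k \<cdot> (PIdl (x [^] k)) \<subseteq> frobenius_pow R (I \<cdot> J) k"
      unfolding frobenius_pow_def[of R J]
    proof (rule Idl_prod_subset[OF Jc cgenideal_ideal[OF xc] F])
      fix i y assume "i \<in> (\<lambda>z. z [^] k) ` J" "y \<in> PIdl (x [^] k)"
      then obtain j r where j: "j \<in> J" "i = j [^] k" and r: "r \<in> carrier R" "y = r \<otimes> x [^] k"
        by (auto simp: PIdl_iff)
      have "i \<otimes> y = r \<otimes> (j [^] k \<otimes> x [^] k)" using r j ideal.Icarr[OF J] xc by (simp add: m_ac)
      then show "i \<otimes> y \<in> frobenius_pow R (I \<cdot> J) k"
        using 1[OF x j(1)] ideal.I_l_closed[OF F _ r(1)] by metis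
    qed
    then have "j \<otimes> x [^] k \<in> frobenius_pow R (I \<cdot> J) k"
      using ideal_prod.prod[OF j cgenideal_self[OF xc], of R] by blast
    then show ?thesis using xc ideal.Icarr[OF frobenius_pow_ideal[OF J] j] by (simp add: m_comm)
  qed
  show ?thesis unfolding frobenius_pow_def[of R I]
    by (rule Idl_prod_subset[OF Ic frobenius_pow_ideal[OF J] F]) (use 2 in auto)
qed

lemma frobenius_pow_carrier: "frobenius_pow R (carrier R) k = carrier R"
  using pow_mem_frobenius_pow[OF oneideal, of \<one> k] ideal.one_imp_carrier[OF frobenius_pow_ideal[OF oneideal]]
  by simp

lemma ideal_pow_frobenius_pow_subset:
  assumes I: "ideal I R"
  shows "ideal_pow R (frobenius_pow R I k) n \<subseteq> frobenius_pow R (ideal_pow R I n) k"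
proof (induction n)
  case 0
  then show ?case by (simp add: frobenius_pow_carrier)
next
  case (Suc n)
  have "ideal_pow R (frobenius_pow R I k) n \<cdot> frobenius_pow R I k
      \<subseteq> frobenius_pow R (ideal_pow R I n) k \<cdot> frobenius_pow R I k"
    by (intro ideal_prod_mono Suc) simp
  also have "\<dots> \<subseteq> frobenius_pow R (ideal_pow R I n \<cdot> I) k"
    by (rule frobenius_pow_prod_subset[OF ideal_pow_ideal[OF I] I])
  finally show ?case by simp
qed

lemma pow_mem_frobenius_ideal_pow:
  "ideal I R \<Longrightarrow> z \<in> frobenius_pow R I k \<Longrightarrow> z [^] n \<in> frobenius_pow R (ideal_pow R I n) k"
  using ideal_pow_frobenius_pow_subset pow_mem_ideal_pow by blast

end

text \<open>Additivity of the p-th power map is supplied by \<open>F_finite\<close>, which includes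
  that the map is a ring homomorphism.\<close>

locale frobenius_parameter_ring = regular_parameter_ring +
  fixes p :: nat
  assumes p_gt_1: "p > 1" and F_fin: "F_finite p R"
begin

lemma frob_p_hom: "(\<lambda>z. z [^] p) \<in> ring_hom R R"
  using F_fin by (simp add: F_finite_def finite_ring_hom_def)

lemma frob_add:
  "x \<in> carrier R \<Longrightarrow> y \<in> carrier R \<Longrightarrow> (x \<oplus> y) [^] (p ^ k) = x [^] (p ^ k) \<oplus> y [^] (p ^ k)"
proof (induction k)
  case (Suc k)
  have "z [^] (p ^ Suc k) = (z [^] (p ^ k)) [^] p" if "z \<in> carrier R" for z
    using that by (simp add: nat_pow_pow mult.commute)
  then show ?case using Suc ring_hom_add[OF frob_p_hom, of "x [^] (p ^ k)" "y [^] (p ^ k)"] by simp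
qed simp

lemma pk_pos: "0 < p ^ k"
  using p_gt_1 by simp

lemma zero_pow_pk: "\<zero> [^] (p ^ k) = \<zero>"
  using pk_pos[of k] by (simp add: nat_pow_zero)

lemma frob_uminus: "x \<in> carrier R \<Longrightarrow> (\<ominus> x) [^] (p ^ k) = \<ominus> (x [^] (p ^ k))"
proof -
  assume x: "x \<in> carrier R"
  have "(\<ominus> x) [^] (p ^ k) \<oplus> x [^] (p ^ k) = (\<ominus> x \<oplus> x) [^] (p ^ k)" using frob_add x by simp
  also have "\<dots> = \<zero>" using x zero_pow_pk by (simp add: l_neg)
  finally show ?thesis using x by (simp add: minus_equality)
qed

lemma frob_minus:
  "x \<in> carrier R \<Longrightarrow> y \<in> carrier R \<Longrightarrow> (x \<ominus> y) [^] (p ^ k) = x [^] (p ^ k) \<ominus> y [^] (p ^ k)"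
  by (simp add: a_minus_def frob_add frob_uminus)

text \<open>Additivity of Frobenius makes the elements whose p^k-th power lies in the right-hand
  side an ideal; it contains A and hence all of \<open>Idl A\<close>.\<close>

lemma frob_Idl:
  assumes A: "A \<subseteq> carrier R"
  shows "frobenius_pow R (Idl A) (p ^ k) = Idl ((\<lambda>x. x [^] (p ^ k)) ` A)"
proof
  have sub: "(\<lambda>x. x [^] (p ^ k)) ` A \<subseteq> carrier R" using A by auto
  note iA = genideal_ideal[OF A] and iAq = genideal_ideal[OF sub]
  show "Idl ((\<lambda>x. x [^] (p ^ k)) ` A) \<subseteq> frobenius_pow R (Idl A) (p ^ k)"
    using genideal_self[OF A] by (intro genideal_minimal frobenius_pow_ideal iA) (auto intro: pow_mem_frobenius_pow[OF iA])
  define J where "J = {z \<in> carrier R. z [^] (p ^ k) \<in> Idl ((\<lambda>x. x [^] (p ^ k)) ` A)}"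
  have "ideal J R"
  proof (rule ideal_if_closed)
    show "\<zero> \<in> J" using ideal_zero_mem[OF iAq] zero_pow_pk by (simp add: J_def)
    show "a \<oplus> b \<in> J" if "a \<in> J" "b \<in> J" for a b
      using that by (auto simp: J_def frob_add intro: ideal_add_closed[OF iAq])
    show "r \<otimes> a \<in> J" if "a \<in> J" "r \<in> carrier R" for a r
      using that by (auto simp: J_def nat_pow_distrib intro: ideal.I_l_closed[OF iAq])
  qed (auto simp: J_def)
  moreover have "A \<subseteq> J" using A genideal_self[OF sub] by (auto simp: J_def)
  ultimately have "Idl A \<subseteq> J" by (rule genideal_minimal)
  then show "frobenius_pow R (Idl A) (p ^ k) \<subseteq> Idl ((\<lambda>x. x [^] (p ^ k)) ` A)"
    by (intro frobenius_pow_subset iAq) (auto simp: J_def)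
qed

lemma frob_frob:
  assumes I: "ideal I R"
  shows "frobenius_pow R (frobenius_pow R I (p ^ k)) (p ^ l) = frobenius_pow R I (p ^ (k + l))"
proof -
  have sub: "(\<lambda>z. z [^] (p ^ k)) ` I \<subseteq> carrier R" using ideal.Icarr[OF I] by auto
  have "(\<lambda>z. z [^] (p ^ l)) ` ((\<lambda>z. z [^] (p ^ k)) ` I) = (\<lambda>z. z [^] (p ^ (k + l))) ` I"
    unfolding image_image using ideal.Icarr[OF I] by (intro image_cong) (auto simp: nat_pow_pow power_add)
  then show ?thesis using frob_Idl[OF sub, of l] by (simp add: frobenius_pow_def)
qed

lemma frob_box:
  assumes "S \<subseteq> carrier R"
  shows "frobenius_pow R (box S a) (p ^ k) = box S (\<lambda>x. a x * p ^ k)"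
proof -
  have "(\<lambda>x. x [^] (p ^ k)) ` ((\<lambda>x. x [^] a x) ` S) = (\<lambda>x. x [^] (a x * p ^ k)) ` S"
    unfolding image_image using assms by (intro image_cong) (auto simp: nat_pow_pow)
  then show ?thesis unfolding box_def using frob_Idl[of "(\<lambda>x. x [^] a x) ` S" k] assms by auto
qed

lemma Idl_eq_box: "S \<subseteq> carrier R \<Longrightarrow> Idl S = box S (\<lambda>x. 1)"
proof -
  assume "S \<subseteq> carrier R"
  then have "(\<lambda>x. x [^] (1::nat)) ` S = (\<lambda>x. x) ` S" by (intro image_cong) auto
  then show ?thesis by (simp add: box_def)
qed

lemma frob_Idl_params: "S \<subseteq> X0 \<Longrightarrow> frobenius_pow R (Idl S) (p ^ k) = box S (\<lambda>x. p ^ k)"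
  using frob_box[of S "\<lambda>x. 1" k] Idl_eq_box[of S] params_carrier by auto

lemma frob_max: "frobenius_pow R \<mm> (p ^ k) = box X0 (\<lambda>x. p ^ k)"
  unfolding max_eq by (rule frob_Idl_params) simp

subsection \<open>Orders of powers\<close>

text \<open>A substitute for reducedness of the associated graded ring. Since z has order exactly d,
  some monomial of degree d occurs with a unit coefficient. All other monomials of degree d, and
  everything of higher order, lie in the box just above its exponent vector, so taking p-th powers
  isolates the p-th power of this monomial, contrary to \<open>monomial_notin_box\<close>.\<close>

lemma pow_p_notin_max_pow:
  assumes z: "z \<in> ideal_pow R \<mm> d" "z \<notin> ideal_pow R \<mm> (Suc d)"
  shows "z [^] p \<notin> ideal_pow R \<mm> (Suc (d * p))"
proof
  assume zp: "z [^] p \<in> ideal_pow R \<mm> (Suc (d * p))"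
  note im = ideal_pow_ideal[OF max_ideal]
  \<comment> \<open>Exponents are taken in an extensional function space, so that there are finitely
    many and different monomials come from functions that differ on \<open>X0\<close>.\<close>
  define M where "M = (\<lambda>\<beta>. mon \<beta> X0) ` {\<beta> \<in> X0 \<rightarrow>\<^sub>E {..d}. sum \<beta> X0 = d}"
  have "{mon \<beta> X0 | \<beta>. sum \<beta> X0 = d} \<subseteq> M"
  proof
    fix m assume "m \<in> {mon \<beta> X0 | \<beta>. sum \<beta> X0 = d}"
    then obtain \<beta> where b: "m = mon \<beta> X0" "sum \<beta> X0 = d" by auto
    let ?b = "restrict \<beta> X0"
    have "mon ?b X0 = mon \<beta> X0" unfolding mon_def using params_carrier by (intro finprod_cong') auto
    moreover have "sum ?b X0 = d" using b by simp
    moreover have "\<beta> x \<le> d" if "x \<in> X0" for x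
      using member_le_sum[OF that _ finite_params, of \<beta>] b by simp
    ultimately show "m \<in> M" unfolding M_def using b by (auto intro!: image_eqI[of _ _ ?b])
  qed
  have "finite {\<beta> \<in> X0 \<rightarrow>\<^sub>E {..d}. sum \<beta> X0 = d}" using finite_params by (simp add: finite_PiE)
  then have fM: "finite M" unfolding M_def by simp
  have Mc: "M \<subseteq> carrier R" unfolding M_def using mon_closed[OF params_carrier] by auto
  have Mm: "m \<in> ideal_pow R \<mm> d" if mM: "m \<in> M" for m
  proof -
    obtain \<beta> where b: "m = mon \<beta> X0" "sum \<beta> X0 = d" using mM unfolding M_def by blast
    have "mon \<beta> S \<in> ideal_pow R \<mm> (sum \<beta> S)" if "finite S" "S \<subseteq> X0" for S
      using that
    proof (induction S rule: finite_induct)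
      case empty
      then show ?case by (simp add: mon_def)
    next
      case (insert x S)
      have "x [^] \<beta> x \<in> ideal_pow R \<mm> (\<beta> x)" using insert params_subset_max by (intro pow_mem_ideal_pow) auto
      moreover have "x \<in> carrier R" "S \<subseteq> carrier R" using insert params_carrier by auto
      ultimately show ?case
        using insert ideal_pow_mult_mem[OF max_ideal, of "x [^] \<beta> x" "\<beta> x" "mon \<beta> S" "sum \<beta> S"]
        by (simp add: mon_insert)
    qed
    from this[OF finite_params] show ?thesis using b by simp
  qed
  define D where "D = ideal_pow R \<mm> (Suc d)"
  have iD: "ideal D R" unfolding D_def by (rule im)
  \<comment> \<open>Monomials with coefficient in \<mm> are pushed into D one by one; a unit
    coefficient is contradictory. Ending with z in D contradicts the order of z.\<close>
  have "z \<in> D" if "finite T" "T \<subseteq> M" "z \<in> D <+> Idl T" for T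
    using that
  proof (induction T rule: finite_induct)
    case empty
    then show ?case using iD by (auto simp: Idl_empty set_add_iff ideal.Icarr)
  next
    case (insert m T)
    obtain \<beta> where b: "m = mon \<beta> X0" "sum \<beta> X0 = d" "\<beta> \<in> X0 \<rightarrow>\<^sub>E {..d}" using insert.prems M_def by auto
    have T: "T \<subseteq> carrier R" "T \<subseteq> M" and m: "m \<in> carrier R" using insert.prems Mc by auto
    note iT = genideal_ideal[OF T(1)]
    note iW = add_ideals[OF iD iT]
    have "z \<in> (D <+> PIdl m) <+> Idl T"
      using insert.prems(2) set_add_Idl_insert[OF iD m T(1)] by simp
    then obtain w c t where w: "w \<in> D" and c: "c \<in> carrier R" and t: "t \<in> Idl T"
      and zz: "z = (w \<oplus> c \<otimes> m) \<oplus> t" by (auto simp: set_add_iff PIdl_iff)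
    have wc: "w \<in> carrier R" and tc: "t \<in> carrier R" using ideal.Icarr[OF iD w] ideal.Icarr[OF iT t] by auto
    have zz2: "z = (w \<oplus> t) \<oplus> c \<otimes> m" unfolding zz using wc tc c m by (simp add: a_ac)
    show ?case
    proof (cases "c \<in> \<mm>")
      case True
      then have "m \<otimes> c \<in> D"
        unfolding D_def ideal_pow_Suc using Mm[of m] insert.prems by (intro ideal_prod.prod) auto
      then have "w \<oplus> c \<otimes> m \<in> D"
        using w c m by (simp add: m_comm ideal_add_closed[OF iD])
      then have "z \<in> D <+> Idl T" unfolding zz using t by (rule set_addI)
      then show ?thesis by (rule insert.IH[OF T(2)])
    next
      case False
      let ?B = "box X0 (\<lambda>x. Suc (\<beta> x))" and ?C = "box X0 (\<lambda>x. Suc (\<beta> x * p))"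
      note iB = box_ideal[OF params_carrier, of "\<lambda>x. Suc (\<beta> x)"] and iC = box_ideal[OF params_carrier, of "\<lambda>x. Suc (\<beta> x * p)"]
      have "D \<subseteq> ?B" unfolding D_def by (rule max_pow_subset_box) (use b in simp)
      moreover have "T \<subseteq> ?B"
      proof
        fix m' assume m': "m' \<in> T"
        then obtain \<gamma> where g: "m' = mon \<gamma> X0" "sum \<gamma> X0 = d" "\<gamma> \<in> X0 \<rightarrow>\<^sub>E {..d}" using T(2) M_def by auto
        have "\<gamma> \<noteq> \<beta>" using g b m' insert.hyps by auto
        have "\<exists>x\<in>X0. \<beta> x < \<gamma> x"
        proof (rule ccontr)
          assume "\<not> ?thesis"
          then have le: "\<gamma> x \<le> \<beta> x" if "x \<in> X0" for x using that by (meson not_le)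
          have "\<gamma> x = \<beta> x" if x: "x \<in> X0" for x
          proof (rule ccontr)
            assume "\<gamma> x \<noteq> \<beta> x"
            then have "sum \<gamma> X0 < sum \<beta> X0" using le x finite_params
              by (intro sum_strict_mono_ex1) (auto intro!: bexI[of _ x] simp: le_neq_implies_less)
            then show False using b g by simp
          qed
          then have "\<gamma> = \<beta>" using b(3) g(3) by (intro PiE_ext) auto
          then show False using \<open>\<gamma> \<noteq> \<beta>\<close> by simp
        qed
        then obtain x where "x \<in> X0" "\<beta> x < \<gamma> x" by auto
        then show "m' \<in> ?B" unfolding g(1) by (intro monomial_mem_box[of x]) auto
      qed
      then have "Idl T \<subseteq> ?B" by (rule genideal_minimal[OF iB])
      ultimately have wt: "w \<oplus> t \<in> ?B" using w t by (intro ideal_add_closed[OF iB]) auto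
      have "(w \<oplus> t) [^] (p ^ 1) \<in> frobenius_pow R ?B (p ^ 1)" by (rule pow_mem_frobenius_pow[OF iB wt])
      also have "frobenius_pow R ?B (p ^ 1) = box X0 (\<lambda>x. Suc (\<beta> x) * p ^ 1)" by (rule frob_box[OF params_carrier])
      also have "\<dots> \<subseteq> ?C" using p_gt_1 by (intro box_antimono[OF params_carrier]) auto
      finally have wtp: "(w \<oplus> t) [^] p \<in> ?C" by simp
      have "(\<Sum>x\<in>X0. Suc (\<beta> x * p) - 1) = d * p" using b(2) by (simp add: sum_distrib_right[symmetric])
      then have "ideal_pow R \<mm> (Suc (d * p)) \<subseteq> ?C" by (intro max_pow_subset_box) simp
      then have zC: "z [^] p \<in> ?C" using zp by blast
      have "c [^] p \<otimes> m [^] p = z [^] p \<ominus> (w \<oplus> t) [^] p"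
      proof -
        have "z [^] p = (w \<oplus> t) [^] p \<oplus> c [^] p \<otimes> m [^] p"
          unfolding zz2 using frob_add[of "w \<oplus> t" "c \<otimes> m" 1] wc tc c m by (simp add: nat_pow_distrib)
        then show ?thesis using wc tc c m by (simp add: add_minus_cancel)
      qed
      also have "\<dots> \<in> ?C" by (rule ideal_minus_closed[OF iC zC wtp])
      finally have "c [^] p \<otimes> m [^] p \<in> ?C" .
      moreover have "c [^] p \<notin> \<mm>" using False c primeideal_pow_mem[OF max_prime c] by blast
      ultimately have "m [^] p \<in> ?C" using c m mem_if_unit_mult_mem[OF iC, of "c [^] p" "m [^] p"] by simp
      moreover have "m [^] p = mon (\<lambda>x. \<beta> x * p) X0" unfolding b(1) by (rule mon_pow[OF finite_params params_carrier])
      ultimately show ?thesis using monomial_notin_box[of "\<lambda>x. \<beta> x * p"] by simp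
    qed
  qed
  moreover have "z \<in> Idl M"
    using z(1) Idl_pow_subset_monomials[OF finite_params params_carrier, of d] max_eq
      genideal_minimal[OF genideal_ideal[OF Mc]] genideal_self[OF Mc] \<open>{mon \<beta> X0 | \<beta>. sum \<beta> X0 = d} \<subseteq> M\<close> by blast
  then have "z \<in> D <+> Idl M"
    using subset_set_add(2)[OF iD genideal_ideal[OF Mc]] by blast
  ultimately have "z \<in> D" using fM by blast
  then show False using z(2) D_def by blast
qed

lemma pow_pk_notin_max_pow:
  assumes z: "z \<in> ideal_pow R \<mm> d" "z \<notin> ideal_pow R \<mm> (Suc d)"
  shows "z [^] (p ^ k) \<notin> ideal_pow R \<mm> (Suc (d * p ^ k))"
proof (induction k)
  case 0
  have "z \<in> carrier R" using ideal.Icarr[OF ideal_pow_ideal[OF max_ideal] z(1)] .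
  then show ?case using z by simp
next
  case (Suc k)
  have zc: "z \<in> carrier R" using ideal.Icarr[OF ideal_pow_ideal[OF max_ideal] z(1)] .
  have "z [^] (p ^ k) \<in> ideal_pow R \<mm> (d * p ^ k)" by (rule pow_mem_ideal_pow_mult[OF max_ideal z(1)])
  from pow_p_notin_max_pow[OF this Suc] show ?case using zc by (simp add: nat_pow_pow mult_ac)
qed

text \<open>Excess order in z^n would persist in z^(p^k): write p^k = n l + r with l at least 1, and
  the l factors z^n carry at least one excess degree.\<close>

lemma pow_notin_max_pow:
  assumes z: "z \<in> ideal_pow R \<mm> d" "z \<notin> ideal_pow R \<mm> (Suc d)"
  shows "z [^] (n::nat) \<notin> ideal_pow R \<mm> (Suc (d * n))"
proof
  assume zn: "z [^] n \<in> ideal_pow R \<mm> (Suc (d * n))"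
  have zc: "z \<in> carrier R" using ideal.Icarr[OF ideal_pow_ideal[OF max_ideal] z(1)] .
  show False
  proof (cases "n = 0")
    case True
    then have "\<one> \<in> ideal_pow R \<mm> 1" using zn by simp
    then show ?thesis using one_notin_max unfolding ideal_pow_1[OF max_ideal] by blast
  next
    case False
    define k where "k = n"
    have k: "n < p ^ k" unfolding k_def by (rule power_gt_expt) (use p_gt_1 in simp)
    define l r where "l = p ^ k div n" and "r = p ^ k mod n"
    have l: "l \<ge> 1" unfolding l_def using k False by (simp add: Suc_leI div_greater_zero_iff)
    have lr: "p ^ k = n * l + r" unfolding l_def r_def by simp
    have "(z [^] n) [^] l \<otimes> z [^] r \<in> ideal_pow R \<mm> (Suc (d * n) * l + d * r)"
      by (rule ideal_pow_mult_mem[OF max_ideal pow_mem_ideal_pow_mult[OF max_ideal zn] pow_mem_ideal_pow_mult[OF max_ideal z(1)]])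
    moreover have "(z [^] n) [^] l \<otimes> z [^] r = z [^] (p ^ k)"
      unfolding lr using zc by (simp add: nat_pow_pow nat_pow_mult)
    ultimately have mem: "z [^] (p ^ k) \<in> ideal_pow R \<mm> (Suc (d * n) * l + d * r)" by metis
    have "Suc (d * (n * l + r)) \<le> Suc (d * n) * l + d * r" using l by (simp add: distrib_left)
    then have "Suc (d * p ^ k) \<le> Suc (d * n) * l + d * r" using lr by metis
    from subsetD[OF ideal_pow_antimono[OF max_ideal this] mem]
    have "z [^] (p ^ k) \<in> ideal_pow R \<mm> (Suc (d * p ^ k))" .
    then show ?thesis using pow_pk_notin_max_pow[OF z] by blast
  qed
qed

end

subsection \<open>Freeness over the subring of \<open>p\<close>-th powers\<close>

context frobenius_parameter_ring
begin

text \<open>R as a module over itself through Frobenius: coefficients are recorded before taking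
  p-th powers. Independence accordingly concludes that these roots vanish, which includes
  injectivity of Frobenius.\<close>

definition frob_comb :: "'a set \<Rightarrow> ('a \<Rightarrow> 'a) \<Rightarrow> 'a" where
  "frob_comb E c = (\<Oplus>e\<in>E. c e [^] p \<otimes> e)"

definition frob_spans :: "'a set \<Rightarrow> bool" where
  "frob_spans E \<longleftrightarrow> finite E \<and> E \<subseteq> carrier R \<and> (\<forall>x\<in>carrier R. \<exists>c\<in>E \<rightarrow> carrier R. x = frob_comb E c)"

definition frob_indep :: "'a set \<Rightarrow> bool" where
  "frob_indep E \<longleftrightarrow> (\<forall>c\<in>E \<rightarrow> carrier R. frob_comb E c = \<zero> \<longrightarrow> (\<forall>e\<in>E. c e = \<zero>))"

lemma frob_indepD:
  assumes "frob_indep E" "c \<in> E \<rightarrow> carrier R" "frob_comb E c = \<zero>" "e \<in> E"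
  shows "c e = \<zero>"
  using assms unfolding frob_indep_def by blast

context
  fixes E :: "'a set"
  assumes E: "E \<subseteq> carrier R" and fin: "finite E"
begin

lemma frob_comb_closed: "c \<in> E \<rightarrow> carrier R \<Longrightarrow> frob_comb E c \<in> carrier R"
  unfolding frob_comb_def using E by (intro finsum_closed) (auto simp: Pi_iff)

lemma frob_comb_cong:
  "c \<in> E \<rightarrow> carrier R \<Longrightarrow> (\<And>e. e \<in> E \<Longrightarrow> d e = c e) \<Longrightarrow> frob_comb E d = frob_comb E c"
  unfolding frob_comb_def using E by (intro finsum_cong') (auto simp: Pi_iff)

lemma frob_comb_add:
  assumes "c \<in> E \<rightarrow> carrier R" "d \<in> E \<rightarrow> carrier R"
  shows "frob_comb E (\<lambda>e. c e \<oplus> d e) = frob_comb E c \<oplus> frob_comb E d"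
proof -
  have "frob_comb E (\<lambda>e. c e \<oplus> d e) = (\<Oplus>e\<in>E. c e [^] p \<otimes> e \<oplus> d e [^] p \<otimes> e)"
    unfolding frob_comb_def using assms E frob_add[of _ _ 1]
    by (intro finsum_cong') (auto simp: Pi_iff l_distr subset_iff)
  also have "\<dots> = frob_comb E c \<oplus> frob_comb E d"
    unfolding frob_comb_def using assms E by (intro finsum_addf) (auto simp: Pi_iff)
  finally show ?thesis .
qed

lemma frob_comb_smult:
  assumes "c \<in> E \<rightarrow> carrier R" "r \<in> carrier R"
  shows "frob_comb E (\<lambda>e. r \<otimes> c e) = r [^] p \<otimes> frob_comb E c"
proof -
  have "r [^] p \<otimes> frob_comb E c = (\<Oplus>e\<in>E. r [^] p \<otimes> (c e [^] p \<otimes> e))"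
    unfolding frob_comb_def using assms E fin by (intro finsum_rdistr) (auto simp: Pi_iff)
  also have "\<dots> = frob_comb E (\<lambda>e. r \<otimes> c e)"
    unfolding frob_comb_def using assms E
    by (intro finsum_cong') (auto simp: Pi_iff nat_pow_distrib m_assoc subset_iff)
  finally show ?thesis by simp
qed

lemma frob_comb_minus:
  assumes "c \<in> E \<rightarrow> carrier R" "d \<in> E \<rightarrow> carrier R"
  shows "frob_comb E (\<lambda>e. c e \<ominus> d e) = frob_comb E c \<ominus> frob_comb E d"
proof -
  have "frob_comb E (\<lambda>e. c e \<oplus> (\<ominus> \<one>) \<otimes> d e) = frob_comb E c \<oplus> frob_comb E (\<lambda>e. (\<ominus> \<one>) \<otimes> d e)"
    using assms by (intro frob_comb_add) auto
  also have "frob_comb E (\<lambda>e. (\<ominus> \<one>) \<otimes> d e) = \<ominus> frob_comb E d"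
    using frob_comb_smult[OF assms(2), of "\<ominus> \<one>"] frob_uminus[of \<one> 1] frob_comb_closed[OF assms(2)]
    by (simp add: l_minus)
  also have "frob_comb E (\<lambda>e. c e \<oplus> (\<ominus> \<one>) \<otimes> d e) = frob_comb E (\<lambda>e. c e \<ominus> d e)"
    using assms by (intro frob_comb_cong) (auto simp: a_minus_def l_minus Pi_iff)
  finally show ?thesis by (simp add: a_minus_def)
qed

lemma frob_comb_zero: "frob_comb E (\<lambda>e. \<zero>) = \<zero>"
  using frob_comb_smult[of "\<lambda>e. \<zero>" \<zero>] frob_comb_closed[of "\<lambda>e. \<zero>"] zero_pow_pk[of 1] by simp

lemma frob_comb_mem_frobenius_pow:
  assumes I: "ideal I R" and c: "\<And>e. e \<in> E \<Longrightarrow> c e \<in> I"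
  shows "frob_comb E c \<in> frobenius_pow R I p"
  unfolding frob_comb_def
  by (intro ideal_finsum_closed frobenius_pow_ideal I fin ideal.I_r_closed[OF frobenius_pow_ideal[OF I]]
      pow_mem_frobenius_pow c) (use E in auto)

end

lemma frob_comb_remove:
  assumes "E \<subseteq> carrier R" "finite E" "e \<in> E" "c \<in> E \<rightarrow> carrier R"
  shows "frob_comb E c = c e [^] p \<otimes> e \<oplus> frob_comb (E - {e}) c"
proof -
  have "frob_comb (insert e (E - {e})) c = c e [^] p \<otimes> e \<oplus> frob_comb (E - {e}) c"
    unfolding frob_comb_def using assms by (intro finsum_insert) (auto simp: Pi_iff)
  then show ?thesis using assms(3) by (simp add: insert_absorb)
qed

lemma frob_spans_remove:
  assumes E: "frob_spans E" and c: "c \<in> E \<rightarrow> carrier R" "frob_comb E c = \<zero>" and e: "e \<in> E" "c e \<notin> \<mm>"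
  shows "frob_spans (E - {e})"
proof -
  have Ec: "E \<subseteq> carrier R" "finite E" using E by (auto simp: frob_spans_def)
  have E': "E - {e} \<subseteq> carrier R" "finite (E - {e})" using Ec by auto
  have ec: "e \<in> carrier R" "c e \<in> carrier R" using e c Ec by auto
  have cU: "c e \<in> Units R" by (rule unit_if_notin_max[OF ec(2) e(2)])
  define u where "u = inv (c e)"
  have u: "u \<in> carrier R" "u \<otimes> c e = \<one>" using cU u_def by auto
  have cE': "c \<in> E - {e} \<rightarrow> carrier R" using c by auto
  define w where "w = frob_comb (E - {e}) c"
  have w: "w \<in> carrier R" unfolding w_def by (rule frob_comb_closed[OF E' cE'])
  have sum: "c e [^] p \<otimes> e \<oplus> w = \<zero>" using frob_comb_remove[OF Ec e(1) c(1)] c(2) w_def by simp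
  have b: "(\<lambda>e'. (\<ominus> u) \<otimes> c e') \<in> E - {e} \<rightarrow> carrier R" using u cE' by auto
  have eq: "frob_comb (E - {e}) (\<lambda>e'. (\<ominus> u) \<otimes> c e') = e"
  proof -
    have "\<ominus> w = c e [^] p \<otimes> e" using sum w ec by (intro minus_equality) auto
    have "frob_comb (E - {e}) (\<lambda>e'. (\<ominus> u) \<otimes> c e') = (\<ominus> u) [^] p \<otimes> w"
      unfolding w_def using u by (intro frob_comb_smult E' cE') auto
    also have "\<dots> = \<ominus> (u [^] p) \<otimes> w" using frob_uminus[OF u(1), of 1] by simp
    also have "\<dots> = u [^] p \<otimes> (\<ominus> w)" using u w by (simp add: l_minus r_minus)
    also have "\<dots> = (u \<otimes> c e) [^] p \<otimes> e"
      using \<open>\<ominus> w = c e [^] p \<otimes> e\<close> u(1) ec by (simp add: nat_pow_distrib m_assoc)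
    also have "\<dots> = e" using u ec by simp
    finally show ?thesis .
  qed
  show ?thesis unfolding frob_spans_def
  proof (intro conjI ballI E')
    fix x assume "x \<in> carrier R"
    then obtain d where d: "d \<in> E \<rightarrow> carrier R" "x = frob_comb E d" using E by (auto simp: frob_spans_def)
    have dE': "d \<in> E - {e} \<rightarrow> carrier R" and de: "d e \<in> carrier R" using d e by auto
    have bd: "(\<lambda>e'. d e \<otimes> ((\<ominus> u) \<otimes> c e')) \<in> E - {e} \<rightarrow> carrier R" using b de by auto
    have "x = d e [^] p \<otimes> e \<oplus> frob_comb (E - {e}) d" unfolding d(2) by (rule frob_comb_remove[OF Ec e(1) d(1)])
    also have "d e [^] p \<otimes> e = frob_comb (E - {e}) (\<lambda>e'. d e \<otimes> ((\<ominus> u) \<otimes> c e'))"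
      using frob_comb_smult[OF E' b de] eq by simp
    also have "\<dots> \<oplus> frob_comb (E - {e}) d = frob_comb (E - {e}) (\<lambda>e'. d e \<otimes> ((\<ominus> u) \<otimes> c e') \<oplus> d e')"
      by (rule frob_comb_add[OF E' bd dE', symmetric])
    finally show "\<exists>c\<in>E - {e} \<rightarrow> carrier R. x = frob_comb (E - {e}) c"
      using bd dE' by (intro bexI[of _ "\<lambda>e'. d e \<otimes> ((\<ominus> u) \<otimes> c e') \<oplus> d e'"]) auto
  qed
qed

text \<open>The combinations with coefficients in I already form an ideal: r times w^p e is w^p (r
  e), and expanding r e in E again gives coefficients that are multiples of w.\<close>

lemma frobenius_pow_obtain_comb:
  assumes E: "frob_spans E" and I: "ideal I R" and h: "h \<in> frobenius_pow R I p"
  obtains w where "w \<in> E \<rightarrow> I" "h = frob_comb E w"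
proof -
  have Ec: "E \<subseteq> carrier R" "finite E" using E by (auto simp: frob_spans_def)
  have Ic: "I \<subseteq> carrier R" by (rule ideal_subset_carrier[OF I])
  define J where "J = frob_comb E ` (E \<rightarrow> I)"
  have c: "w \<in> E \<rightarrow> carrier R" if "w \<in> E \<rightarrow> I" for w using that Ic by auto
  have zero: "\<zero> \<in> J" unfolding J_def using frob_comb_zero[OF Ec] ideal_zero_mem[OF I]
    by (intro image_eqI[of _ _ "\<lambda>e. \<zero>"]) auto
  have add: "a \<oplus> b \<in> J" if ab: "a \<in> J" "b \<in> J" for a b
  proof -
    obtain v w where vw: "v \<in> E \<rightarrow> I" "w \<in> E \<rightarrow> I" "a = frob_comb E v" "b = frob_comb E w"
      using ab J_def by auto
    have "a \<oplus> b = frob_comb E (\<lambda>e. v e \<oplus> w e)" using frob_comb_add[OF Ec c[OF vw(1)] c[OF vw(2)]] vw by simp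
    moreover have "(\<lambda>e. v e \<oplus> w e) \<in> E \<rightarrow> I" using vw ideal_add_closed[OF I] by auto
    ultimately show ?thesis unfolding J_def by blast
  qed
  have prod_mem: "z [^] p \<otimes> x \<in> J" if z: "z \<in> I" and x: "x \<in> carrier R" for z x
  proof -
    obtain d where d: "d \<in> E \<rightarrow> carrier R" "x = frob_comb E d" using E x by (auto simp: frob_spans_def)
    have "z [^] p \<otimes> x = frob_comb E (\<lambda>e. z \<otimes> d e)" using frob_comb_smult[OF Ec d(1)] z Ic d(2) by auto
    moreover have "(\<lambda>e. z \<otimes> d e) \<in> E \<rightarrow> I" using d(1) z by (auto intro: ideal.I_r_closed[OF I])
    ultimately show ?thesis unfolding J_def by blast
  qed
  have "ideal J R"
  proof (rule ideal_if_closed[OF _ zero add])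
    show "J \<subseteq> carrier R" unfolding J_def using frob_comb_closed[OF Ec c] by auto
    fix a r assume a: "a \<in> J" and r: "r \<in> carrier R"
    then obtain w where w: "w \<in> E \<rightarrow> I" "a = frob_comb E w" using J_def by auto
    have wc: "w \<in> E \<rightarrow> carrier R" by (rule c[OF w(1)])
    have "r \<otimes> a = (\<Oplus>e\<in>E. r \<otimes> (w e [^] p \<otimes> e))"
      unfolding w(2) frob_comb_def using wc Ec r by (intro finsum_rdistr) (auto simp: Pi_iff)
    also have "\<dots> = (\<Oplus>e\<in>E. w e [^] p \<otimes> (r \<otimes> e))"
      using wc Ec r by (intro finsum_cong') (auto simp: Pi_iff m_lcomm subset_iff)
    also have "\<dots> \<in> J"
    proof -
      have "(\<Oplus>e\<in>F. w e [^] p \<otimes> (r \<otimes> e)) \<in> J" if "finite F" "F \<subseteq> E" for F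
        using that
      proof (induction F rule: finite_induct)
        case (insert e F)
        have "(\<Oplus>e\<in>insert e F. w e [^] p \<otimes> (r \<otimes> e)) = w e [^] p \<otimes> (r \<otimes> e) \<oplus> (\<Oplus>e\<in>F. w e [^] p \<otimes> (r \<otimes> e))"
          using insert wc Ec r by (intro finsum_insert) (auto simp: Pi_iff subset_iff)
        moreover have "w e [^] p \<otimes> (r \<otimes> e) \<in> J" using insert w Ec r by (intro prod_mem) auto
        ultimately show ?case using insert add by auto
      qed (use zero in simp)
      then show ?thesis using Ec by blast
    qed
    finally show "r \<otimes> a \<in> J" .
  qed
  moreover have "z [^] p \<in> J" if "z \<in> I" for z using prod_mem[OF that one_closed] that Ic by auto
  ultimately have "frobenius_pow R I p \<subseteq> J" by (rule frobenius_pow_subset)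
  then have "h \<in> frob_comb E ` (E \<rightarrow> I)" using h J_def by auto
  then obtain w where "w \<in> E \<rightarrow> I" "h = frob_comb E w" by (elim imageE) simp
  then show ?thesis by (rule that)
qed

text \<open>A minimal spanning set is a basis: the ideal \<open>K\<close> of all coefficients of relations lies in
  \<open>\<mm>\<close>, and dividing a relation by the regular sequence of the \<open>p\<close>-th powers of the parameters
  shows \<open>K = \<mm>K\<close>.\<close>

theorem frobenius_basis:
  obtains E where "frob_spans E" "frob_indep E"
proof -
  obtain E0 where "frob_spans E0"
    using F_fin unfolding F_finite_def finite_ring_hom_def frob_spans_def frob_comb_def by blast
  then obtain E where E: "frob_spans E" and min: "\<And>E'. frob_spans E' \<Longrightarrow> card E \<le> card E'"
    using ex_has_least_nat[of frob_spans E0 card] by blast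
  have Ec: "E \<subseteq> carrier R" "finite E" using E by (auto simp: frob_spans_def)
  define K0 where "K0 = {c e | c e. c \<in> E \<rightarrow> carrier R \<and> frob_comb E c = \<zero> \<and> e \<in> E}"
  have K0m: "K0 \<subseteq> \<mm>"
  proof
    fix k assume "k \<in> K0"
    then obtain c e where ce: "k = c e" "c \<in> E \<rightarrow> carrier R" "frob_comb E c = \<zero>" "e \<in> E" using K0_def by auto
    show "k \<in> \<mm>"
    proof (rule ccontr)
      assume "k \<notin> \<mm>"
      then have "card E \<le> card (E - {e})" using ce by (intro min frob_spans_remove[OF E]) auto
      then show False using ce(4) Ec(2) by (metis card_Diff1_less linorder_not_le)
    qed
  qed
  have K0c: "K0 \<subseteq> carrier R" using K0m ideal_subset_carrier[OF max_ideal] by blast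
  define K where "K = Idl K0"
  have iK: "ideal K R" unfolding K_def by (rule genideal_ideal[OF K0c])
  have iP: "ideal (\<mm> \<cdot> K) R" by (rule ideal_prod_is_ideal[OF max_ideal iK])
  have K0K: "K0 \<subseteq> K" unfolding K_def by (rule genideal_self[OF K0c])
  \<comment> \<open>The induction shrinks the ideal containing the coefficients of a relation. With
    c = v + u x, cancelling x^p gives that the combination of u equals one with coefficients w in
    (S). Then v + x w is again a relation, now with coefficients in (S).\<close>
  have main: "c e \<in> \<mm> \<cdot> K" if "finite S" "S \<subseteq> X0" "c \<in> E \<rightarrow> Idl S" "frob_comb E c = \<zero>" "e \<in> E" for S c e
    using that
  proof (induction S arbitrary: c e rule: finite_induct)
    case empty
    then have "c e = \<zero>" by (auto simp: Idl_empty)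
    then show ?case using ideal_zero_mem[OF iP] by simp
  next
    case (insert x S)
    have x: "x \<in> carrier R" "x \<in> X0" "x \<in> X0 - S" and S: "S \<subseteq> carrier R" "S \<subseteq> X0"
      using insert.prems(1) insert.hyps params_carrier by auto
    note iS = genideal_ideal[OF S(1)]
    have "\<forall>e\<in>E. \<exists>v u. v \<in> Idl S \<and> u \<in> carrier R \<and> c e = v \<oplus> u \<otimes> x"
    proof
      fix e assume "e \<in> E"
      then have "c e \<in> Idl (insert x S)" using insert.prems(2) by blast
      then have "c e \<in> Idl S <+> PIdl x" unfolding Idl_insert[OF x(1) S(1)] .
      then obtain v j where v: "v \<in> Idl S" "c e = v \<oplus> j" and "j \<in> PIdl x" by (auto simp: set_add_iff)
      then obtain u where "u \<in> carrier R" "j = u \<otimes> x" by (auto simp: PIdl_iff)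
      with v show "\<exists>v u. v \<in> Idl S \<and> u \<in> carrier R \<and> c e = v \<oplus> u \<otimes> x" by metis
    qed
    from bchoice[OF this] obtain v
      where "\<forall>e\<in>E. \<exists>u. v e \<in> Idl S \<and> u \<in> carrier R \<and> c e = v e \<oplus> u \<otimes> x" by blast
    from bchoice[OF this] obtain u
      where "\<forall>e\<in>E. v e \<in> Idl S \<and> u e \<in> carrier R \<and> c e = v e \<oplus> u e \<otimes> x" by blast
    then have vu: "\<And>e. e \<in> E \<Longrightarrow> v e \<in> Idl S" "\<And>e. e \<in> E \<Longrightarrow> u e \<in> carrier R"
      "\<And>e. e \<in> E \<Longrightarrow> c e = v e \<oplus> u e \<otimes> x" by simp_all
    have vc: "v e \<in> carrier R" if "e \<in> E" for e using ideal.Icarr[OF iS vu(1)[OF that]] .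
    have vC: "v \<in> E \<rightarrow> carrier R" and uC: "u \<in> E \<rightarrow> carrier R" using vc vu(2) by auto
    have cC: "c \<in> E \<rightarrow> carrier R" using vu vc x by auto
    have xu: "(\<lambda>e. x \<otimes> u e) \<in> E \<rightarrow> carrier R" using uC x by auto
    have "frob_comb E c = frob_comb E (\<lambda>e. v e \<oplus> x \<otimes> u e)"
      using vu vc x by (intro frob_comb_cong Ec) (auto simp: m_comm)
    also have "\<dots> = frob_comb E v \<oplus> x [^] p \<otimes> frob_comb E u"
      using frob_comb_add[OF Ec vC xu] frob_comb_smult[OF Ec uC x(1)] by simp
    finally have "frob_comb E v \<oplus> x [^] p \<otimes> frob_comb E u = \<zero>" using insert.prems(3) by simp
    then have eq: "x [^] p \<otimes> frob_comb E u = \<ominus> frob_comb E v"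
      using frob_comb_closed[OF Ec vC] frob_comb_closed[OF Ec uC] x by (metis a_comm m_closed minus_equality nat_pow_closed)
    have frS: "frobenius_pow R (Idl S) p = box S (\<lambda>x. p)" using frob_Idl_params[OF S(2), of 1] by simp
    have "frob_comb E v \<in> box S (\<lambda>x. p)" unfolding frS[symmetric] by (rule frob_comb_mem_frobenius_pow[OF Ec iS vu(1)])
    then have "x [^] p \<otimes> frob_comb E u \<in> box S (\<lambda>x. p)"
      unfolding eq by (rule ideal_a_inv_closed[OF box_ideal[OF S(1)]])
    then have "frob_comb E u \<in> box S (\<lambda>x. p)"
      by (rule nonzerodivisor_pow_mod_box[OF partial_primes S(2) x(3) frob_comb_closed[OF Ec uC]])
    then have "frob_comb E u \<in> frobenius_pow R (Idl S) p" using frS by simp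
    then obtain w where w: "w \<in> E \<rightarrow> Idl S" "frob_comb E u = frob_comb E w"
      by (rule frobenius_pow_obtain_comb[OF E iS])
    have wC: "w \<in> E \<rightarrow> carrier R" using w(1) ideal_subset_carrier[OF iS] by auto
    \<comment> \<open>This difference is itself a relation, so its coefficients lie in K and x times
      them in \<mm> K.\<close>
    define \<kappa> where "\<kappa> = (\<lambda>e. u e \<ominus> w e)"
    have \<kappa>C: "\<kappa> \<in> E \<rightarrow> carrier R" using uC wC \<kappa>_def by auto
    have "frob_comb E \<kappa> = \<zero>"
      unfolding \<kappa>_def using frob_comb_minus[OF Ec uC wC] w(2) frob_comb_closed[OF Ec wC] by (simp add: a_minus_def r_neg)
    then have \<kappa>0: "frob_comb E \<kappa> = \<zero>" "\<And>e. e \<in> E \<Longrightarrow> \<kappa> e \<in> K" using \<kappa>C K0K K0_def by auto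
    define c' where "c' = (\<lambda>e. v e \<oplus> x \<otimes> w e)"
    have c'S: "c' \<in> E \<rightarrow> Idl S"
      unfolding c'_def using vu(1) w(1) x by (auto intro!: ideal_add_closed[OF iS] ideal.I_l_closed[OF iS])
    have c'C: "c' \<in> E \<rightarrow> carrier R" using c'S ideal_subset_carrier[OF iS] by auto
    have split: "c e = c' e \<oplus> x \<otimes> \<kappa> e" if "e \<in> E" for e
    proof -
      have eq: "a \<oplus> b \<otimes> x = (a \<oplus> x \<otimes> d) \<oplus> x \<otimes> (b \<ominus> d)" if [simp]: "a \<in> carrier R" "b \<in> carrier R" "d \<in> carrier R" for a b d
      proof -
        have [simp]: "x \<in> carrier R" by (rule x)
        show ?thesis by (simp add: r_minus_distr add_add_minus_cancel m_comm)
      qed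
      then show ?thesis unfolding c'_def \<kappa>_def using vu(3)[OF that] eq[OF vc[OF that] vu(2)[OF that], of "w e"] wC that by auto
    qed
    have x\<kappa>: "(\<lambda>e. x \<otimes> \<kappa> e) \<in> E \<rightarrow> carrier R" using \<kappa>C x by auto
    have "frob_comb E c = frob_comb E (\<lambda>e. c' e \<oplus> x \<otimes> \<kappa> e)"
      using split c'C x\<kappa> by (intro frob_comb_cong Ec) auto
    also have "\<dots> = frob_comb E c' \<oplus> x [^] p \<otimes> frob_comb E \<kappa>"
      using frob_comb_add[OF Ec c'C x\<kappa>] frob_comb_smult[OF Ec \<kappa>C x(1)] by simp
    also have "\<dots> = frob_comb E c'" using \<kappa>0(1) x frob_comb_closed[OF Ec c'C] by simp
    finally have "frob_comb E c' = \<zero>" using insert.prems(3) by simp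
    then have "c' e \<in> \<mm> \<cdot> K" by (rule insert.IH[OF S(2) c'S _ insert.prems(4)])
    moreover have "x \<otimes> \<kappa> e \<in> \<mm> \<cdot> K" using \<kappa>0(2)[OF insert.prems(4)] params_subset_max x(2) by (intro ideal_prod.prod) auto
    ultimately show ?case unfolding split[OF insert.prems(4)] by (rule ideal_add_closed[OF iP])
  qed
  have "K0 \<subseteq> \<mm> \<cdot> K"
  proof
    fix k assume "k \<in> K0"
    then obtain c e where ce: "k = c e" "c \<in> E \<rightarrow> carrier R" "frob_comb E c = \<zero>" "e \<in> E" using K0_def by auto
    have "c \<in> E \<rightarrow> Idl X0" using ce K0m max_eq unfolding K0_def by blast
    then show "k \<in> \<mm> \<cdot> K" unfolding ce(1) by (rule main[OF finite_params subset_refl _ ce(3,4)])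
  qed
  then have "K \<subseteq> \<mm> \<cdot> K" unfolding K_def[symmetric] by (subst K_def) (rule genideal_minimal[OF iP])
  then have "K \<subseteq> {\<zero>} <+> \<mm> \<cdot> K" using subset_set_add(2)[OF zeroideal iP] by blast
  then have "K \<subseteq> {\<zero>}" by (rule Nakayama[OF zeroideal iK])
  then have "frob_indep E" using K0K unfolding frob_indep_def K0_def by blast
  then show ?thesis using that E by blast
qed

lemma frobenius_pow_comb_coeff_mem:
  assumes E: "frob_spans E" and indep: "frob_indep E"
    and I: "ideal I R" and c: "c \<in> E \<rightarrow> carrier R" and mem: "frob_comb E c \<in> frobenius_pow R I p" and e: "e \<in> E"
  shows "c e \<in> I"
proof -
  have Ec: "E \<subseteq> carrier R" "finite E" using E by (auto simp: frob_spans_def)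
  obtain w where w: "w \<in> E \<rightarrow> I" "frob_comb E c = frob_comb E w"
    by (rule frobenius_pow_obtain_comb[OF E I mem])
  have wC: "w \<in> E \<rightarrow> carrier R" using w(1) ideal_subset_carrier[OF I] by auto
  have zero: "frob_comb E (\<lambda>e. c e \<ominus> w e) = \<zero>"
    using frob_comb_minus[OF Ec c wC] w(2) frob_comb_closed[OF Ec wC] by (simp add: a_minus_def r_neg)
  have "(\<lambda>e. c e \<ominus> w e) \<in> E \<rightarrow> carrier R" using c wC by auto
  from frob_indepD[OF indep this zero e] have "c e \<ominus> w e = \<zero>" .
  then have "c e = w e" using funcset_mem[OF c e] funcset_mem[OF wC e] by simp
  then show ?thesis using w(1) e by auto
qed

text \<open>With respect to a basis, membership in L^[p] is membership of each coefficient in L, and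
  this commutes with arbitrary, also infinite, intersections. It is what makes a smallest ideal
  available later.\<close>

lemma frobenius_pow_Inter:
  assumes "F \<noteq> {}" "\<And>L. L \<in> F \<Longrightarrow> ideal L R" "\<And>L. L \<in> F \<Longrightarrow> h \<in> frobenius_pow R L (p ^ k)"
  shows "h \<in> frobenius_pow R (\<Inter>F) (p ^ k)"
  using assms(3)
proof (induction k arbitrary: h)
  case 0
  have "h \<in> L" if "L \<in> F" for L using 0[OF that] frobenius_pow_1[OF assms(2)[OF that]] by simp
  moreover have "frobenius_pow R (\<Inter>F) (p ^ 0) = \<Inter>F"
    using frobenius_pow_1[OF i_Intersect[OF assms(2,1)]] by simp
  ultimately show ?case by blast
next
  case (Suc k)
  have iF: "ideal (\<Inter>F) R" by (rule i_Intersect[OF assms(2,1)])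
  obtain E where E: "frob_spans E" and indep: "frob_indep E"
    by (rule frobenius_basis)
  have Ec: "E \<subseteq> carrier R" "finite E" using E by (auto simp: frob_spans_def)
  obtain L0 where L0: "L0 \<in> F" using assms(1) by auto
  have "h \<in> carrier R" using ideal.Icarr[OF frobenius_pow_ideal[OF assms(2)[OF L0]] Suc.prems[OF L0]] .
  then obtain c where c: "c \<in> E \<rightarrow> carrier R" "h = frob_comb E c" using E by (auto simp: frob_spans_def)
  have "c e \<in> frobenius_pow R (\<Inter>F) (p ^ k)" if e: "e \<in> E" for e
  proof (rule Suc.IH)
    fix L assume L: "L \<in> F"
    have "frob_comb E c \<in> frobenius_pow R (frobenius_pow R L (p ^ k)) p"
      using Suc.prems[OF L] frob_frob[OF assms(2)[OF L], of k 1] c(2) by simp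
    then show "c e \<in> frobenius_pow R L (p ^ k)"
      by (rule frobenius_pow_comb_coeff_mem[where c = c and e = e, OF E indep frobenius_pow_ideal[OF assms(2)[OF L]] c(1) _ e])
  qed
  then have "h \<in> frobenius_pow R (frobenius_pow R (\<Inter>F) (p ^ k)) p"
    unfolding c(2) by (rule frob_comb_mem_frobenius_pow[OF Ec frobenius_pow_ideal[OF iF]])
  then show ?case using frob_frob[OF iF, of k 1] by simp
qed

text \<open>Flatness of Frobenius for colon ideals. If h has coefficients c e, then h times the
  p^(k+1)-th power of z has coefficients z^(p^k) times c e, and the induction descends to
  these.\<close>

lemma frobenius_pow_colon:
  assumes I: "ideal I R" and z: "z \<in> carrier R" and h: "h \<in> carrier R"
    and mem: "h \<otimes> z [^] (p ^ k) \<in> frobenius_pow R I (p ^ k)"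
  shows "h \<in> frobenius_pow R (colon I z) (p ^ k)"
  using h mem
proof (induction k arbitrary: h)
  case 0
  then show ?case using frobenius_pow_1[OF I] frobenius_pow_1[OF colon_ideal[OF I z]] z by (simp add: colon_def)
next
  case (Suc k)
  note iC = colon_ideal[OF I z]
  obtain E where E: "frob_spans E" and indep: "frob_indep E"
    by (rule frobenius_basis)
  have Ec: "E \<subseteq> carrier R" "finite E" using E by (auto simp: frob_spans_def)
  obtain c where c: "c \<in> E \<rightarrow> carrier R" "h = frob_comb E c" using E Suc.prems(1) by (auto simp: frob_spans_def)
  define y where "y = z [^] (p ^ k)"
  have y: "y \<in> carrier R" using z y_def by simp
  have yc: "(\<lambda>e. y \<otimes> c e) \<in> E \<rightarrow> carrier R" using c y by auto
  have "y [^] p = z [^] (p ^ Suc k)" unfolding y_def using z by (simp add: nat_pow_pow mult.commute)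
  then have "frob_comb E (\<lambda>e. y \<otimes> c e) = h \<otimes> z [^] (p ^ Suc k)"
    using frob_comb_smult[OF Ec c(1) y] c(2) Suc.prems(1) z m_comm[of h "z [^] (p ^ Suc k)"] by simp
  then have mem: "frob_comb E (\<lambda>e. y \<otimes> c e) \<in> frobenius_pow R (frobenius_pow R I (p ^ k)) p"
    using Suc.prems(2) frob_frob[OF I, of k 1] by simp
  have "c e \<in> frobenius_pow R (colon I z) (p ^ k)" if e: "e \<in> E" for e
  proof (rule Suc.IH)
    show ce: "c e \<in> carrier R" using c e by auto
    have "y \<otimes> c e \<in> frobenius_pow R I (p ^ k)"
      by (rule frobenius_pow_comb_coeff_mem[where c = "\<lambda>e. y \<otimes> c e" and e = e, OF E indep frobenius_pow_ideal[OF I] yc mem e])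
    then show "c e \<otimes> z [^] (p ^ k) \<in> frobenius_pow R I (p ^ k)" using ce y m_comm y_def by metis
  qed
  then have "h \<in> frobenius_pow R (frobenius_pow R (colon I z) (p ^ k)) p"
    unfolding c(2) by (rule frob_comb_mem_frobenius_pow[OF Ec frobenius_pow_ideal[OF iC]])
  then show ?case using frob_frob[OF iC, of k 1] by simp
qed

text \<open>A proper colon ideal lies in \<mm>, and this would force h into \<mm>^[p^k]. One
  exponent suffices here, in contrast to the next criterion.\<close>

lemma mem_if_frobenius_multiple:
  assumes I: "ideal I R" and z: "z \<in> carrier R" and h: "h \<in> carrier R" "h \<notin> frobenius_pow R \<mm> (p ^ k)"
    and mem: "h \<otimes> z [^] (p ^ k) \<in> frobenius_pow R I (p ^ k)"
  shows "z \<in> I"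
proof (rule ccontr)
  assume "z \<notin> I"
  then have "\<one> \<notin> colon I z" using z by (simp add: colon_def)
  then have "colon I z \<noteq> carrier R" by auto
  then have "colon I z \<subseteq> \<mm>" by (rule proper_ideal_subset_max[OF colon_ideal[OF I z]])
  then have "frobenius_pow R (colon I z) (p ^ k) \<subseteq> frobenius_pow R \<mm> (p ^ k)"
    by (rule frobenius_pow_mono[OF max_ideal])
  then show False using frobenius_pow_colon[OF I z h(1) mem] h(2) by blast
qed

lemma frobenius_max_subset: "frobenius_pow R \<mm> (p ^ k) \<subseteq> ideal_pow R \<mm> (p ^ k)"
  by (rule frobenius_pow_subset_ideal_pow[OF max_ideal])

lemma frobenius_max_subset_max: "frobenius_pow R \<mm> (p ^ k) \<subseteq> \<mm>"
  using frobenius_max_subset ideal_pow_antimono[OF max_ideal, of 1 "p ^ k"] ideal_pow_1[OF max_ideal] pk_pos[of k]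
  by (metis One_nat_def Suc_leI subset_trans)

text \<open>Every ideal is tightly closed: by Krull's intersection theorem a nonzero multiplier h
  lies outside some \<mm>^[p^n], and the exponent n alone decides.\<close>

lemma mem_if_frobenius_multiples:
  assumes I: "ideal I R" and z: "z \<in> carrier R" and h: "h \<in> carrier R" "h \<noteq> \<zero>"
    and mem: "\<And>k. h \<otimes> z [^] (p ^ k) \<in> frobenius_pow R I (p ^ k)"
  shows "z \<in> I"
proof (rule ccontr)
  assume zI: "z \<notin> I"
  have "h \<in> ideal_pow R \<mm> n" for n
  proof -
    have "h \<in> frobenius_pow R \<mm> (p ^ n)" using mem_if_frobenius_multiple[OF I z h(1) _ mem] zI by blast
    moreover have "n \<le> p ^ n" using power_gt_expt[of p n] p_gt_1 by simp
    ultimately show ?thesis using frobenius_max_subset ideal_pow_antimono[OF max_ideal] by blast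
  qed
  then have "h = \<zero>" by (rule Krull_intersection_zero[OF h(1)])
  then show False using h(2) by simp
qed

end

subsection \<open>Ideals with small \<open>F\<close>-pure threshold\<close>

text \<open>Pigeonhole on the powers of p modulo s gives a positive m with p^m congruent to 1;
  multiplying m by n makes the exponent as large as required.\<close>

lemma exists_power_cong_one:
  fixes p s :: nat
  assumes "coprime s p" "s > 0" "p > 1"
  obtains k r where "n \<le> k" "p ^ k = s * r + 1"
proof -
  have "\<not> inj_on (\<lambda>i. p ^ i mod s) {..s}"
  proof
    assume "inj_on (\<lambda>i. p ^ i mod s) {..s}"
    then have "card {..s} \<le> card {..<s}" using assms by (intro card_inj_on_le[of "\<lambda>i. p ^ i mod s"]) auto
    then show False by simp
  qed
  then obtain i j where "i \<noteq> j" "p ^ i mod s = p ^ j mod s" by (auto simp: inj_on_def)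
  then obtain i m where m: "m > 0" "p ^ i mod s = p ^ (i + m) mod s"
    by (metis less_imp_add_positive linorder_neqE_nat)
  have "int s dvd int (p ^ (i + m)) - int (p ^ i)"
    using m(2) by (metis mod_eq_dvd_iff of_nat_mod)
  then have "int s dvd int (p ^ i) * (int (p ^ m) - 1)" by (simp add: power_add algebra_simps)
  moreover have "coprime (int s) (int (p ^ i))" using assms(1) by simp
  ultimately have "int s dvd int (p ^ m) - 1" by (simp add: coprime_dvd_mult_right_iff)
  then have "int (p ^ m) mod int s = 1 mod int s" by (simp add: mod_eq_dvd_iff)
  then have pm: "p ^ m mod s = 1 mod s" by (metis of_nat_1 of_nat_eq_iff of_nat_mod)
  have "p ^ (m * n) mod s = 1 mod s"
    by (metis pm power_mod power_mult power_one)
  moreover have "1 \<le> p ^ (m * n)" using assms(3) by simp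
  ultimately have "s dvd p ^ (m * n) - 1" by (metis mod_eq_dvd_iff_nat)
  then obtain r where "p ^ (m * n) - 1 = s * r" by (elim dvdE)
  then have "p ^ (m * n) = s * r + 1" using \<open>1 \<le> p ^ (m * n)\<close> by linarith
  moreover have "n \<le> m * n" using m(1) by simp
  ultimately show ?thesis using that by blast
qed

context cring
begin

lemma ideal_pow_prod:
  assumes I: "ideal I R" and J: "ideal J R"
  shows "ideal_pow R (I \<cdot> J) n = ideal_pow R I n \<cdot> ideal_pow R J n"
proof -
  interpret M: comm_monoid "ideals_set R" by (rule ideals_set_is_comm_monoid)
  have "I \<in> carrier (ideals_set R)" "J \<in> carrier (ideals_set R)" using I J by (auto simp: ideals_set_def)
  from M.nat_pow_distrib[OF this, of n] show ?thesis by simp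
qed

end

section \<open>Congruences that see a single parameter\<close>

context frobenius_parameter_ring
begin

lemma frobenius_pow_add_subset:
  assumes I: "ideal I R" and J: "ideal J R"
  shows "frobenius_pow R (I <+> J) (p ^ k) \<subseteq> frobenius_pow R I (p ^ k) <+> frobenius_pow R J (p ^ k)"
proof (rule frobenius_pow_subset)
  show "ideal (frobenius_pow R I (p ^ k) <+> frobenius_pow R J (p ^ k)) R"
    by (intro add_ideals frobenius_pow_ideal I J)
  fix z assume "z \<in> I <+> J"
  then obtain i j where ij: "i \<in> I" "j \<in> J" "z = i \<oplus> j" by (auto simp: set_add_iff)
  have "z [^] (p ^ k) = i [^] (p ^ k) \<oplus> j [^] (p ^ k)"
    unfolding ij(3) by (rule frob_add[OF ideal.Icarr[OF I ij(1)] ideal.Icarr[OF J ij(2)]])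
  then show "z [^] (p ^ k) \<in> frobenius_pow R I (p ^ k) <+> frobenius_pow R J (p ^ k)"
    using set_addI[OF pow_mem_frobenius_pow[OF I ij(1)] pow_mem_frobenius_pow[OF J ij(2)]] by simp
qed

lemma frobenius_pow_PIdl: "y \<in> carrier R \<Longrightarrow> frobenius_pow R (PIdl y) (p ^ k) = PIdl (y [^] (p ^ k))"
  using frob_Idl[of "{y}" k] by (simp add: cgenideal_eq_genideal)

lemma frob_cong:
  "ideal I R \<Longrightarrow> ideal_cong I a b \<Longrightarrow> ideal_cong (frobenius_pow R I (p ^ k)) (a [^] (p ^ k)) (b [^] (p ^ k))"
  using pow_mem_frobenius_pow[of I "a \<ominus> b" "p ^ k"] by (simp add: ideal_cong_def frob_minus)

lemma frobenius_max_subset_pow: "n \<le> k \<Longrightarrow> frobenius_pow R \<mm> (p ^ k) \<subseteq> ideal_pow R \<mm> n"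
proof -
  assume "n \<le> k"
  also have "k \<le> p ^ k" using power_gt_expt[of p k] p_gt_1 by simp
  finally show ?thesis using frobenius_max_subset ideal_pow_antimono[OF max_ideal] by blast
qed

text \<open>Working modulo this ideal resembles restricting to the x-axis, except that x stays a
  nonzerodivisor and Frobenius only rescales n.\<close>

definition coord_box :: "nat \<Rightarrow> 'a \<Rightarrow> 'a set" where
  "coord_box n x = box (X0 - {x}) (\<lambda>_. n)"

lemma coord_box_ideal: "ideal (coord_box n x) R"
  unfolding coord_box_def using params_carrier by (intro box_ideal) auto

lemma frob_coord_box: "frobenius_pow R (coord_box n x) (p ^ k) = coord_box (n * p ^ k) x"
  unfolding coord_box_def using params_carrier by (intro frob_box) auto

lemma params_pow_closed: "x \<in> X0 \<Longrightarrow> x [^] (n::nat) \<in> carrier R"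
  using params_carrier by auto

lemma frob_max_eq:
  assumes "x \<in> X0"
  shows "frobenius_pow R \<mm> (p ^ k) = coord_box (p ^ k) x <+> PIdl (x [^] (p ^ k))"
  unfolding frob_max coord_box_def using box_insert[of x "X0 - {x}" "\<lambda>_. p ^ k"] assms params_carrier
  by (auto simp: insert_absorb)

lemma coord_box_subset_frob_max: "coord_box (p ^ k) x \<subseteq> frobenius_pow R \<mm> (p ^ k)"
  unfolding frob_max coord_box_def using params_carrier by (intro box_mono) auto

text \<open>One family of coefficients serves all parameters at the same time, because modulo
  \<open>coord_box\<close> for x every other summand vanishes. The order count for f needs this
  simultaneity.\<close>

lemma frob_max_coefficients:
  assumes z: "z \<in> frobenius_pow R \<mm> (p ^ k)"
  obtains A where "A \<in> X0 \<rightarrow> carrier R" "z = (\<Oplus>x\<in>X0. A x \<otimes> x [^] (p ^ k))"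
    "\<And>x. x \<in> X0 \<Longrightarrow> ideal_cong (coord_box (p ^ k) x) z (A x \<otimes> x [^] (p ^ k))"
proof -
  let ?h = "\<lambda>x. x [^] (p ^ k)"
  have hc: "?h \<in> X0 \<rightarrow> carrier R" using params_pow_closed by auto
  have zc: "z \<in> carrier R" by (rule ideal.Icarr[OF frobenius_pow_ideal[OF max_ideal] z])
  have "z \<in> Idl (?h ` X0)" using z by (simp add: frob_max box_def)
  then obtain A where A: "A \<in> X0 \<rightarrow> carrier R" "z = (\<Oplus>x\<in>X0. A x \<otimes> ?h x)"
    unfolding Idl_finite_image_iff[OF finite_params hc] by blast
  have "ideal_cong (coord_box (p ^ k) x) z (A x \<otimes> ?h x)" if x: "x \<in> X0" for x
  proof -
    note iD = coord_box_ideal[of "p ^ k" x]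
    have rest: "(\<Oplus>y\<in>X0 - {x}. A y \<otimes> ?h y) \<in> coord_box (p ^ k) x"
    proof (rule ideal_finsum_closed[OF iD])
      show "finite (X0 - {x})" using finite_params by simp
      fix y assume y: "y \<in> X0 - {x}"
      have "?h y \<in> coord_box (p ^ k) x" unfolding coord_box_def
        using pow_mem_box[of "X0 - {x}" y "\<lambda>_. p ^ k"] params_carrier y by auto
      then show "A y \<otimes> ?h y \<in> coord_box (p ^ k) x" using A(1) y by (intro ideal.I_l_closed[OF iD]) auto
    qed
    have Ax: "A x \<otimes> ?h x \<in> carrier R" using A(1) x params_pow_closed by auto
    have "(\<Oplus>y\<in>insert x (X0 - {x}). A y \<otimes> ?h y) = A x \<otimes> ?h x \<oplus> (\<Oplus>y\<in>X0 - {x}. A y \<otimes> ?h y)"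
      using finite_params A(1) hc x by (intro finsum_insert) (auto simp: Pi_iff)
    then have "z = A x \<otimes> ?h x \<oplus> (\<Oplus>y\<in>X0 - {x}. A y \<otimes> ?h y)"
      unfolding A(2) using x by (simp add: insert_absorb)
    then have "z \<ominus> A x \<otimes> ?h x \<in> coord_box (p ^ k) x"
      using rest Ax ideal.Icarr[OF iD rest] by (simp add: add_minus_cancel)
    then show ?thesis using zc Ax by (simp add: ideal_cong_def)
  qed
  then show ?thesis using that A by blast
qed

lemma coord_box_cancel:
  assumes x: "x \<in> X0" and vw: "v \<in> carrier R" "w \<in> carrier R"
    and "ideal_cong (coord_box n x) (v \<otimes> x [^] (m::nat)) (w \<otimes> x [^] m)"
  shows "ideal_cong (coord_box n x) v w"
proof -
  define y where "y = x [^] m"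
  have [simp]: "y \<in> carrier R" "v \<in> carrier R" "w \<in> carrier R" using vw params_pow_closed[OF x] y_def by auto
  have "v \<otimes> y \<ominus> w \<otimes> y = y \<otimes> (v \<ominus> w)" by (simp add: r_minus_distr m_comm)
  then have "x [^] m \<otimes> (v \<ominus> w) \<in> box (X0 - {x}) (\<lambda>_. n)"
    using assms(4) by (simp add: ideal_cong_def coord_box_def y_def)
  then have "v \<ominus> w \<in> box (X0 - {x}) (\<lambda>_. n)"
    by (rule nonzerodivisor_pow_mod_box[OF partial_primes, rotated 3]) (use x vw in auto)
  then show ?thesis using vw by (simp add: ideal_cong_def coord_box_def)
qed

end

text \<open>The assumption \<open>small\<close> is fpt(\<aa>) = 1/d with the supremum eliminated, by
  \<open>fpt_eq_iff\<close>; f is an element of \<aa> that attains the order d.\<close>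

locale small_fpt = frobenius_parameter_ring +
  fixes \<aa> :: "'a set" and d q s e :: nat and f :: 'a
  assumes ideal_a: "ideal \<aa> R" and d_eq: "d = q * s" and q_eq: "q = p ^ e"
    and s_pos: "s > 0" and s_coprime: "coprime s p"
    and small: "p ^ k < d * t \<Longrightarrow> ideal_pow R \<aa> t \<subseteq> frobenius_pow R \<mm> (p ^ k)"
    and f_a: "f \<in> \<aa>" and f_ord: "f \<in> ideal_pow R \<mm> d" "f \<notin> ideal_pow R \<mm> (Suc d)"
begin

lemma f_closed: "f \<in> carrier R"
  using ideal.Icarr[OF ideal_a f_a] .

lemma q_pos: "q > 0"
  unfolding q_eq by (rule pk_pos)

lemma f_pow_nonzero: "f [^] (n::nat) \<noteq> \<zero>"
  using pow_notin_max_pow[OF f_ord, of n] ideal_zero_mem[OF ideal_pow_ideal[OF max_ideal, of "Suc (d * n)"]] by metis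

abbreviation (input) \<open>Mq \<equiv> frobenius_pow R \<mm> q\<close>

lemma Mq_ideal: "ideal Mq R"
  by (rule frobenius_pow_ideal[OF max_ideal])

lemma frob_Mq: "frobenius_pow R Mq (p ^ k) = frobenius_pow R \<mm> (p ^ (e + k))"
  unfolding q_eq by (rule frob_frob[OF max_ideal])

text \<open>The hypothesis is the boundary case of \<open>small\<close>. One additional factor f
  makes the inequality strict for every Frobenius power, and tight closure removes it.\<close>

lemma f_pow_mem_frob_Mq:
  assumes "p ^ k \<le> a * s"
  shows "f [^] a \<in> frobenius_pow R Mq (p ^ k)"
proof (rule mem_if_frobenius_multiples[OF frobenius_pow_ideal[OF Mq_ideal] _ f_closed])
  show "f \<noteq> \<zero>" using f_pow_nonzero[of 1] f_closed by simp
  show "f [^] a \<in> carrier R" using f_closed by simp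
  fix l
  have "f [^] (a * p ^ l + 1) \<in> ideal_pow R \<aa> (a * p ^ l + 1)" by (rule pow_mem_ideal_pow[OF f_a])
  moreover have "p ^ (e + k + l) < d * (a * p ^ l + 1)"
  proof -
    have "p ^ (e + k + l) = q * (p ^ k * p ^ l)" unfolding q_eq by (simp add: power_add)
    also have "\<dots> \<le> q * ((a * s) * p ^ l)" using assms by simp
    also have "\<dots> < q * ((a * s) * p ^ l) + q * s" using q_pos s_pos by simp
    also have "\<dots> = d * (a * p ^ l + 1)" unfolding d_eq by (simp add: algebra_simps)
    finally show ?thesis .
  qed
  ultimately have "f [^] (a * p ^ l + 1) \<in> frobenius_pow R \<mm> (p ^ (e + k + l))" using small by blast
  moreover have "f \<otimes> (f [^] a) [^] (p ^ l) = f [^] (a * p ^ l + 1)"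
    using f_closed by (simp add: nat_pow_pow m_comm)
  ultimately show "f \<otimes> (f [^] a) [^] (p ^ l) \<in> frobenius_pow R (frobenius_pow R Mq (p ^ k)) (p ^ l)"
    by (simp add: frob_frob[OF max_ideal] frob_Mq add.assoc)
qed

text \<open>The c-th power of the previous membership, with a defect: the number of factors f needed
  for each factor of Mq must be rounded up. The loss is at most c factors whatever l is, so the
  multiplier f^c absorbs it.\<close>

lemma f_pow_mem_frob_Mq_pow:
  assumes "c * p ^ k \<le> a * s"
  shows "f [^] a \<in> frobenius_pow R (ideal_pow R Mq c) (p ^ k)"
proof (rule mem_if_frobenius_multiples[OF frobenius_pow_ideal[OF ideal_pow_ideal[OF Mq_ideal]]])
  show "f [^] c \<noteq> \<zero>" by (rule f_pow_nonzero)
  show "f [^] a \<in> carrier R" "f [^] c \<in> carrier R" using f_closed by auto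
  fix l
  define n where "n = p ^ (k + l)"
  \<comment> \<open>The quotient n / s rounded up.\<close>
  define w where "w = (n + s - 1) div s"
  have w: "n \<le> w * s" "w * s \<le> n + s"
  proof -
    have "w * s + (n + s - 1) mod s = n + s - 1" unfolding w_def by simp
    moreover have "(n + s - 1) mod s < s" using s_pos by simp
    ultimately show "n \<le> w * s" "w * s \<le> n + s" using s_pos by linarith+
  qed
  have "f [^] w \<in> frobenius_pow R Mq (p ^ (k + l))" using w(1) by (intro f_pow_mem_frob_Mq) (simp add: n_def)
  then have mem: "(f [^] w) [^] c \<in> frobenius_pow R (ideal_pow R Mq c) (p ^ (k + l))"
    by (rule pow_mem_frobenius_ideal_pow[OF Mq_ideal])
  have "(w * c) * s \<le> (c + a * p ^ l) * s"
  proof -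
    have "(w * c) * s = (w * s) * c" by simp
    also have "\<dots> \<le> (n + s) * c" using w(2) by (rule mult_le_mono1)
    also have "\<dots> = (c * p ^ k) * p ^ l + c * s" unfolding n_def by (simp add: power_add algebra_simps)
    also have "\<dots> \<le> (a * s) * p ^ l + c * s" using assms by simp
    also have "\<dots> = (c + a * p ^ l) * s" by (simp add: algebra_simps)
    finally show ?thesis .
  qed
  then have "w * c \<le> c + a * p ^ l" using s_pos by simp
  then have "f [^] (c + a * p ^ l) \<in> frobenius_pow R (ideal_pow R Mq c) (p ^ (k + l))"
    using pow_mem_ideal[OF frobenius_pow_ideal[OF ideal_pow_ideal[OF Mq_ideal]] f_closed, of "w * c"] mem f_closed
    by (simp add: nat_pow_pow)
  moreover have "f [^] c \<otimes> (f [^] a) [^] (p ^ l) = f [^] (c + a * p ^ l)"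
    using f_closed by (simp add: nat_pow_pow nat_pow_mult)
  ultimately show "f [^] c \<otimes> (f [^] a) [^] (p ^ l) \<in> frobenius_pow R (frobenius_pow R (ideal_pow R Mq c) (p ^ k)) (p ^ l)"
    by (simp add: frob_frob[OF ideal_pow_ideal[OF Mq_ideal]])
qed

lemma Mq_pow_subset:
  assumes x: "x \<in> X0"
  shows "ideal_pow R Mq c \<subseteq> coord_box q x <+> PIdl (x [^] (q * c))"
proof -
  have xq: "x [^] q \<in> carrier R" by (rule params_pow_closed[OF x])
  have "Mq = coord_box q x <+> PIdl (x [^] q)" unfolding q_eq by (rule frob_max_eq[OF x])
  then have "ideal_pow R Mq c \<subseteq> ideal_pow R (coord_box q x) (Suc 0) <+> ideal_pow R (PIdl (x [^] q)) c"
    using ideal_pow_add_subset[OF coord_box_ideal cgenideal_ideal[OF xq], of q x 0 c] by simp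
  also have "\<dots> \<subseteq> coord_box q x <+> PIdl (x [^] (q * c))"
  proof (rule set_add_mono)
    show "ideal_pow R (coord_box q x) (Suc 0) \<subseteq> coord_box q x"
      using ideal_pow_1[OF coord_box_ideal[of q x]] by (simp only: One_nat_def subset_refl)
    show "ideal_pow R (PIdl (x [^] q)) c \<subseteq> PIdl (x [^] (q * c))"
      using PIdl_pow_subset[OF xq, of c] x params_carrier by (simp add: nat_pow_pow subset_iff)
  qed
  finally show ?thesis .
qed

lemma f_cong_param_pow:
  assumes x: "x \<in> X0"
  obtains u where "u \<in> carrier R" "ideal_cong (coord_box q x) f (u \<otimes> x [^] d)"
proof -
  \<comment> \<open>The case a = 1, c = s without Frobenius: f lies in the s-th power of Mq.\<close>
  have "f [^] (1::nat) \<in> frobenius_pow R (ideal_pow R Mq s) (p ^ 0)"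
    by (rule f_pow_mem_frob_Mq_pow) simp
  then have "f \<in> ideal_pow R Mq s"
    using frobenius_pow_1[OF ideal_pow_ideal[OF Mq_ideal], of s] f_closed by simp
  then have "f \<in> coord_box q x <+> PIdl (x [^] d)" using Mq_pow_subset[OF x] d_eq by auto
  then show ?thesis using that add_PIdl_cong_iff[OF coord_box_ideal params_pow_closed[OF x]] by auto
qed

lemma f_frob_cong:
  assumes x: "x \<in> X0" and u: "u \<in> carrier R" "ideal_cong (coord_box q x) f (u \<otimes> x [^] d)"
  shows "ideal_cong (coord_box (q * p ^ k) x) (f [^] (p ^ k)) (u [^] (p ^ k) \<otimes> x [^] (d * p ^ k))"
proof -
  have "(u \<otimes> x [^] d) [^] (p ^ k) = u [^] (p ^ k) \<otimes> x [^] (d * p ^ k)"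
    using u x params_carrier params_pow_closed[OF x, of d] by (auto simp: nat_pow_distrib nat_pow_pow)
  then show ?thesis using frob_cong[OF coord_box_ideal u(2), of k] by (simp add: frob_coord_box)
qed

text \<open>Write \<open>f\<^sup>r\<^sup>+\<^sup>1 = \<Sum> A\<^sub>x x\<^sup>q\<^sup>Q\<close> where \<open>Q = p\<^sup>k = s r + 1\<close>. If the coefficient of \<open>x\<^sup>d\<close> in \<open>f\<close> is in
  \<open>\<mm>\<close> then \<open>A\<^sub>x\<^sup>s \<in> \<mm>\<^sup>[\<^sup>Q\<^sup>]\<close>; if this holds for all \<open>x\<close>, then the order of a power of
  \<open>f\<^sup>r\<^sup>+\<^sup>1\<close> is too large.\<close>

lemma exists_param_unit_coeff:
  obtains x u where "x \<in> X0" "u \<in> carrier R" "u \<notin> \<mm>" "ideal_cong (coord_box q x) f (u \<otimes> x [^] d)"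
proof (rule ccontr)
  assume "\<not> thesis"
  then have contra: "u \<in> \<mm>" if "x \<in> X0" "u \<in> carrier R" "ideal_cong (coord_box q x) f (u \<otimes> x [^] d)" for x u
    using that \<open>\<And>u x. x \<in> X0 \<Longrightarrow> u \<in> carrier R \<Longrightarrow> u \<notin> \<mm> \<Longrightarrow> ideal_cong (coord_box q x) f (u \<otimes> x [^] d) \<Longrightarrow> thesis\<close>
    by blast
  \<comment> \<open>Large enough that, by pigeonhole, the N-th power of the ideal of the
    coefficients lies in \<mm>^[p^k] once their s-th powers do. It is fixed before k, so that p^k
    can outgrow q (s - 1) N.\<close>
  define N where "N = card X0 * s + 1"
  obtain k r where kr: "Suc (q * (s - 1) * N) \<le> k" "p ^ k = s * r + 1"
    by (rule exists_power_cong_one[OF s_coprime s_pos p_gt_1])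
  have pk: "q * (s - 1) * N < p ^ k" using kr(1) power_gt_expt[of p k] p_gt_1 by simp
  let ?n = "p ^ (e + k)"
  have n: "?n = q * p ^ k" unfolding q_eq by (simp add: power_add)
  let ?h = "\<lambda>x. x [^] ?n"
  define m where "m = r + 1"
  have exp: "m * s = (s - 1) + p ^ k" using kr(2) s_pos by (simp add: m_def algebra_simps)
  have "f [^] m \<in> frobenius_pow R Mq (p ^ k)" by (rule f_pow_mem_frob_Mq) (simp add: exp)
  then have "f [^] m \<in> frobenius_pow R \<mm> (p ^ (e + k))" unfolding frob_Mq .
  then obtain A where A: "A \<in> X0 \<rightarrow> carrier R" "f [^] m = (\<Oplus>x\<in>X0. A x \<otimes> ?h x)"
    "\<And>x. x \<in> X0 \<Longrightarrow> ideal_cong (coord_box ?n x) (f [^] m) (A x \<otimes> ?h x)"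
    by (rule frob_max_coefficients) (rule that)
  have As: "A x [^] s \<in> frobenius_pow R \<mm> (p ^ k)" if x: "x \<in> X0" for x
  proof -
    let ?D = "coord_box (q * p ^ k) x"
    note iD = coord_box_ideal[of "q * p ^ k" x]
    have Ax: "A x \<in> carrier R" and xc: "x \<in> carrier R" using A(1) x params_carrier by auto
    obtain u where u: "u \<in> carrier R" "ideal_cong (coord_box q x) f (u \<otimes> x [^] d)"
      by (rule f_cong_param_pow[OF x])
    have um: "u \<in> \<mm>" by (rule contra[OF x u])
    have "ideal_cong ?D (f [^] m) (A x \<otimes> ?h x)" using A(3)[OF x] unfolding n .
    from ideal_cong_pow[OF iD this, of s]
    have 1: "ideal_cong ?D (f [^] (m * s)) (A x [^] s \<otimes> x [^] (d * p ^ k))"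
      using f_closed Ax xc unfolding n d_eq by (simp add: nat_pow_distrib nat_pow_pow mult_ac)
    have "f [^] (m * s) = f [^] (s - 1) \<otimes> f [^] (p ^ k)" unfolding exp using f_closed by (simp add: nat_pow_mult)
    moreover have "ideal_cong ?D (f [^] (s - 1) \<otimes> f [^] (p ^ k)) (f [^] (s - 1) \<otimes> (u [^] (p ^ k) \<otimes> x [^] (d * p ^ k)))"
      using f_closed by (intro ideal_cong_mult[OF iD] ideal_cong_refl iD f_frob_cong x u) auto
    ultimately have 2: "ideal_cong ?D (f [^] (m * s)) (f [^] (s - 1) \<otimes> (u [^] (p ^ k) \<otimes> x [^] (d * p ^ k)))"
      by simp
    \<comment> \<open>Both expressions for f^(m s) carry the same power of x; cancelling it leaves
      A_x^s congruent to f^(s-1) u^(p^k), and u is in \<mm>.\<close>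
    have "ideal_cong ?D (f [^] (s - 1) \<otimes> (u [^] (p ^ k) \<otimes> x [^] (d * p ^ k))) (A x [^] s \<otimes> x [^] (d * p ^ k))"
      by (rule ideal_cong_trans[OF iD ideal_cong_sym[OF iD 2] 1])
    then have "ideal_cong ?D ((f [^] (s - 1) \<otimes> u [^] (p ^ k)) \<otimes> x [^] (d * p ^ k)) (A x [^] s \<otimes> x [^] (d * p ^ k))"
      using f_closed u xc by (simp add: m_assoc)
    then have cong: "ideal_cong ?D (f [^] (s - 1) \<otimes> u [^] (p ^ k)) (A x [^] s)"
      by (rule coord_box_cancel[OF x, rotated 2]) (use f_closed u Ax in auto)
    have "?D \<subseteq> frobenius_pow R Mq (p ^ k)"
      using coord_box_subset_frob_max[of "e + k" x] n frob_Mq by simp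
    also have "\<dots> \<subseteq> frobenius_pow R \<mm> (p ^ k)"
      using frobenius_pow_mono[OF max_ideal frobenius_max_subset_max[of e]] q_eq by simp
    finally have sub: "?D \<subseteq> frobenius_pow R \<mm> (p ^ k)" .
    have "f [^] (s - 1) \<otimes> u [^] (p ^ k) \<in> frobenius_pow R \<mm> (p ^ k)"
      using f_closed by (intro ideal.I_l_closed[OF frobenius_pow_ideal[OF max_ideal]] pow_mem_frobenius_pow max_ideal um) auto
    then show ?thesis
      using ideal_cong_mem_iff[OF frobenius_pow_ideal[OF max_ideal] ideal_cong_mono[OF cong sub]] by blast
  qed
  define \<AA> where "\<AA> = Idl (A ` X0)"
  have Ac: "A ` X0 \<subseteq> carrier R" using A(1) by auto
  have iA: "ideal \<AA> R" unfolding \<AA>_def by (rule genideal_ideal[OF Ac])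
  let ?M = "frobenius_pow R \<mm> ?n"
  have iM: "ideal ?M R" by (rule frobenius_pow_ideal[OF max_ideal])
  have iF: "ideal (frobenius_pow R \<mm> (p ^ k)) R" by (rule frobenius_pow_ideal[OF max_ideal])
  have "(\<Sum>y\<in>A ` X0. s - 1) + 1 \<le> N"
  proof -
    have "card (A ` X0) * (s - 1) \<le> card X0 * s" using card_image_le[OF finite_params] by (intro mult_le_mono) auto
    then show ?thesis unfolding N_def by simp
  qed
  note le = this
  have "ideal_pow R \<AA> ((\<Sum>y\<in>A ` X0. s - 1) + 1) \<subseteq> frobenius_pow R \<mm> (p ^ k)"
    unfolding \<AA>_def by (rule Idl_pow_subset_if_gens) (use As finite_params Ac iF in auto)
  then have AN: "ideal_pow R \<AA> N \<subseteq> frobenius_pow R \<mm> (p ^ k)"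
    using ideal_pow_antimono[OF iA le] by blast
  have "f [^] m \<in> \<AA> \<cdot> ?M"
    unfolding A(2)
  proof (rule ideal_finsum_closed[OF ideal_prod_is_ideal[OF iA iM] finite_params])
    fix x assume x: "x \<in> X0"
    show "A x \<otimes> ?h x \<in> \<AA> \<cdot> ?M"
      using genideal_self[OF Ac] x params_subset_max unfolding \<AA>_def
      by (intro ideal_prod.prod pow_mem_frobenius_pow[OF max_ideal]) auto
  qed
  then have "(f [^] m) [^] N \<in> ideal_pow R (\<AA> \<cdot> ?M) N" by (rule pow_mem_ideal_pow)
  also have "\<dots> = ideal_pow R \<AA> N \<cdot> ideal_pow R ?M N" by (rule ideal_pow_prod[OF iA iM])
  also have "\<dots> \<subseteq> ideal_pow R \<mm> (p ^ k) \<cdot> ideal_pow R (ideal_pow R \<mm> ?n) N"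
    using AN frobenius_max_subset by (intro ideal_prod_mono ideal_pow_mono) blast+
  also have "\<dots> = ideal_pow R \<mm> (p ^ k + ?n * N)" by (simp add: ideal_pow_mult[OF max_ideal] ideal_pow_add[OF max_ideal])
  also have "\<dots> \<subseteq> ideal_pow R \<mm> (Suc (d * (m * N)))"
  proof (rule ideal_pow_antimono[OF max_ideal])
    \<comment> \<open>The true order of f^(m N) exceeds q p^k N by q (s - 1) N only, while the
      coefficients contribute p^k.\<close>
    have "d * (m * N) = q * (m * s) * N" unfolding d_eq by simp
    also have "\<dots> = q * (s - 1) * N + ?n * N" unfolding exp n by (simp add: algebra_simps)
    finally show "Suc (d * (m * N)) \<le> p ^ k + ?n * N" using pk by linarith
  qed
  finally have "f [^] (m * N) \<in> ideal_pow R \<mm> (Suc (d * (m * N)))"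
    using f_closed by (simp add: nat_pow_pow)
  then show False using pow_notin_max_pow[OF f_ord] by blast
qed

end

section \<open>Approximate roots of f, and an exact one\<close>

context small_fpt
begin

text \<open>\<open>f\<close> is, up to a fixed unit, an \<open>s\<close>-th power modulo \<open>\<mm>\<^sup>[\<^sup>Q\<^sup>]\<close> for all large \<open>Q\<close>: compare
  \<open>f\<^sup>a \<equiv> A x\<^sup>q\<^sup>(\<^sup>s\<^sup>-\<^sup>1\<^sup>)\<^sup>Q\<close>, where \<open>a s = (s - 1) Q + 1\<close>, with \<open>f\<^sup>a\<^sup>s = f (f\<^sup>Q)\<^sup>s\<^sup>-\<^sup>1\<close>.\<close>

lemma f_cong_unit_mult_pow:
  assumes x: "x \<in> X0" and u: "u \<in> carrier R" "u \<notin> \<mm>" "ideal_cong (coord_box q x) f (u \<otimes> x [^] d)"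
    and k: "p ^ k = s * r + 1"
  obtains A where "A \<in> carrier R" "ideal_cong (frobenius_pow R \<mm> (p ^ (e + k))) f (u \<otimes> A [^] s)"
proof -
  define D where "D = coord_box (q * p ^ k) x"
  have iD: "ideal D R" unfolding D_def by (rule coord_box_ideal)
  have xc: "x \<in> carrier R" using x params_carrier by auto
  \<comment> \<open>Chosen so that f^(a s) contains exactly one factor f besides the (s - 1)-th
    power of f^(p^k).\<close>
  define a where "a = (s - 1) * r + 1"
  have as: "a * s = (s - 1) * p ^ k + 1"
    using s_pos unfolding a_def k by (cases s) (simp_all add: algebra_simps)
  have "f [^] a \<in> frobenius_pow R (ideal_pow R Mq (s - 1)) (p ^ k)"
    by (rule f_pow_mem_frob_Mq_pow) (simp add: as)
  also have "\<dots> \<subseteq> frobenius_pow R (coord_box q x <+> PIdl (x [^] (q * (s - 1)))) (p ^ k)"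
    by (intro frobenius_pow_mono Mq_pow_subset x add_ideals coord_box_ideal cgenideal_ideal params_pow_closed)
  also have "\<dots> \<subseteq> frobenius_pow R (coord_box q x) (p ^ k) <+> frobenius_pow R (PIdl (x [^] (q * (s - 1)))) (p ^ k)"
    by (intro frobenius_pow_add_subset x coord_box_ideal cgenideal_ideal params_pow_closed)
  also have "\<dots> = D <+> PIdl (x [^] (q * (s - 1) * p ^ k))"
    unfolding frob_coord_box D_def frobenius_pow_PIdl[OF params_pow_closed[OF x]] using xc by (simp add: nat_pow_pow)
  finally obtain A where A: "A \<in> carrier R" "ideal_cong D (f [^] a) (A \<otimes> x [^] (q * (s - 1) * p ^ k))"
    using add_PIdl_cong_iff[OF iD params_pow_closed[OF x]] by auto
  define n where "n = d * p ^ k * (s - 1)"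
  have xn: "(x [^] (q * (s - 1) * p ^ k)) [^] s = x [^] n" "(x [^] (d * p ^ k)) [^] (s - 1) = x [^] n"
    unfolding n_def d_eq using xc by (simp_all add: nat_pow_pow mult_ac)
  have 1: "ideal_cong D (f [^] (a * s)) (A [^] s \<otimes> x [^] n)"
  proof -
    have "(A \<otimes> x [^] (q * (s - 1) * p ^ k)) [^] s = A [^] s \<otimes> x [^] n"
      unfolding xn(1)[symmetric] using A(1) xc by (simp add: nat_pow_distrib)
    then show ?thesis using ideal_cong_pow[OF iD A(2), of s] f_closed by (simp only: nat_pow_pow)
  qed
  define w where "w = (u [^] (p ^ k)) [^] (s - 1)"
  have wc: "w \<in> carrier R" unfolding w_def using u by simp
  have "ideal_cong D ((f [^] (p ^ k)) [^] (s - 1)) ((u [^] (p ^ k) \<otimes> x [^] (d * p ^ k)) [^] (s - 1))"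
    unfolding D_def by (rule ideal_cong_pow[OF coord_box_ideal f_frob_cong[OF x u(1,3)]])
  also have "(u [^] (p ^ k) \<otimes> x [^] (d * p ^ k)) [^] (s - 1) = w \<otimes> x [^] n"
    unfolding w_def xn(2)[symmetric] using u xc by (simp add: nat_pow_distrib)
  finally have "ideal_cong D (f \<otimes> (f [^] (p ^ k)) [^] (s - 1)) (f \<otimes> (w \<otimes> x [^] n))"
    by (intro ideal_cong_mult[OF iD] ideal_cong_refl iD f_closed)
  moreover have "f \<otimes> (f [^] (p ^ k)) [^] (s - 1) = f [^] (a * s)"
    unfolding as using f_closed by (simp add: nat_pow_pow m_comm mult.commute)
  ultimately have 2: "ideal_cong D (f [^] (a * s)) ((f \<otimes> w) \<otimes> x [^] n)"
    using f_closed wc xc by (simp add: m_assoc)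
  have "ideal_cong D ((f \<otimes> w) \<otimes> x [^] n) (A [^] s \<otimes> x [^] n)"
    by (rule ideal_cong_trans[OF iD ideal_cong_sym[OF iD 2] 1])
  then have cong: "ideal_cong D (f \<otimes> w) (A [^] s)"
    unfolding D_def by (rule coord_box_cancel[OF x, rotated 2]) (use f_closed wc A in auto)
  have uU: "u \<in> Units R" by (rule unit_if_notin_max[OF u(1,2)])
  define v where "v = inv u"
  have v: "v \<in> carrier R" "u \<otimes> v = \<one>" using uU v_def by auto
  \<comment> \<open>Hence 1/w is u times the s-th power of u^(-a), and dividing by w leaves only the
    factor u itself, the same for all k.\<close>
  have uw: "u \<otimes> w = u [^] (a * s)"
    unfolding as w_def using u by (simp add: nat_pow_pow m_comm mult.commute)
  have "ideal_cong D ((f \<otimes> w) \<otimes> (u \<otimes> v [^] (a * s))) (A [^] s \<otimes> (u \<otimes> v [^] (a * s)))"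
    using u v by (intro ideal_cong_mult[OF iD cong] ideal_cong_refl iD) auto
  moreover have "(f \<otimes> w) \<otimes> (u \<otimes> v [^] (a * s)) = f"
  proof -
    have "(f \<otimes> w) \<otimes> (u \<otimes> v [^] (a * s)) = f \<otimes> ((u \<otimes> w) \<otimes> v [^] (a * s))"
      using f_closed wc u v by (simp add: m_ac)
    also have "(u \<otimes> w) \<otimes> v [^] (a * s) = (u \<otimes> v) [^] (a * s)" unfolding uw using u(1) v(1) by (simp add: nat_pow_distrib)
    finally show ?thesis using v f_closed by simp
  qed
  moreover have "A [^] s \<otimes> (u \<otimes> v [^] (a * s)) = u \<otimes> (A \<otimes> v [^] a) [^] s"
    using A u v by (simp add: nat_pow_distrib nat_pow_pow m_ac)
  ultimately have "ideal_cong D f (u \<otimes> (A \<otimes> v [^] a) [^] s)" by simp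
  moreover have "D \<subseteq> frobenius_pow R \<mm> (p ^ (e + k))"
    using coord_box_subset_frob_max[of "e + k" x] by (simp add: D_def q_eq power_add)
  ultimately have "ideal_cong (frobenius_pow R \<mm> (p ^ (e + k))) f (u \<otimes> (A \<otimes> v [^] a) [^] s)"
    by (rule ideal_cong_mono)
  then show ?thesis using A v by (intro that[of "A \<otimes> v [^] a"]) auto
qed

text \<open>\<open>J\<close> is the smallest ideal with \<open>f\<^sup>r\<^sup>+\<^sup>1 \<in> J\<^sup>[\<^sup>P\<^sup>]\<close> for a fixed large \<open>P = s r + 1\<close>. The previous
  lemma puts \<open>J\<close> into \<open>(A) + \<mm>\<^sup>n\<close> for all \<open>n\<close>, with \<open>A\<close> depending on \<open>n\<close>.\<close>

lemma exists_root_ideal: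
  obtains J u where "ideal J R" "J \<subseteq> Mq" "f \<in> ideal_pow R J s" "u \<in> carrier R" "u \<notin> \<mm>"
    and "\<forall>n. \<exists>A\<in>carrier R. J \<subseteq> ideal_pow R \<mm> n <+> PIdl A \<and> ideal_cong (ideal_pow R \<mm> n) f (u \<otimes> A [^] s)"
proof -
  obtain x u where x: "x \<in> X0" and u: "u \<in> carrier R" "u \<notin> \<mm>" "ideal_cong (coord_box q x) f (u \<otimes> x [^] d)"
    by (rule exists_param_unit_coeff)
  \<comment> \<open>The bound on k0 keeps f^(s-1) outside \<mm>^[p^k0]. This one exponent then
    suffices to deduce that f lies in J^s.\<close>
  obtain k0 r0 where k0: "Suc (d * (s - 1)) \<le> k0" "p ^ k0 = s * r0 + 1"
    by (rule exists_power_cong_one[OF s_coprime s_pos p_gt_1])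
  define m where "m = r0 + 1"
  have ms: "m * s = (s - 1) + p ^ k0" using k0(2) s_pos by (simp add: m_def algebra_simps)
  define F where "F = {L. ideal L R \<and> f [^] m \<in> frobenius_pow R L (p ^ k0)}"
  have MqF: "Mq \<in> F" unfolding F_def using Mq_ideal f_pow_mem_frob_Mq[of k0 m] ms by simp
  have iL: "ideal L R" if "L \<in> F" for L using that F_def by auto
  define J where "J = \<Inter>F"
  have F0: "F \<noteq> {}" using MqF by auto
  have iJ: "ideal J R" unfolding J_def by (rule i_Intersect[OF iL F0])
  have fmJ: "f [^] m \<in> frobenius_pow R J (p ^ k0)"
    unfolding J_def by (rule frobenius_pow_Inter[OF F0 iL]) (auto simp: F_def)
  have fJs: "f \<in> ideal_pow R J s"
  proof (rule mem_if_frobenius_multiple[OF ideal_pow_ideal[OF iJ] f_closed])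
    show "f [^] (s - 1) \<in> carrier R" using f_closed by simp
    have "(f [^] m) [^] s \<in> frobenius_pow R (ideal_pow R J s) (p ^ k0)"
      by (rule pow_mem_frobenius_ideal_pow[OF iJ fmJ])
    moreover have "(f [^] m) [^] s = f [^] (s - 1) \<otimes> f [^] (p ^ k0)"
      using f_closed ms by (simp add: nat_pow_pow nat_pow_mult)
    ultimately show "f [^] (s - 1) \<otimes> f [^] (p ^ k0) \<in> frobenius_pow R (ideal_pow R J s) (p ^ k0)" by simp
    show "f [^] (s - 1) \<notin> frobenius_pow R \<mm> (p ^ k0)"
      using frobenius_max_subset_pow[OF k0(1)] pow_notin_max_pow[OF f_ord, of "s - 1"] by blast
  qed
  have approx: "\<exists>A\<in>carrier R. J \<subseteq> ideal_pow R \<mm> n <+> PIdl A \<and> ideal_cong (ideal_pow R \<mm> n) f (u \<otimes> A [^] s)" for n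
  proof -
    obtain k1 r1 where k1: "n \<le> k1" "p ^ k1 = s * r1 + 1"
      by (rule exists_power_cong_one[OF s_coprime s_pos p_gt_1])
    \<comment> \<open>Numbers congruent to 1 modulo s are closed under products, so the
      approximation lemma applies to the exponent k0 + k1 as well.\<close>
    have "p ^ (k0 + k1) = s * (s * r0 * r1 + r0 + r1) + 1"
      unfolding power_add k0(2) k1(2) by (simp add: algebra_simps)
    then obtain A where A: "A \<in> carrier R" "ideal_cong (frobenius_pow R \<mm> (p ^ (e + (k0 + k1)))) f (u \<otimes> A [^] s)"
      by (rule f_cong_unit_mult_pow[OF x u])
    note iA = cgenideal_ideal[OF A(1)]
    let ?M1 = "frobenius_pow R \<mm> (p ^ k1)"
    have iM1: "ideal ?M1 R" by (rule frobenius_pow_ideal[OF max_ideal])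
    \<comment> \<open>L competes in the family whose intersection is J: f^m is congruent to a
      multiple of A^(m s), and m s is at least p^k0.\<close>
    define L where "L = ?M1 <+> PIdl A"
    have iL: "ideal L R" unfolding L_def by (rule add_ideals[OF iM1 iA])
    have L: "?M1 \<subseteq> L" "PIdl A \<subseteq> L" unfolding L_def by (rule subset_set_add[OF iM1 iA])+
    have AL: "A \<in> L" using L(2) cgenideal_self[OF A(1)] by blast
    have iFL: "ideal (frobenius_pow R L (p ^ k0)) R" by (rule frobenius_pow_ideal[OF iL])
    have "frobenius_pow R \<mm> (p ^ (e + (k0 + k1))) = frobenius_pow R (frobenius_pow R \<mm> (p ^ e)) (p ^ (k1 + k0))"
      by (simp add: frob_frob[OF max_ideal] add.commute)
    also have "\<dots> \<subseteq> frobenius_pow R \<mm> (p ^ (k1 + k0))"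
      by (rule frobenius_pow_mono[OF max_ideal frobenius_max_subset_max])
    finally have sub1: "frobenius_pow R \<mm> (p ^ (e + (k0 + k1))) \<subseteq> frobenius_pow R \<mm> (p ^ (k1 + k0))" .
    have "frobenius_pow R \<mm> (p ^ (k1 + k0)) = frobenius_pow R ?M1 (p ^ k0)" by (simp add: frob_frob[OF max_ideal])
    also have "\<dots> \<subseteq> frobenius_pow R L (p ^ k0)" by (rule frobenius_pow_mono[OF iL L(1)])
    finally have "ideal_cong (frobenius_pow R L (p ^ k0)) f (u \<otimes> A [^] s)"
      using ideal_cong_mono[OF A(2)] sub1 by blast
    from ideal_cong_pow[OF iFL this, of m]
    have cong: "ideal_cong (frobenius_pow R L (p ^ k0)) (f [^] m) (u [^] m \<otimes> A [^] (m * s))"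
      using u A(1) by (simp add: nat_pow_distrib nat_pow_pow mult.commute)
    have "A [^] (m * s) \<in> frobenius_pow R L (p ^ k0)"
      using ms by (intro pow_mem_ideal[OF iFL A(1) pow_mem_frobenius_pow[OF iL AL]]) simp
    then have "f [^] m \<in> frobenius_pow R L (p ^ k0)"
      using ideal_cong_mem_iff[OF iFL cong] ideal.I_l_closed[OF iFL] u by auto
    then have "J \<subseteq> L" unfolding J_def F_def using iL by auto
    also have "L \<subseteq> ideal_pow R \<mm> n <+> PIdl A"
      unfolding L_def using frobenius_max_subset_pow[OF k1(1)] by (intro set_add_mono) auto
    finally have "J \<subseteq> ideal_pow R \<mm> n <+> PIdl A" .
    moreover have "ideal_cong (ideal_pow R \<mm> n) f (u \<otimes> A [^] s)"
      using k1(1) by (intro ideal_cong_mono[OF A(2)] frobenius_max_subset_pow) simp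
    ultimately show ?thesis using A(1) by blast
  qed
  show ?thesis
    by (rule that[OF iJ _ fJs u(1,2)]) (use MqF J_def approx in auto)
qed

text \<open>Modulo \<mm>^n the ideal J is contained in (A), and some generator j of J must be a unit
  times A, for otherwise J would be too small for f to lie in J^s. So J is inside (j) + \<mm>^n. As
  there are finitely many generators, one of them works for all n, and Krull's intersection theorem
  finishes.\<close>

lemma root_ideal_principal:
  assumes J: "ideal J R" "f \<in> ideal_pow R J s" and u: "u \<in> carrier R" "u \<notin> \<mm>"
    and approx: "\<forall>n. \<exists>A\<in>carrier R. J \<subseteq> ideal_pow R \<mm> n <+> PIdl A \<and> ideal_cong (ideal_pow R \<mm> n) f (u \<otimes> A [^] s)"
  obtains j where "j \<in> J" "J \<subseteq> PIdl j"
proof -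
  obtain G where G: "G \<subseteq> carrier R" "finite G" "J = Idl G" using finetely_gen[OF J(1)] by auto
  have GJ: "G \<subseteq> J" using G genideal_self by auto
  have im: "ideal (ideal_pow R \<mm> n) R" for n by (rule ideal_pow_ideal[OF max_ideal])
  have "\<exists>j\<in>G. J \<subseteq> PIdl j"
  proof (rule ccontr)
    assume no: "\<not> ?thesis"
    have "\<exists>n. \<not> J \<subseteq> PIdl j <+> ideal_pow R \<mm> n" if j: "j \<in> G" for j
    proof (rule ccontr)
      assume "\<nexists>n. \<not> J \<subseteq> PIdl j <+> ideal_pow R \<mm> n"
      then have sub: "J \<subseteq> PIdl j <+> ideal_pow R \<mm> n" for n by blast
      have jc: "j \<in> carrier R" using j G by auto
      have "J \<subseteq> PIdl j"
      proof
        fix y assume y: "y \<in> J"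
        show "y \<in> PIdl j"
          by (rule Krull_intersection[OF cgenideal_ideal[OF jc] ideal.Icarr[OF J(1) y]]) (use sub y in blast)
      qed
      then show False using no j by blast
    qed
    then obtain N where N: "\<And>j. j \<in> G \<Longrightarrow> \<not> J \<subseteq> PIdl j <+> ideal_pow R \<mm> (N j)" by metis
    \<comment> \<open>It dominates the failure exponents of all generators at once, and it exceeds d
      so that f is outside \<mm>^n.\<close>
    define n where "n = Suc d + Max (insert 0 (N ` G))"
    have nN: "N j \<le> n" if "j \<in> G" for j
    proof -
      have "N j \<le> Max (insert 0 (N ` G))" by (rule Max_ge) (use that G(2) in auto)
      then show ?thesis unfolding n_def by linarith
    qed
    obtain A where A: "A \<in> carrier R" "J \<subseteq> ideal_pow R \<mm> n <+> PIdl A" "ideal_cong (ideal_pow R \<mm> n) f (u \<otimes> A [^] s)"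
      using approx by blast
    note iA = cgenideal_ideal[OF A(1)]
    have imA: "ideal (\<mm> \<cdot> (PIdl A)) R" by (rule ideal_prod_is_ideal[OF max_ideal iA])
    define W where "W = ideal_pow R \<mm> n <+> \<mm> \<cdot> (PIdl A)"
    have iW: "ideal W R" unfolding W_def by (rule add_ideals[OF im imA])
    \<comment> \<open>If J lay in \<mm>^n + \<mm> A, its s-th power would lie in \<mm>^n + \<mm>
      A^s. Since A^s is f up to a unit modulo \<mm>^n, Nakayama's lemma would put f into
      \<mm>^n.\<close>
    have "\<exists>j\<in>G. j \<notin> W"
    proof (rule ccontr)
      assume "\<not> (\<exists>j\<in>G. j \<notin> W)"
      then have "G \<subseteq> W" by blast
      then have JW: "J \<subseteq> W" unfolding G(3) by (rule genideal_minimal[OF iW])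
      have As: "A [^] s \<in> carrier R" using A(1) by simp
      note iAs = cgenideal_ideal[OF As]
      have "f \<in> ideal_pow R W s" using J(2) ideal_pow_mono[OF JW] by blast
      also have "\<dots> \<subseteq> ideal_pow R (ideal_pow R \<mm> n) (Suc 0) <+> ideal_pow R (\<mm> \<cdot> (PIdl A)) s"
        unfolding W_def using ideal_pow_add_subset[OF im imA, of n 0 s] by simp
      also have "ideal_pow R (ideal_pow R \<mm> n) (Suc 0) = ideal_pow R \<mm> n"
        using ideal_pow_1[OF im] by (simp only: One_nat_def)
      finally have f1: "f \<in> ideal_pow R \<mm> n <+> ideal_pow R (\<mm> \<cdot> (PIdl A)) s" .
      have "ideal_pow R (\<mm> \<cdot> (PIdl A)) s = ideal_pow R \<mm> s \<cdot> ideal_pow R (PIdl A) s"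
        by (rule ideal_pow_prod[OF max_ideal iA])
      also have "\<dots> \<subseteq> \<mm> \<cdot> (PIdl (A [^] s))"
      proof (rule ideal_prod_mono)
        show "ideal_pow R \<mm> s \<subseteq> \<mm>"
          using ideal_pow_antimono[OF max_ideal, of 1 s] ideal_pow_1[OF max_ideal] s_pos by (simp only: Suc_leI One_nat_def)
        show "ideal_pow R (PIdl A) s \<subseteq> PIdl (A [^] s)" by (rule PIdl_pow_subset[OF A(1)])
      qed
      finally have f2: "f \<in> ideal_pow R \<mm> n <+> \<mm> \<cdot> (PIdl (A [^] s))" using f1 set_add_mono by blast
      note iF = cgenideal_ideal[OF f_closed]
      have imF: "ideal (\<mm> \<cdot> (PIdl f)) R" by (rule ideal_prod_is_ideal[OF max_ideal iF])
      have iT: "ideal (ideal_pow R \<mm> n <+> \<mm> \<cdot> (PIdl f)) R" by (rule add_ideals[OF im imF])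
      have sub: "ideal_pow R \<mm> n \<subseteq> ideal_pow R \<mm> n <+> \<mm> \<cdot> (PIdl f)" "\<mm> \<cdot> (PIdl f) \<subseteq> ideal_pow R \<mm> n <+> \<mm> \<cdot> (PIdl f)"
        by (rule subset_set_add[OF im imF])+
      have "\<mm> \<cdot> (PIdl (A [^] s)) \<subseteq> ideal_pow R \<mm> n <+> \<mm> \<cdot> (PIdl f)"
      proof (rule ideal_prod_subset[OF iT])
        fix z y assume z: "z \<in> \<mm>" and "y \<in> PIdl (A [^] s)"
        then obtain r where r: "r \<in> carrier R" "y = r \<otimes> A [^] s" by (auto simp: PIdl_iff)
        have zc: "z \<in> carrier R" by (rule ideal.Icarr[OF max_ideal z])
        have "z \<otimes> f \<in> \<mm> \<cdot> (PIdl f)" using z cgenideal_self[OF f_closed] by (rule ideal_prod.prod)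
        then have "z \<otimes> f \<in> ideal_pow R \<mm> n <+> \<mm> \<cdot> (PIdl f)" using sub by blast
        moreover have "ideal_cong (ideal_pow R \<mm> n <+> \<mm> \<cdot> (PIdl f)) (z \<otimes> f) (z \<otimes> (u \<otimes> A [^] s))"
          by (intro ideal_cong_mult[OF iT] ideal_cong_refl iT zc ideal_cong_mono[OF A(3)] sub)
        ultimately have "z \<otimes> (u \<otimes> A [^] s) \<in> ideal_pow R \<mm> n <+> \<mm> \<cdot> (PIdl f)"
          using ideal_cong_mem_iff[OF iT] by blast
        then have "u \<otimes> (z \<otimes> A [^] s) \<in> ideal_pow R \<mm> n <+> \<mm> \<cdot> (PIdl f)" using u zc As by (simp add: m_lcomm)
        then have "z \<otimes> A [^] s \<in> ideal_pow R \<mm> n <+> \<mm> \<cdot> (PIdl f)"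
          using mem_if_unit_mult_mem[OF iT u] zc As by simp
        then have "r \<otimes> (z \<otimes> A [^] s) \<in> ideal_pow R \<mm> n <+> \<mm> \<cdot> (PIdl f)"
          using ideal.I_l_closed[OF iT _ r(1)] by blast
        then show "z \<otimes> y \<in> ideal_pow R \<mm> n <+> \<mm> \<cdot> (PIdl f)" using r zc As by (simp add: m_lcomm)
      qed
      then have "f \<in> ideal_pow R \<mm> n <+> \<mm> \<cdot> (PIdl f)"
        using f2 set_add_subset_ideal[OF iT sub(1)] by blast
      then have "PIdl f \<subseteq> ideal_pow R \<mm> n <+> \<mm> \<cdot> (PIdl f)" by (rule cgenideal_minimal[OF iT])
      then have "PIdl f \<subseteq> ideal_pow R \<mm> n" by (rule Nakayama[OF im iF])
      then have "f \<in> ideal_pow R \<mm> n" using cgenideal_self[OF f_closed] by blast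
      moreover have "Suc d \<le> n" unfolding n_def by simp
      ultimately show False using f_ord(2) ideal_pow_antimono[OF max_ideal] by blast
    qed
    then obtain j where j: "j \<in> G" "j \<notin> W" by blast
    have jc: "j \<in> carrier R" using j G by auto
    note ij = cgenideal_ideal[OF jc]
    have "j \<in> ideal_pow R \<mm> n <+> PIdl A" using j(1) GJ A(2) by blast
    then obtain c where c: "c \<in> carrier R" "ideal_cong (ideal_pow R \<mm> n) j (c \<otimes> A)"
      using add_PIdl_cong_iff[OF im A(1)] by blast
    have cm: "c \<notin> \<mm>"
    proof
      assume "c \<in> \<mm>"
      then have "c \<otimes> A \<in> \<mm> \<cdot> (PIdl A)" using cgenideal_self[OF A(1)] by (rule ideal_prod.prod)
      then have "c \<otimes> A \<in> W" unfolding W_def using subset_set_add(2)[OF im imA] by blast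
      moreover have "ideal_cong W j (c \<otimes> A)" unfolding W_def
        by (rule ideal_cong_mono[OF c(2) subset_set_add(1)[OF im imA]])
      ultimately show False using j(2) ideal_cong_mem_iff[OF iW] by blast
    qed
    define V where "V = PIdl j <+> ideal_pow R \<mm> n"
    have iV: "ideal V R" unfolding V_def by (rule add_ideals[OF ij im])
    have V: "PIdl j \<subseteq> V" "ideal_pow R \<mm> n \<subseteq> V" unfolding V_def by (rule subset_set_add[OF ij im])+
    have "j \<in> V" using V(1) cgenideal_self[OF jc] by blast
    then have "c \<otimes> A \<in> V" using ideal_cong_mem_iff[OF iV ideal_cong_mono[OF c(2) V(2)]] by blast
    then have "A \<in> V" by (rule mem_if_unit_mult_mem[OF iV c(1) cm A(1)])
    then have "ideal_pow R \<mm> n <+> PIdl A \<subseteq> V" using V(2) by (intro set_add_subset_ideal iV cgenideal_minimal)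
    then have "J \<subseteq> V" using A(2) by blast
    also have "V \<subseteq> PIdl j <+> ideal_pow R \<mm> (N j)"
      unfolding V_def by (intro set_add_mono subset_refl ideal_pow_antimono[OF max_ideal] nN j(1))
    finally show False using N[OF j(1)] by blast
  qed
  then show ?thesis using that GJ by blast
qed

text \<open>The cofactor v of j^s is a unit by counting orders: j^s already has order at least d,
  which is the order of f.\<close>

lemma f_eq_unit_mult_pow:
  obtains j v where "j \<in> Mq" "v \<in> carrier R" "v \<notin> \<mm>" "f = v \<otimes> j [^] s"
proof -
  obtain J u where J: "ideal J R" "J \<subseteq> Mq" "f \<in> ideal_pow R J s" and u: "u \<in> carrier R" "u \<notin> \<mm>"
    and approx: "\<forall>n. \<exists>A\<in>carrier R. J \<subseteq> ideal_pow R \<mm> n <+> PIdl A \<and> ideal_cong (ideal_pow R \<mm> n) f (u \<otimes> A [^] s)"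
    by (rule exists_root_ideal)
  obtain j where j: "j \<in> J" "J \<subseteq> PIdl j" by (rule root_ideal_principal[OF J(1,3) u approx])
  have jc: "j \<in> carrier R" by (rule ideal.Icarr[OF J(1) j(1)])
  have "f \<in> PIdl (j [^] s)" using J(3) ideal_pow_mono[OF j(2)] PIdl_pow_subset[OF jc] by blast
  then obtain v where v: "v \<in> carrier R" "f = v \<otimes> j [^] s" by (auto simp: PIdl_iff)
  have "j \<in> ideal_pow R \<mm> q" using j(1) J(2) frobenius_pow_subset_ideal_pow[OF max_ideal, of q] by blast
  then have js: "j [^] s \<in> ideal_pow R \<mm> d" unfolding d_eq by (rule pow_mem_ideal_pow_mult[OF max_ideal])
  have "v \<notin> \<mm>"
  proof
    assume "v \<in> \<mm>"
    then have "j [^] s \<otimes> v \<in> ideal_pow R \<mm> (Suc d)" unfolding ideal_pow_Suc using js by (intro ideal_prod.prod)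
    then show False using f_ord(2) v jc m_comm[of v "j [^] s"] by simp
  qed
  then show ?thesis using that j(1) J(2) v by blast
qed

lemma root_cong_param_pow:
  assumes j: "j \<in> Mq" and jq: "j \<notin> ideal_pow R \<mm> (Suc q)"
  obtains x c where "x \<in> X0" "c \<in> carrier R" "c \<notin> \<mm>" "ideal_cong (coord_box q x) j (c \<otimes> x [^] q)"
proof -
  obtain C where C: "C \<in> X0 \<rightarrow> carrier R" "j = (\<Oplus>x\<in>X0. C x \<otimes> x [^] q)"
    "\<And>x. x \<in> X0 \<Longrightarrow> ideal_cong (coord_box q x) j (C x \<otimes> x [^] q)"
    using frob_max_coefficients[OF j[unfolded q_eq]] unfolding q_eq by blast
  have "\<exists>x\<in>X0. C x \<notin> \<mm>"
  proof (rule ccontr)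
    assume "\<not> ?thesis"
    then have Cm: "C x \<in> \<mm>" if "x \<in> X0" for x using that by blast
    have "j \<in> ideal_pow R \<mm> (Suc q)"
      unfolding C(2)
    proof (rule ideal_finsum_closed[OF ideal_pow_ideal[OF max_ideal] finite_params])
      fix x assume x: "x \<in> X0"
      have "x [^] q \<otimes> C x \<in> ideal_pow R \<mm> (Suc q)"
        unfolding ideal_pow_Suc using x params_subset_max by (intro ideal_prod.prod pow_mem_ideal_pow Cm) auto
      then show "C x \<otimes> x [^] q \<in> ideal_pow R \<mm> (Suc q)"
        using x C(1) params_pow_closed[OF x] by (metis PiE m_comm)
    qed
    then show False using jq by simp
  qed
  then obtain x where x: "x \<in> X0" "C x \<notin> \<mm>" by blast
  have "C x \<in> carrier R" using C(1) x by auto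
  then show ?thesis using that x C(3) by blast
qed

text \<open>Take t slightly above p^k / s. Then f^(t-T) h^T lies in \<aa>^t, hence in the ideal of
  j^(p^k) modulo the other parameters, where j can be cancelled. Letting k grow gives h^T in (j^(s
  (T-2))), that is, h^T is divisible by f^T up to the fixed factor f^2, and tight closure removes
  this factor.\<close>

lemma mem_PIdl_f:
  assumes j: "j \<in> Mq" and v: "v \<in> carrier R" "v \<notin> \<mm>" and f_eq: "f = v \<otimes> j [^] s" and h: "h \<in> \<aa>"
  shows "h \<in> PIdl f"
proof -
  have jc: "j \<in> carrier R" and hc: "h \<in> carrier R" using ideal.Icarr[OF Mq_ideal j] ideal.Icarr[OF ideal_a h] by auto
  have vpow: "v [^] (n::nat) \<notin> \<mm>" for n using v primeideal_pow_mem[OF max_prime v(1)] by blast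
  have jpow: "j [^] (n::nat) \<in> carrier R" for n using jc by simp
  have "j \<notin> ideal_pow R \<mm> (Suc q)"
  proof
    assume "j \<in> ideal_pow R \<mm> (Suc q)"
    then have "j [^] s \<in> ideal_pow R \<mm> (Suc q * s)" by (rule pow_mem_ideal_pow_mult[OF max_ideal])
    then have "j [^] s \<in> ideal_pow R \<mm> (Suc d)"
      using ideal_pow_antimono[OF max_ideal, of "Suc d" "Suc q * s"] s_pos d_eq by auto
    then show False
      using f_ord(2) ideal.I_l_closed[OF ideal_pow_ideal[OF max_ideal] _ v(1)] f_eq by blast
  qed
  then obtain x c where x: "x \<in> X0" and c: "c \<in> carrier R" "c \<notin> \<mm>" "ideal_cong (coord_box q x) j (c \<otimes> x [^] q)"
    by (rule root_cong_param_pow[OF j])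
  have xc: "x \<in> carrier R" using x params_carrier by auto
  have iD: "ideal (coord_box n x) R" for n by (rule coord_box_ideal)
  \<comment> \<open>Modulo these powers j^(p^k) is a unit times a power of x, hence cancellable; a
    lower power of j is first completed to j^(p^k).\<close>
  have j_nzd: "z \<in> coord_box (q * p ^ k) x" if z: "z \<in> carrier R" "j [^] m \<otimes> z \<in> coord_box (q * p ^ k) x" "m \<le> p ^ k" for z k m
  proof -
    have "j [^] (p ^ k) \<otimes> z = j [^] (p ^ k - m) \<otimes> (j [^] m \<otimes> z)"
      using z jc by (simp add: m_assoc[symmetric] nat_pow_mult)
    then have 1: "j [^] (p ^ k) \<otimes> z \<in> coord_box (q * p ^ k) x" using ideal.I_l_closed[OF iD z(2)] jpow by metis
    have cxk: "(c \<otimes> x [^] q) [^] (p ^ k) = c [^] (p ^ k) \<otimes> x [^] (q * p ^ k)"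
      using c xc by (simp add: nat_pow_distrib nat_pow_pow)
    have "ideal_cong (coord_box (q * p ^ k) x) (j [^] (p ^ k)) (c [^] (p ^ k) \<otimes> x [^] (q * p ^ k))"
      using frob_cong[OF iD c(3), of k] unfolding frob_coord_box cxk .
    then have "ideal_cong (coord_box (q * p ^ k) x) (j [^] (p ^ k) \<otimes> z) ((c [^] (p ^ k) \<otimes> x [^] (q * p ^ k)) \<otimes> z)"
      by (intro ideal_cong_mult[OF iD] ideal_cong_refl iD z)
    then have "(c [^] (p ^ k) \<otimes> x [^] (q * p ^ k)) \<otimes> z \<in> coord_box (q * p ^ k) x"
      using 1 ideal_cong_mem_iff[OF iD] by blast
    then have "c [^] (p ^ k) \<otimes> (x [^] (q * p ^ k) \<otimes> z) \<in> coord_box (q * p ^ k) x"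
      using c xc z by (simp add: m_assoc)
    moreover have "c [^] (p ^ k) \<notin> \<mm>" using c primeideal_pow_mem[OF max_prime c(1)] by blast
    ultimately have "x [^] (q * p ^ k) \<otimes> z \<in> coord_box (q * p ^ k) x"
      using mem_if_unit_mult_mem[OF iD, of "c [^] (p ^ k)"] c xc z by simp
    then show ?thesis unfolding coord_box_def
      by (rule nonzerodivisor_pow_mod_box[OF partial_primes, rotated 3]) (use x z in auto)
  qed
  have ij: "ideal (PIdl j) R" by (rule cgenideal_ideal[OF jc])
  have iB: "ideal (coord_box q x <+> PIdl j) R" by (rule add_ideals[OF iD ij])
  \<comment> \<open>Inverting the unit c lets j replace x^q as generator of Mq modulo the other
    parameters.\<close>
  have "x [^] q \<in> coord_box q x <+> PIdl j"
  proof -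
    have "j \<in> coord_box q x <+> PIdl j" using subset_set_add(2)[OF iD ij] cgenideal_self[OF jc] by blast
    then have "c \<otimes> x [^] q \<in> coord_box q x <+> PIdl j"
      using ideal_cong_mem_iff[OF iB ideal_cong_mono[OF c(3) subset_set_add(1)[OF iD ij]]] by blast
    then show ?thesis by (rule mem_if_unit_mult_mem[OF iB c(1,2) params_pow_closed[OF x]])
  qed
  then have "PIdl (x [^] q) \<subseteq> coord_box q x <+> PIdl j" by (rule cgenideal_minimal[OF iB])
  moreover have "Mq = coord_box q x <+> PIdl (x [^] q)" unfolding q_eq by (rule frob_max_eq[OF x])
  ultimately have Mq_sub: "Mq \<subseteq> coord_box q x <+> PIdl j"
    using set_add_subset_ideal[OF iB subset_set_add(1)[OF iD ij]] by simp
  have Mqk: "frobenius_pow R \<mm> (p ^ (e + k)) \<subseteq> coord_box (q * p ^ k) x <+> PIdl (j [^] (p ^ k))" for k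
  proof -
    have "frobenius_pow R Mq (p ^ k) \<subseteq> frobenius_pow R (coord_box q x <+> PIdl j) (p ^ k)"
      by (rule frobenius_pow_mono[OF iB Mq_sub])
    also have "\<dots> \<subseteq> frobenius_pow R (coord_box q x) (p ^ k) <+> frobenius_pow R (PIdl j) (p ^ k)"
      by (rule frobenius_pow_add_subset[OF iD ij])
    finally show ?thesis by (simp add: frob_Mq frob_coord_box frobenius_pow_PIdl[OF jc])
  qed
  have key: "h [^] T \<in> PIdl (j [^] (s * (T - 2)))" if T: "T \<ge> 2" for T :: nat
  proof (rule Krull_intersection[OF cgenideal_ideal[OF jpow]])
    show hT: "h [^] T \<in> carrier R" using hc by simp
    fix n
    obtain k r where kr: "n + s * T + 1 \<le> k" "p ^ k = s * r + 1"
      by (rule exists_power_cong_one[OF s_coprime s_pos p_gt_1])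
    have "k < p ^ k" using power_gt_expt[of p k] p_gt_1 by simp
    then have "s * T < s * r" using kr by linarith
    then have Tr: "T < r" by simp
    \<comment> \<open>With r + 1 the product s t would be exactly p^k when s = 1, and
      \<open>small\<close> needs a strict inequality. This is the origin of the 2 in T - 2.\<close>
    define t where "t = r + 2"
    have ts: "s * t = p ^ k + 2 * s - 1" unfolding t_def kr(2) by (simp add: algebra_simps)
    define m where "m = s * (t - T)"
    define g where "g = s * (T - 2) + 1"
    have mg: "m + g = p ^ k"
    proof -
      obtain T' where T': "T = T' + 2" using T le_Suc_ex by (metis add.commute)
      obtain r' where r': "r = T' + r'" using Tr T' by (metis le_Suc_ex add_leD1 less_imp_le)
      show ?thesis unfolding m_def g_def t_def kr(2) T' r' by (simp add: algebra_simps)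
    qed
    have "f [^] (t - T) \<otimes> h [^] T \<in> ideal_pow R \<aa> ((t - T) + T)"
      by (intro ideal_pow_mult_mem ideal_a pow_mem_ideal_pow f_a h)
    also have "(t - T) + T = t" using Tr t_def by simp
    also have "ideal_pow R \<aa> t \<subseteq> frobenius_pow R \<mm> (p ^ (e + k))"
    proof (rule small)
      have "p ^ (e + k) = q * p ^ k" by (simp add: q_eq power_add)
      also have "\<dots> < q * (s * t)" using q_pos s_pos unfolding ts by (intro mult_strict_left_mono) linarith+
      finally show "p ^ (e + k) < d * t" by (simp add: d_eq mult.assoc)
    qed
    also note Mqk[of k]
    finally obtain z where z: "z \<in> carrier R"
      "ideal_cong (coord_box (q * p ^ k) x) (f [^] (t - T) \<otimes> h [^] T) (z \<otimes> j [^] (p ^ k))"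
      using add_PIdl_cong_iff[OF iD jpow] by blast
    define w where "w = v [^] (t - T)"
    have w: "w \<in> carrier R" "w \<notin> \<mm>" unfolding w_def using v vpow by auto
    have fT: "f [^] (t - T) \<otimes> h [^] T = j [^] m \<otimes> (w \<otimes> h [^] T)"
      unfolding f_eq w_def m_def using v jc hT by (simp add: nat_pow_distrib nat_pow_pow m_ac)
    have jz: "z \<otimes> j [^] (p ^ k) = j [^] m \<otimes> (z \<otimes> j [^] g)"
      unfolding mg[symmetric] using z jc by (simp add: nat_pow_mult[symmetric] m_ac)
    have "j [^] m \<otimes> (w \<otimes> h [^] T \<ominus> z \<otimes> j [^] g) \<in> coord_box (q * p ^ k) x"
      using z(2) w hT z jc unfolding fT jz by (simp add: ideal_cong_def r_minus_distr)
    then have "w \<otimes> h [^] T \<ominus> z \<otimes> j [^] g \<in> coord_box (q * p ^ k) x"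
      using mg w hT z jc j_nzd[of "w \<otimes> h [^] T \<ominus> z \<otimes> j [^] g" m k] by simp
    also have "\<dots> \<subseteq> frobenius_pow R \<mm> (p ^ (e + k))"
      using coord_box_subset_frob_max[of "e + k" x] by (simp add: q_eq power_add)
    also have "\<dots> \<subseteq> ideal_pow R \<mm> n" by (rule frobenius_max_subset_pow) (use kr in simp)
    finally have mem: "w \<otimes> h [^] T \<ominus> z \<otimes> j [^] g \<in> ideal_pow R \<mm> n" .
    note ig = cgenideal_ideal[OF jpow[of "s * (T - 2)"]] and im = ideal_pow_ideal[OF max_ideal, of n]
    define V where "V = PIdl (j [^] (s * (T - 2))) <+> ideal_pow R \<mm> n"
    have iV: "ideal V R" unfolding V_def by (rule add_ideals[OF ig im])
    have V: "PIdl (j [^] (s * (T - 2))) \<subseteq> V" "ideal_pow R \<mm> n \<subseteq> V" unfolding V_def by (rule subset_set_add[OF ig im])+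
    have "z \<otimes> j [^] g = (z \<otimes> j) \<otimes> j [^] (s * (T - 2))" unfolding g_def using z jc by (simp add: m_ac)
    then have "z \<otimes> j [^] g \<in> V"
      using V(1) ideal.I_l_closed[OF ig cgenideal_self[OF jpow], of "z \<otimes> j"] z jc by auto
    moreover have "ideal_cong V (w \<otimes> h [^] T) (z \<otimes> j [^] g)"
      using mem V(2) w hT z jc by (auto simp: ideal_cong_def)
    ultimately have "w \<otimes> h [^] T \<in> V" using ideal_cong_mem_iff[OF iV] by blast
    then have "h [^] T \<in> V" by (rule mem_if_unit_mult_mem[OF iV w hT])
    then show "h [^] T \<in> PIdl (j [^] (s * (T - 2))) <+> ideal_pow R \<mm> n" unfolding V_def .
  qed
  have if': "ideal (PIdl f) R" by (rule cgenideal_ideal[OF f_closed])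
  show ?thesis
  \<comment> \<open>The multiplier f^2 compensates the two missing factors. The exponent l = 0 is
    separate because there T = 1 is below 2.\<close>
  proof (rule mem_if_frobenius_multiples[OF if' hc, of "f [^] (2::nat)"])
    show "f [^] (2::nat) \<in> carrier R" using f_closed by simp
    show "f [^] (2::nat) \<noteq> \<zero>" by (rule f_pow_nonzero)
    fix l
    show "f [^] (2::nat) \<otimes> h [^] (p ^ l) \<in> frobenius_pow R (PIdl f) (p ^ l)"
    proof (cases l)
      case 0
      have "f [^] (2::nat) \<otimes> h = (f \<otimes> h) \<otimes> f" using f_closed hc by (simp add: numeral_2_eq_2 m_ac)
      then have "f [^] (2::nat) \<otimes> h \<in> PIdl f" using f_closed hc by (auto simp: PIdl_iff)
      then show ?thesis using 0 frobenius_pow_1[OF if'] hc by simp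
    next
      case (Suc l')
      define T where "T = p ^ l"
      have "p ^ 1 \<le> p ^ l" using Suc p_gt_1 by (intro power_increasing) auto
      then have T: "T \<ge> 2" using p_gt_1 T_def by simp
      obtain z where z: "z \<in> carrier R" "h [^] T = z \<otimes> j [^] (s * (T - 2))" using key[OF T] by (auto simp: PIdl_iff)
      note iT = cgenideal_ideal[OF nat_pow_closed[OF f_closed, of T]]
      have "v [^] (T - 2) \<otimes> (f [^] (2::nat) \<otimes> h [^] T) = z \<otimes> (f [^] (2::nat) \<otimes> f [^] (T - 2))"
      proof -
        have "f [^] (T - 2) = v [^] (T - 2) \<otimes> j [^] (s * (T - 2))"
          unfolding f_eq using v jc by (simp add: nat_pow_distrib nat_pow_pow)
        then show ?thesis unfolding z(2) using v z f_closed jpow by (simp add: m_ac)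
      qed
      also have "f [^] (2::nat) \<otimes> f [^] (T - 2) = f [^] T" 
        using nat_pow_mult[OF f_closed, of 2 "T - 2"] T by (metis le_add_diff_inverse)
      finally have "v [^] (T - 2) \<otimes> (f [^] (2::nat) \<otimes> h [^] T) \<in> PIdl (f [^] T)" using z by (auto simp: PIdl_iff)
      then have "f [^] (2::nat) \<otimes> h [^] T \<in> PIdl (f [^] T)"
        using mem_if_unit_mult_mem[OF iT, of "v [^] (T - 2)"] v vpow f_closed hc by simp
      then show ?thesis unfolding T_def frobenius_pow_PIdl[OF f_closed] .
    qed
  qed
qed

theorem eq_PIdl_pow:
  obtains g where "g \<in> Mq" "\<aa> = PIdl (g [^] s)"
proof -
  obtain j v where j: "j \<in> Mq" and v: "v \<in> carrier R" "v \<notin> \<mm>" and f_eq: "f = v \<otimes> j [^] s"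
    by (rule f_eq_unit_mult_pow)
  have js: "j [^] s \<in> carrier R" using ideal.Icarr[OF Mq_ideal j] by simp
  have "\<aa> \<subseteq> PIdl f" using mem_PIdl_f[OF j v f_eq] by blast
  also have "\<dots> \<subseteq> PIdl (j [^] s)"
    using v f_eq by (intro cgenideal_minimal cgenideal_ideal js) (auto simp: PIdl_iff)
  finally have 1: "\<aa> \<subseteq> PIdl (j [^] s)" .
  have "j [^] s \<in> \<aa>" using mem_if_unit_mult_mem[OF ideal_a v js] f_a f_eq by simp
  then have "PIdl (j [^] s) \<subseteq> \<aa>" by (rule cgenideal_minimal[OF ideal_a])
  then show ?thesis using that j 1 by blast
qed

end

subsection \<open>The \<open>F\<close>-pure threshold\<close>

context frobenius_parameter_ring
begin

text \<open>The lower bound 1/d comes from f alone: if d t < p^k, the order of f^t is too small for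
  \<mm>^[p^k]. Equality is thus an upper bound on the elements of S, and this is the condition on
  the right.\<close>

lemma fpt_eq_iff:
  assumes I: "ideal I R" "I \<subseteq> \<mm>" and f: "f \<in> I" "f \<in> ideal_pow R \<mm> d" "f \<notin> ideal_pow R \<mm> (Suc d)" and d: "d > 0"
  shows "fpt p R \<mm> I = 1 / real d \<longleftrightarrow>
    (\<forall>t k. p ^ k < d * t \<longrightarrow> ideal_pow R I t \<subseteq> frobenius_pow R \<mm> (p ^ k))"
proof -
  define S where "S = {real t / real p ^ k | t k :: nat. \<not> ideal_pow R I t \<subseteq> frobenius_pow R \<mm> (p ^ k)}"
  have fpt: "fpt p R \<mm> I = Sup S" unfolding fpt_def S_def ..
  have pk: "real p ^ k > 0" for k using p_gt_1 by simp
  have S_intro: "real t / real p ^ k \<in> S" if "d * t < p ^ k" for t k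
  proof -
    have "f [^] t \<in> ideal_pow R I t" by (rule pow_mem_ideal_pow[OF f(1)])
    moreover have "frobenius_pow R \<mm> (p ^ k) \<subseteq> ideal_pow R \<mm> (Suc (d * t))"
      using frobenius_max_subset ideal_pow_antimono[OF max_ideal, of "Suc (d * t)" "p ^ k"] that by fastforce
    ultimately have "\<not> ideal_pow R I t \<subseteq> frobenius_pow R \<mm> (p ^ k)"
      using pow_notin_max_pow[OF f(2,3), of t] by blast
    then show ?thesis unfolding S_def by blast
  qed
  have "bdd_above S"
  proof (rule bdd_aboveI)
    fix y assume "y \<in> S"
    then obtain t k where tk: "y = real t / real p ^ k" "\<not> ideal_pow R I t \<subseteq> frobenius_pow R \<mm> (p ^ k)"
      unfolding S_def by auto
    have "t \<le> card X0 * p ^ k"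
    proof (rule ccontr)
      assume t: "\<not> ?thesis"
      have "(\<Sum>x\<in>X0. p ^ k - 1) \<le> card X0 * p ^ k" by simp
      then have "ideal_pow R \<mm> t \<subseteq> frobenius_pow R \<mm> (p ^ k)"
        unfolding frob_max using t by (intro max_pow_subset_box) linarith
      then show False using tk(2) ideal_pow_mono[OF I(2), of t] by blast
    qed
    then have "real t \<le> real (card X0 * p ^ k)" by (rule of_nat_mono)
    then have "real t \<le> real (card X0) * real p ^ k" by simp
    then show "y \<le> real (card X0)" unfolding tk(1) pos_divide_le_eq[OF pk] .
  qed
  have "S \<noteq> {}" using S_intro[of 0 0] by auto
  have lower: "1 / real d \<le> Sup S"
  proof (rule field_le_epsilon)
    fix \<epsilon> :: real assume "\<epsilon> > 0"
    then obtain k where k: "1 / \<epsilon> < real k" using reals_Archimedean2 by blast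
    have "k < p ^ k" using power_gt_expt[of p k] p_gt_1 by simp
    then have "real k < real (p ^ k)" by (simp only: of_nat_less_iff)
    then have "1 / \<epsilon> < real (p ^ k)" using k by linarith
    then have "1 / \<epsilon> < real p ^ k" by simp
    moreover have "1 / P \<le> \<epsilon>" if "1 / \<epsilon> < P" "P > 0" for P :: real
      using that \<open>\<epsilon> > 0\<close> by (simp add: field_simps)
    ultimately have eps: "1 / real p ^ k \<le> \<epsilon>" using pk by blast
    \<comment> \<open>The largest t with d t < p^k; then t / p^k misses 1/d by at most 1 /
      p^k.\<close>
    define t where "t = (p ^ k - 1) div d"
    have t1: "d * t \<le> p ^ k - 1" unfolding t_def by (rule times_div_less_eq_dividend)
    have t2: "p ^ k - 1 < d * t + d"
      unfolding t_def using d dividend_less_times_div[of d "p ^ k - 1"] by simp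
    have "d * t < p ^ k" using t1 pk_pos[of k] by linarith
    then have mem: "real t / real p ^ k \<in> S" by (rule S_intro)
    have "p ^ k \<le> d * t + d" using t2 by linarith
    then have "real (p ^ k) \<le> real (d * t + d)" by (rule of_nat_mono)
    then have "real p ^ k \<le> real d * real t + real d" by simp
    moreover have "1 / D \<le> T / P + 1 / P" if "P \<le> D * T + D" "D > 0" "P > 0" for D T P :: real
      using that by (simp add: field_simps)
    ultimately have "1 / real d \<le> real t / real p ^ k + 1 / real p ^ k"
      using d pk[of k] by simp
    then show "1 / real d \<le> Sup S + \<epsilon>" using cSup_upper[OF mem \<open>bdd_above S\<close>] eps by linarith
  qed
  have elem_le: "real t / real p ^ k \<le> 1 / real d \<longleftrightarrow> \<not> p ^ k < d * t" for t k
  proof -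
    have "real t / real p ^ k \<le> 1 / real d \<longleftrightarrow> real (d * t) \<le> real (p ^ k)"
      using d pk[of k] by (simp add: field_simps)
    then show ?thesis by (metis linorder_not_less of_nat_le_iff)
  qed
  have "Sup S = 1 / real d \<longleftrightarrow> (\<forall>y\<in>S. y \<le> 1 / real d)"
    using cSup_upper[OF _ \<open>bdd_above S\<close>] cSup_least[OF \<open>S \<noteq> {}\<close>] lower by (metis order_antisym)
  also have "\<dots> \<longleftrightarrow> (\<forall>t k. \<not> ideal_pow R I t \<subseteq> frobenius_pow R \<mm> (p ^ k) \<longrightarrow> \<not> p ^ k < d * t)"
    unfolding S_def using elem_le by blast
  finally show ?thesis unfolding fpt by blast
qed

text \<open>The easy direction of the theorem. For e at most k the inequality can be divided by p^e;
  for larger e already g lies in \<mm>^[p^k].\<close>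

lemma PIdl_pow_small:
  assumes g: "g \<in> frobenius_pow R \<mm> (p ^ e)" and s: "s > 0" and lt: "p ^ k < p ^ e * s * t"
  shows "ideal_pow R (PIdl (g [^] s)) t \<subseteq> frobenius_pow R \<mm> (p ^ k)"
proof -
  have iF: "ideal (frobenius_pow R \<mm> (p ^ k)) R" for k by (rule frobenius_pow_ideal[OF max_ideal])
  have gc: "g \<in> carrier R" by (rule ideal.Icarr[OF iF g])
  have "g [^] (s * t) \<in> frobenius_pow R \<mm> (p ^ k)"
  proof (cases "e \<le> k")
    case True
    then obtain l where l: "k = e + l" using le_Suc_ex by blast
    have "g [^] (p ^ l) \<in> frobenius_pow R \<mm> (p ^ k)"
      unfolding l frob_frob[OF max_ideal, symmetric] by (rule pow_mem_frobenius_pow[OF iF g])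
    moreover have "p ^ e * p ^ l < p ^ e * (s * t)" using lt by (simp add: l power_add mult.assoc)
    then have "p ^ l \<le> s * t" by simp
    ultimately show ?thesis using pow_mem_ideal[OF iF gc] by blast
  next
    case False
    then obtain l where l: "e = l + k" using le_Suc_ex by (metis add.commute nat_le_linear)
    have "frobenius_pow R \<mm> (p ^ e) \<subseteq> frobenius_pow R \<mm> (p ^ k)"
      unfolding l frob_frob[OF max_ideal, symmetric] by (rule frobenius_pow_mono[OF max_ideal frobenius_max_subset_max])
    then have "g [^] (1::nat) \<in> frobenius_pow R \<mm> (p ^ k)" using g gc by auto
    moreover have "1 \<le> s * t" using lt by (cases "s * t") auto
    ultimately show ?thesis using pow_mem_ideal[OF iF gc] by blast
  qed
  then have "PIdl (g [^] (s * t)) \<subseteq> frobenius_pow R \<mm> (p ^ k)" by (rule cgenideal_minimal[OF iF])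
  then show ?thesis using PIdl_pow_subset[of "g [^] s" t] gc by (simp add: nat_pow_pow)
qed

end

text \<open>\<open>GREATEST\<close> is meaningful here because a nonzero element of I lies outside
  some power of \<mm>, which bounds the candidates.\<close>

lemma (in noetherian_local_ring) ideal_ord_props:
  assumes I: "ideal I R" "I \<noteq> {\<zero>}"
  shows "I \<subseteq> ideal_pow R \<mm> (ideal_ord R \<mm> I)" "\<not> I \<subseteq> ideal_pow R \<mm> (Suc (ideal_ord R \<mm> I))"
proof -
  obtain y where y: "y \<in> I" "y \<noteq> \<zero>" using I ideal_zero_mem by blast
  have "\<exists>n. y \<notin> ideal_pow R \<mm> n" using Krull_intersection_zero[OF ideal.Icarr[OF I(1) y(1)]] y(2) by blast
  then obtain n where n: "y \<notin> ideal_pow R \<mm> n" by blast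
  have bound: "m \<le> n" if "I \<subseteq> ideal_pow R \<mm> m" for m
    using that y(1) n ideal_pow_antimono[OF max_ideal, of n m] by (meson nat_le_linear subsetD)
  have "I \<subseteq> ideal_pow R \<mm> 0" using ideal_subset_carrier[OF I(1)] by simp
  then show "I \<subseteq> ideal_pow R \<mm> (ideal_ord R \<mm> I)"
    unfolding ideal_ord_def by (rule GreatestI_nat[where P = "\<lambda>m. I \<subseteq> ideal_pow R \<mm> m"]) (rule bound)
  show "\<not> I \<subseteq> ideal_pow R \<mm> (Suc (ideal_ord R \<mm> I))"
  proof
    assume "I \<subseteq> ideal_pow R \<mm> (Suc (ideal_ord R \<mm> I))"
    then have "Suc (ideal_ord R \<mm> I) \<le> ideal_ord R \<mm> I"
      unfolding ideal_ord_def[of R \<mm> I] by (rule Greatest_le_nat[where P = "\<lambda>m. I \<subseteq> ideal_pow R \<mm> m"]) (rule bound)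
    then show False by simp
  qed
qed

theorem mainTheorem1:
  fixes R :: "('a, 'b) ring_scheme" (structure)
    and \<mm> \<aa> :: "'a set"
    and p d q s e :: nat
  assumes "regular_local_ring R \<mm>"
    and "Factorial_Ring.prime p" and "ring_char R = p"
    and "F_finite p R"
    and "ideal \<aa> R" and "\<aa> \<noteq> {\<zero>}" and "\<aa> \<noteq> carrier R"
    and "d = ideal_ord R \<mm> \<aa>"
    and "d = q * s" and "q = p ^ e" and "s > 0" and "coprime s p"
  shows "fpt p R \<mm> \<aa> = 1 / real d \<longleftrightarrow>
    principalideal \<aa> R \<and> (\<exists>g \<in> frobenius_pow R \<mm> q. \<aa> = PIdl (g [^] s))"
proof -
  interpret regular_local_ring R \<mm> by (rule assms(1))
  obtain X0 where X0: "partial_primes X0" "\<mm> = Idl X0" by (rule regular_parameters)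
  have p: "p > 1" using assms(2) by (rule prime_gt_1_nat)
  interpret frobenius_parameter_ring R \<mm> X0 p
    by unfold_locales (rule X0 p assms(4))+
  note a = assms(5)
  have am: "\<aa> \<subseteq> \<mm>" by (rule proper_ideal_subset_max[OF a assms(7)])
  obtain f where f: "f \<in> \<aa>" "f \<in> ideal_pow R \<mm> d" "f \<notin> ideal_pow R \<mm> (Suc d)"
    using ideal_ord_props[OF a assms(6)] unfolding assms(8) by blast
  have d: "d > 0" using assms(9-11) p by simp
  note iff = fpt_eq_iff[OF a am f d]
  show ?thesis
  proof
    assume "fpt p R \<mm> \<aa> = 1 / real d"
    then have small: "\<forall>t k. p ^ k < d * t \<longrightarrow> ideal_pow R \<aa> t \<subseteq> frobenius_pow R \<mm> (p ^ k)"
      using iff by blast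
    interpret small_fpt R \<mm> X0 p \<aa> d q s e f
    proof (intro small_fpt.intro small_fpt_axioms.intro)
      show "ideal_pow R \<aa> t \<subseteq> frobenius_pow R \<mm> (p ^ k)" if "p ^ k < d * t" for k t
        using small that by blast
    qed (rule frobenius_parameter_ring_axioms a assms(9-12) f)+
    obtain g where g: "g \<in> frobenius_pow R \<mm> q" "\<aa> = PIdl (g [^] s)" by (rule eq_PIdl_pow)
    have "g [^] s \<in> carrier R" using ideal.Icarr[OF Mq_ideal g(1)] by simp
    then have "principalideal \<aa> R" unfolding g(2) by (rule cgenideal_is_principalideal)
    then show "principalideal \<aa> R \<and> (\<exists>g \<in> frobenius_pow R \<mm> q. \<aa> = PIdl (g [^] s))" using g by blast
  next
    assume "principalideal \<aa> R \<and> (\<exists>g \<in> frobenius_pow R \<mm> q. \<aa> = PIdl (g [^] s))"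
    then obtain g where g: "g \<in> frobenius_pow R \<mm> (p ^ e)" "\<aa> = PIdl (g [^] s)" using assms(10) by blast
    have "ideal_pow R \<aa> t \<subseteq> frobenius_pow R \<mm> (p ^ k)" if "p ^ k < d * t" for t k
      unfolding g(2) by (rule PIdl_pow_small[OF g(1) assms(11)]) (use that assms(9,10) in simp)
    then show "fpt p R \<mm> \<aa> = 1 / real d" using iff by blast
  qed
qed

end
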